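(* Let $N\ge 1$. The subalgebra $\mathcal S(N)^{\mathrm{OSp}(V)}$ of $\mathrm{OSp}(V)$-invariants in $\mathcal S(N)$ has the following multiplicity free decomposition as a $\mathfrak{gl}_N$-module: $$\mathcal S(N)^{\mathrm{OSp}(V)}=\bigoplus_\lambda L_\lambda,$$ where $L_\lambda$ is the simple $\mathfrak{gl}_N$-module with highest weight $\lambda$, and the sum is over all partitions $\lambda$ of length $\le N$ all of whose parts are even and which satisfy $\lambda_{m+1}\le 2n$. Furthermore, for each such $\lambda$, written as $\lambda=2\sum_{i=1}^N\ell_i\omega_i$ with $\ell_i\in\mathbb Z_{\ge0}$, the element $D_\lambda=\prod_{i=1}^N D(i)^{\ell_i}$ is a highest weight vector of $L_\lambda$.
   Context: Setting. Let $m,n\ge 0$ and let $V=V_{\bar0}\oplus V_{\bar1}=\mathbb C^{m|2n}$ be the complex superspace with standard basis $e_1,\dots,e_m$ (even), $e_{m+1},\dots,e_{m+2n}$ (odd), with the even non-degenerate supersymmetric bilinear form $(e_i,e_j)=\kappa_{ij}$, where $\kappa=\begin{pmatrix} I_m&0\\0&\eta\end{pmatrix}$, $\eta=\begin{pmatrix}0&I_n\\-I_n&0\end{pmatrix}$. $\mathfrak{osp}(V)\subset\mathfrak{gl}(V)$ is the Lie superalgebra preserving this form: it is spanned by homogeneous $Y$ with $(Yv,w)+(-1)^{[Y][v]}(v,Yw)=0$ for all homogeneous $v,w\in V$, where $[\ ]$ denotes parity. $\mathrm{OSp}(V)$ is the Harish-Chandra super pair $(\mathrm{OSp}(V)_0,\mathfrak{osp}(V))$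 with $\mathrm{OSp}(V)_0=\mathrm O(V_{\bar0})\times\mathrm{Sp}(V_{\bar1})$. An $\mathrm{OSp}(V)$-invariant is an element annihilated by $\mathfrak{osp}(V)$ and fixed by $\mathrm{OSp}(V)_0$. $\mathcal S(N)$ is the symmetric superalgebra of $V\otimes\mathbb C^N$ ($\mathbb C^N$ purely even, with standard basis $f_1,\dots,f_N$), i.e. the free supercommutative superalgebra on $X^a_t=e_a\otimes f_t$ ($1\le a\le m+2n$, $1\le t\le N$). The groups and Lie (super)algebras $\mathrm{OSp}(V)_0$, $\mathfrak{osp}(V)\subset\mathfrak{gl}(V)$, $\mathfrak{gl}_N$ act on $\mathcal S(N)$ by automorphisms, respectively (super)derivations, extending the natural actions on $V\otimes\mathbb C^N$; the standard basis of $\mathfrak{gl}_N$ acts by $E_{st}=\sum_{a}X^a_s\,\partial/\partial X^a_t$. The actions of $\mathrm{OSp}(V)$ and $\mathfrak{gl}_N$ commute. Put $q_{ts}=\sum_{a,b}X_t^a(\kappa^{-1})_{ab}X_s^b$ (an even element), $Q(k)=(q_{ij})_{1\le i,j\le k}$, $D(k)=\det Q(k)$. $\omega_i=(1,\dots,1,0,\dots,0)$ ($i$ ones) is the $i$-th fundamental weight of $\mathfrak{gl}_N$. Highest weight vectors of $\mathfrak{gl}_N$ are nonzero weight vectors killed by $E_{ij}$, $i<j$. Parts $\lambda_k$ with $k$ larger than the length of $\lambda$ are $0$. *)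

theory Defs
  imports
    "HOL-Library.Poly_Mapping"
    "HOL-Library.Multiset"
    "HOL-Library.FSet"
    "HOL-Combinatorics.Permutations"
    "Jordan_Normal_Form.Matrix"
begin

section \<open>Free supercommutative superalgebras\<close>

text \<open>
  The type \<open>'i superpoly\<close> is the free supercommutative complex superalgebra on even generators
  \<open>even_gen i\<close> and odd generators \<open>odd_gen i\<close>, both indexed by the type \<open>'i\<close>. A pair \<open>(\<mu>, A)\<close>
  encodes the monomial consisting of the even generators in \<open>\<mu>\<close> (with multiplicity) times the
  product of the odd generators in \<open>A\<close> in increasing order of their indices; these monomials form
  a basis.
\<close>

type_synonym 'i smonom = "'i multiset \<times> 'i fset"

typedef 'i superpoly = "UNIV :: ('i smonom \<Rightarrow>\<^sub>0 complex) set"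
  morphisms superpoly_coeffs Superpoly ..

setup_lifting type_definition_superpoly

lift_definition scoeff :: "'i superpoly \<Rightarrow> 'i smonom \<Rightarrow> complex" is Poly_Mapping.lookup .
lift_definition ssupport :: "'i superpoly \<Rightarrow> 'i smonom set" is Poly_Mapping.keys .
lift_definition smon :: "'i smonom \<Rightarrow> 'i superpoly" is "\<lambda>u. Poly_Mapping.single u 1" .
lift_definition scale :: "complex \<Rightarrow> 'i superpoly \<Rightarrow> 'i superpoly" is
  "\<lambda>c. Poly_Mapping.map ((*) c)" .

instantiation superpoly :: (type) ab_group_add
begin
lift_definition zero_superpoly :: "'a superpoly" is 0 .
lift_definition plus_superpoly :: "'a superpoly \<Rightarrow> 'a superpoly \<Rightarrow> 'a superpoly" is "(+)" .
lift_definition minus_superpoly :: "'a superpoly \<Rightarrow> 'a superpoly \<Rightarrow> 'a superpoly" is "(-)" .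
lift_definition uminus_superpoly :: "'a superpoly \<Rightarrow> 'a superpoly" is uminus .
instance
  by standard (transfer; simp add: algebra_simps)+
end

lemma scoeff_simps [simp]:
  "scoeff 0 u = 0" "scoeff (p + q) u = scoeff p u + scoeff q u"
  "scoeff (p - q) u = scoeff p u - scoeff q u" "scoeff (- p) u = - scoeff p u"
  "scoeff (scale c p) u = c * scoeff p u" "scoeff (smon v) u = (if v = u then 1 else 0)"
  by (transfer; simp add: lookup_add lookup_minus Poly_Mapping.map.rep_eq lookup_single when_def)+

lemma superpoly_eqI: "(\<And>u. scoeff p u = scoeff q u) \<Longrightarrow> p = q"
  by transfer (rule poly_mapping_eqI)

lemma finite_support [simp]: "finite (ssupport p)"
  by transfer simp

lemma in_support_iff: "u \<in> ssupport p \<longleftrightarrow> scoeff p u \<noteq> 0"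
  by transfer (simp add: in_keys_iff)

interpretation superpoly: vector_space scale
  by standard (auto intro!: superpoly_eqI simp: algebra_simps)

definition lin_ext :: "('i smonom \<Rightarrow> 'j superpoly) \<Rightarrow> 'i superpoly \<Rightarrow> 'j superpoly" where
  "lin_ext F p = (\<Sum>u\<in>ssupport p. scale (scoeff p u) (F u))"

lemma lin_ext_superset:
  assumes "finite S" "ssupport p \<subseteq> S"
  shows "lin_ext F p = (\<Sum>u\<in>S. scale (scoeff p u) (F u))"
  unfolding lin_ext_def using assms
  by (intro sum.mono_neutral_left) (auto simp: in_support_iff)

lemma lin_ext_add: "lin_ext F (p + q) = lin_ext F p + lin_ext F q"
proof -
  let ?S = "ssupport p \<union> ssupport q"
  have "ssupport (p + q) \<subseteq> ?S" by (auto simp: in_support_iff)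
  then show ?thesis
    by (simp add: lin_ext_superset[of ?S] superpoly.scale_left_distrib sum.distrib)
qed

lemma lin_ext_scale: "lin_ext F (scale c p) = scale c (lin_ext F p)"
proof -
  have "ssupport (scale c p) \<subseteq> ssupport p" by (auto simp: in_support_iff)
  then show ?thesis
    by (simp add: lin_ext_superset[of "ssupport p"] superpoly.scale_sum_right)
qed

lemma lin_ext_zero [simp]: "lin_ext F 0 = 0"
  by (simp add: lin_ext_def in_support_iff)

lemma lin_ext_mon [simp]: "lin_ext F (smon u) = F u"
proof -
  have "ssupport (smon u) \<subseteq> {u}" by (auto simp: in_support_iff split: if_splits)
  then show ?thesis by (simp add: lin_ext_superset[of "{u}"])
qed

lemma superpoly_expand: "p = (\<Sum>u\<in>ssupport p. scale (scoeff p u) (smon u))"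
proof (rule superpoly_eqI)
  have scoeff_sum: "scoeff (sum f S) u = (\<Sum>x\<in>S. scoeff (f x) u)" for f :: "'b \<Rightarrow> 'a superpoly" and S u
    by (induction S rule: infinite_finite_induct) auto
  fix u
  have "(\<Sum>x\<in>ssupport p. scoeff p x * (if x = u then 1 else 0)) =
        (\<Sum>x\<in>ssupport p. if x = u then scoeff p x else 0)"
    by (intro sum.cong) auto
  then show "scoeff p u = scoeff (\<Sum>u\<in>ssupport p. scale (scoeff p u) (smon u)) u"
    by (simp add: scoeff_sum) (simp add: in_support_iff)
qed

lemma superpoly_induct [case_names zero add scale smon]:
  assumes "P 0" "\<And>p q. P p \<Longrightarrow> P q \<Longrightarrow> P (p + q)"
    "\<And>c p. P p \<Longrightarrow> P (scale c p)" "\<And>u. P (smon u)"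
  shows "P p"
proof -
  have "P (\<Sum>u\<in>S. scale (scoeff p u) (smon u))" if "finite S" for S
    using that by (induction S) (auto intro: assms)
  then show ?thesis by (subst superpoly_expand) simp
qed

text \<open>
  Number of transpositions needed to bring the product of the odd generators in \<open>A\<close>, followed by
  that of the odd generators in \<open>B\<close>, into increasing order (for disjoint \<open>A\<close>, \<open>B\<close>).
\<close>

definition inversions :: "'i::linorder fset \<Rightarrow> 'i fset \<Rightarrow> nat" where
  "inversions A B = card {(a, b). a |\<in>| A \<and> b |\<in>| B \<and> b < a}"

definition mon_mult :: "'i::linorder smonom \<Rightarrow> 'i smonom \<Rightarrow> 'i superpoly" where
  "mon_mult u v = (if snd u |\<inter>| snd v = {||}
     then scale ((-1) ^ inversions (snd u) (snd v)) (smon (fst u + fst v, snd u |\<union>| snd v))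
     else 0)"

lemma inversions_empty [simp]: "inversions {||} A = 0" "inversions A {||} = 0"
  by (simp_all add: inversions_def)

lemma inversions_union_left:
  assumes "A |\<inter>| B = {||}"
  shows "inversions (A |\<union>| B) C = inversions A C + inversions B C"
proof -
  have fin: "finite {(a, b). a |\<in>| X \<and> b |\<in>| C \<and> b < a}" for X
    by (rule finite_subset[of _ "fset X \<times> fset C"]) auto
  have "{(a, b). a |\<in>| A |\<union>| B \<and> b |\<in>| C \<and> b < a} =
    {(a, b). a |\<in>| A \<and> b |\<in>| C \<and> b < a} \<union> {(a, b). a |\<in>| B \<and> b |\<in>| C \<and> b < a}" by auto
  moreover have "{(a, b). a |\<in>| A \<and> b |\<in>| C \<and> b < a} \<inter> {(a, b). a |\<in>| B \<and> b |\<in>| C \<and> b < a} = {}"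
    using assms by (auto simp: fset_eq_iff)
  ultimately show ?thesis
    unfolding inversions_def by (simp add: card_Un_disjoint fin)
qed

lemma inversions_union_right:
  assumes "B |\<inter>| C = {||}"
  shows "inversions A (B |\<union>| C) = inversions A B + inversions A C"
proof -
  have fin: "finite {(a, b). a |\<in>| A \<and> b |\<in>| X \<and> b < a}" for X
    by (rule finite_subset[of _ "fset A \<times> fset X"]) auto
  have "{(a, b). a |\<in>| A \<and> b |\<in>| B |\<union>| C \<and> b < a} =
    {(a, b). a |\<in>| A \<and> b |\<in>| B \<and> b < a} \<union> {(a, b). a |\<in>| A \<and> b |\<in>| C \<and> b < a}" by auto
  moreover have "{(a, b). a |\<in>| A \<and> b |\<in>| B \<and> b < a} \<inter> {(a, b). a |\<in>| A \<and> b |\<in>| C \<and> b < a} = {}"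
    using assms by (auto simp: fset_eq_iff)
  ultimately show ?thesis
    unfolding inversions_def by (simp add: card_Un_disjoint fin)
qed

lemma inversions_single [simp]: "inversions {|x|} {|y|} = (if y < x then 1 else 0)"
proof -
  have "{(a, b). a |\<in>| {|x|} \<and> b |\<in>| {|y|} \<and> b < a} = (if y < x then {(x, y)} else {})"
    by auto
  then show ?thesis by (simp add: inversions_def)
qed

lemma lin_ext_add_fun: "lin_ext (\<lambda>u. F u + G u) p = lin_ext F p + lin_ext G p"
  by (simp add: lin_ext_def superpoly.scale_right_distrib sum.distrib)

lemma lin_ext_scale_fun: "lin_ext (\<lambda>u. scale c (F u)) p = scale c (lin_ext F p)"
  by (simp add: lin_ext_def superpoly.scale_sum_right mult.commute)

lemma lin_ext_zero_fun [simp]: "lin_ext (\<lambda>u. 0) p = 0"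
  by (simp add: lin_ext_def)

instantiation superpoly :: (linorder) ring_1
begin

definition one_superpoly :: "'a superpoly" where
  "1 = smon ({#}, {||})"

definition times_superpoly :: "'a superpoly \<Rightarrow> 'a superpoly \<Rightarrow> 'a superpoly" where
  "p * q = lin_ext (\<lambda>u. lin_ext (mon_mult u) q) p"

instance
proof
  fix a b c :: "'a superpoly"
  have dl: "(p + q) * r = p * r + q * r" and sl: "scale x p * r = scale x (p * r)"
    and dr: "r * (p + q) = r * p + r * q" and sr: "r * scale x p = scale x (r * p)"
    and zl: "0 * r = 0" and zr: "r * 0 = 0"
    for p q r :: "'a superpoly" and x
    by (simp_all add: times_superpoly_def lin_ext_add lin_ext_scale lin_ext_add_fun lin_ext_scale_fun)
  have mm: "smon u * smon v = mon_mult u v" for u v :: "'a smonom"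
    by (simp add: times_superpoly_def)
  show "(a + b) * c = a * c + b * c" "a * (b + c) = a * b + a * c" by (fact dl dr)+
  show "1 * a = a"
    by (induction a rule: superpoly_induct)
      (simp_all add: dr sr zr one_superpoly_def mm mon_mult_def)
  show "a * 1 = a"
    by (induction a rule: superpoly_induct)
      (simp_all add: dl sl zl one_superpoly_def mm mon_mult_def)
  show "(0 :: 'a superpoly) \<noteq> 1"
  proof
    assume "(0 :: 'a superpoly) = 1"
    then have "scoeff (0 :: 'a superpoly) ({#}, {||}) = scoeff 1 ({#}, {||})" by simp
    then show False by (simp add: one_superpoly_def)
  qed
  have base: "smon u * smon v * smon w = smon u * (smon v * smon w)" for u v w :: "'a smonom"
  proof (cases "snd u |\<inter>| snd v = {||} \<and> snd u |\<inter>| snd w = {||} \<and> snd v |\<inter>| snd w = {||}")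
    case True
    then show ?thesis
      by (simp add: mm mon_mult_def sl sr inversions_union_left inversions_union_right
          inf_sup_distrib1 inf_sup_distrib2 power_add mult_ac add_ac sup_assoc)
  next
    case False
    then show ?thesis
      by (auto simp: mm mon_mult_def sl sr zl zr inf_sup_distrib1 inf_sup_distrib2)
  qed
  have "smon u * smon v * p = smon u * (smon v * p)" for u v and p :: "'a superpoly"
    by (induction p rule: superpoly_induct) (simp_all add: base dr sr zr)
  then have "smon u * p * q = smon u * (p * q)" for u and p q :: "'a superpoly"
    by (induction p rule: superpoly_induct) (simp_all add: dl dr sr sl zl zr)
  then show "a * b * c = a * (b * c)"
    by (induction a rule: superpoly_induct) (simp_all add: dl sl zl)
qed

end

lemma scale_mult: "scale c p * q = scale c (p * q)" "p * scale c q = scale c (p * q)"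
  by (simp_all add: times_superpoly_def lin_ext_scale lin_ext_scale_fun)

lemma mon_mult_mon: "smon u * smon v = mon_mult u v"
  by (simp add: times_superpoly_def)

definition even_gen :: "'i \<Rightarrow> 'i superpoly" where
  "even_gen i = smon ({#i#}, {||})"

definition odd_gen :: "'i \<Rightarrow> 'i superpoly" where
  "odd_gen i = smon ({#}, {|i|})"

lemma even_gen_central: "even_gen i * p = p * even_gen i"
  by (induction p rule: superpoly_induct)
    (simp_all add: algebra_simps scale_mult even_gen_def mon_mult_mon mon_mult_def)

lemma odd_gen_anticommute: "odd_gen i * odd_gen j = - (odd_gen j * odd_gen i)"
  by (cases i j rule: linorder_cases)
    (auto simp: odd_gen_def mon_mult_mon mon_mult_def finsert_commute)

definition parity_inv :: "'i superpoly \<Rightarrow> 'i superpoly" where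
  "parity_inv = lin_ext (\<lambda>(\<mu>, A). scale ((-1) ^ fcard A) (smon (\<mu>, A)))"

definition superpoly_even :: "'i superpoly \<Rightarrow> bool" where
  "superpoly_even p \<longleftrightarrow> parity_inv p = p"

definition superpoly_odd :: "'i superpoly \<Rightarrow> bool" where
  "superpoly_odd p \<longleftrightarrow> parity_inv p = - p"

lemma par_add: "parity_inv (p + q) = parity_inv p + parity_inv q"
  and par_scale: "parity_inv (scale c p) = scale c (parity_inv p)"
  and par_zero [simp]: "parity_inv 0 = 0"
  and par_smon: "parity_inv (smon u) = scale ((-1) ^ fcard (snd u)) (smon u)"
  by (simp_all add: parity_inv_def lin_ext_add lin_ext_scale case_prod_beta)

lemma inversions_swap:
  assumes "A |\<inter>| B = {||}"
  shows "inversions A B + inversions B A = fcard A * fcard B"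
proof -
  let ?X = "{(a, b). a |\<in>| A \<and> b |\<in>| B \<and> b < a}" and ?Y = "{(a, b). a |\<in>| B \<and> b |\<in>| A \<and> b < a}"
  have fin: "finite ?X" "finite ?Y"
    by (rule finite_subset[of _ "fset A \<times> fset B"], auto)
      (rule finite_subset[of _ "fset B \<times> fset A"], auto)
  have "card ?Y = card (prod.swap ` ?Y)" by (simp add: card_image)
  moreover have "fset A \<times> fset B = ?X \<union> prod.swap ` ?Y"
  proof (intro equalityI subsetI)
    fix z assume "z \<in> fset A \<times> fset B"
    then obtain a b where z: "z = (a, b)" "a |\<in>| A" "b |\<in>| B" by auto
    then have "a \<noteq> b" using assms by (auto simp: fset_eq_iff)
    then have "b < a \<or> a < b" by auto
    then show "z \<in> ?X \<union> prod.swap ` ?Y"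
      using z by (auto simp: image_iff)
  qed auto
  moreover have "?X \<inter> prod.swap ` ?Y = {}" by auto
  ultimately have "card (fset A \<times> fset B) = card ?X + card ?Y"
    using fin by (simp add: card_Un_disjoint)
  then show ?thesis by (simp add: inversions_def fcard.rep_eq card_cartesian_product)
qed

lemma neg_one_power_swap:
  assumes "a + b = (c :: nat)"
  shows "(-1 :: complex) ^ a = (-1) ^ c * (-1) ^ b"
proof -
  have "(-1 :: complex) ^ (b * 2) = 1" by (simp add: power_mult mult.commute[of b])
  then show ?thesis
    using assms by (auto simp: power_add power_mult power2_eq_square mult.assoc simp flip: power_mult_distrib)
qed

lemma supercommutative:
  "smon u * smon v = scale ((-1) ^ (fcard (snd u) * fcard (snd v))) (smon v * smon u)"
proof (cases "snd u |\<inter>| snd v = {||}")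
  case True
  then have "snd v |\<inter>| snd u = {||}" by (simp add: inf_commute)
  then show ?thesis
    using neg_one_power_swap[OF inversions_swap[OF True]] True
    by (simp add: mon_mult_mon mon_mult_def add.commute sup_commute)
next
  case False
  then have "snd v |\<inter>| snd u \<noteq> {||}" by (simp add: inf_commute)
  with False show ?thesis by (simp add: mon_mult_mon mon_mult_def)
qed

subsection \<open>Partial derivatives\<close>

text \<open>
  \<open>deriv_odd i\<close> is the left derivative, an odd superderivation; see \<open>deriv_odd_mult\<close>.
\<close>

definition deriv_even :: "'i \<Rightarrow> 'i superpoly \<Rightarrow> 'i superpoly" where
  "deriv_even i = lin_ext (\<lambda>(\<mu>, A). scale (of_nat (count \<mu> i)) (smon (\<mu> - {#i#}, A)))"

definition deriv_odd :: "'i::linorder \<Rightarrow> 'i superpoly \<Rightarrow> 'i superpoly" where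
  "deriv_odd i = lin_ext (\<lambda>(\<mu>, A). if i |\<in>| A
     then scale ((-1) ^ inversions {|i|} A) (smon (\<mu>, A |-| {|i|})) else 0)"

lemma deriv_add: "deriv_even i (p + q) = deriv_even i p + deriv_even i q"
    "deriv_odd i' (p' + q') = deriv_odd i' p' + deriv_odd i' q'"
  and deriv_scale: "deriv_even i (scale c p) = scale c (deriv_even i p)"
    "deriv_odd i' (scale c p') = scale c (deriv_odd i' p')"
  and deriv_zero [simp]: "deriv_even i 0 = 0" "deriv_odd i' 0 = 0"
  and deriv_smon: "deriv_even i (smon u) = scale (of_nat (count (fst u) i)) (smon (fst u - {#i#}, snd u))"
    "deriv_odd i' (smon u') = (if i' |\<in>| snd u'
       then scale ((-1) ^ inversions {|i'|} (snd u')) (smon (fst u', snd u' |-| {|i'|})) else 0)"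
  by (simp_all add: deriv_even_def deriv_odd_def lin_ext_add lin_ext_scale case_prod_beta)

lemma deriv_gen:
  "deriv_even i (even_gen j) = (if i = j then 1 else 0)" "deriv_even i (odd_gen j) = 0"
  "deriv_odd i' (odd_gen j') = (if i' = j' then 1 else 0)" "deriv_odd i' (even_gen j') = 0"
  by (auto simp: even_gen_def odd_gen_def deriv_smon one_superpoly_def)

lemma deriv_even_mult: "deriv_even i (p * q) = deriv_even i p * q + p * deriv_even i q"
proof -
  have base: "deriv_even i (smon u * smon v) = deriv_even i (smon u) * smon v + smon u * deriv_even i (smon v)"
    for u v
  proof -
    obtain \<mu> A \<nu> B where uv: "u = (\<mu>, A)" "v = (\<nu>, B)" by (cases u, cases v)
    have 1: "scale (of_nat (count \<mu> i)) (smon (\<mu> - {#i#} + \<nu>, C)) = scale (of_nat (count \<mu> i)) (smon (\<mu> + \<nu> - {#i#}, C))"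
      for C :: "'a fset"
      by (cases "i \<in># \<mu>") (auto simp: not_in_iff)
    have 2: "scale (of_nat (count \<nu> i)) (smon (\<mu> + (\<nu> - {#i#}), C)) = scale (of_nat (count \<nu> i)) (smon (\<mu> + \<nu> - {#i#}, C))"
      for C :: "'a fset"
      by (cases "i \<in># \<nu>") (auto simp: not_in_iff)
    show ?thesis
    proof (cases "A |\<inter>| B = {||}")
      case True
      have "scale (of_nat (count \<mu> i)) (scale c (smon (\<mu> - {#i#} + \<nu>, A |\<union>| B))) =
          scale c (scale (of_nat (count \<mu> i)) (smon (\<mu> + \<nu> - {#i#}, A |\<union>| B)))"
        "scale (of_nat (count \<nu> i)) (scale c (smon (\<mu> + (\<nu> - {#i#}), A |\<union>| B))) =
          scale c (scale (of_nat (count \<nu> i)) (smon (\<mu> + \<nu> - {#i#}, A |\<union>| B)))" for c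
        by (simp_all only: superpoly.scale_left_commute[of _ c] 1 2)
      then show ?thesis
        using True by (simp add: uv mon_mult_mon mon_mult_def deriv_smon deriv_scale scale_mult
          superpoly.scale_left_distrib superpoly.scale_right_distrib
          del: superpoly.scale_scale superpoly.scale_cancel_left superpoly.scale_cancel_right)
    next
      case False
      then show ?thesis
        by (simp add: uv mon_mult_mon mon_mult_def deriv_smon scale_mult)
    qed
  qed
  have "deriv_even i (smon u * q) = deriv_even i (smon u) * q + smon u * deriv_even i q" for u
    by (induction q rule: superpoly_induct)
      (simp_all add: base algebra_simps deriv_add deriv_scale scale_mult superpoly.scale_right_distrib)
  then show ?thesis
    by (induction p rule: superpoly_induct)
      (simp_all add: algebra_simps deriv_add deriv_scale scale_mult superpoly.scale_right_distrib)
qed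

lemma deriv_odd_odd_gen_mult:
  assumes "i |\<notin>| snd u"
  shows "deriv_odd i (odd_gen i * smon u) = smon u"
proof -
  have "inversions {|i|} {|i|} = 0" by simp
  moreover have "{|i|} |\<inter>| snd u = {||}" using assms by auto
  moreover have "inversions {|i|} ({|i|} |\<union>| snd u) = inversions {|i|} {|i|} + inversions {|i|} (snd u)"
    by (rule inversions_union_right) (fact calculation(2))
  ultimately show ?thesis
    using assms
    by (simp add: odd_gen_def mon_mult_mon mon_mult_def deriv_scale deriv_smon
        flip: power_mult_distrib)
qed

lemma odd_gen_square [simp]: "odd_gen i * odd_gen i = 0"
  by (simp add: odd_gen_def mon_mult_mon mon_mult_def)

lemma odd_gen_par: "odd_gen i * p = parity_inv p * odd_gen i"
proof (induction p rule: superpoly_induct)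
  case (smon u)
  then show ?case
    using supercommutative[of "({#}, {|i|})" u]
    by (simp add: odd_gen_def par_smon scale_mult fcard.rep_eq)
qed (simp_all add: algebra_simps par_add par_scale scale_mult)

lemma deriv_odd_mult: "deriv_odd i (p * q) = deriv_odd i p * q + parity_inv p * deriv_odd i q"
proof -
  have split: "\<exists>c w. i |\<notin>| snd w \<and> (smon u = scale c (smon w) \<or> smon u = scale c (odd_gen i * smon w))"
    for u :: "'a smonom"
  proof (cases "i |\<in>| snd u")
    case True
    let ?w = "(fst u, snd u |-| {|i|})"
    have "finsert i (snd u) = snd u" using True by auto
    then have "odd_gen i * smon ?w = scale ((-1) ^ inversions {|i|} (snd ?w)) (smon u)"
      by (simp add: odd_gen_def mon_mult_mon mon_mult_def)
    then have "smon u = scale ((-1) ^ inversions {|i|} (snd ?w)) (odd_gen i * smon ?w)"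
      by (simp flip: power_mult_distrib)
    then show ?thesis by (intro exI[of _ "(-1) ^ inversions {|i|} (snd ?w)"] exI[of _ ?w]) auto
  next
    case False
    then show ?thesis by (intro exI[of _ 1] exI[of _ u]) auto
  qed
  have free: "deriv_odd i (smon u) = 0" if "i |\<notin>| snd u" for u
    using that by (simp add: deriv_smon)
  have free_mult: "deriv_odd i (smon u * smon v) = 0" "deriv_odd i (odd_gen i * (smon u * smon v)) = smon u * smon v"
    if "i |\<notin>| snd u" "i |\<notin>| snd v" for u v
    using that deriv_odd_odd_gen_mult[of i "(fst u + fst v, snd u |\<union>| snd v)"]
    by (auto simp: mon_mult_mon mon_mult_def deriv_scale scale_mult deriv_smon)
  have par_gen: "parity_inv (odd_gen i * smon u) = - (odd_gen i * parity_inv (smon u))" if "i |\<notin>| snd u" for u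
    using that by (simp add: odd_gen_def mon_mult_mon mon_mult_def par_smon par_scale scale_mult
        fcard_finsert_disjoint mult.commute)
  have par_swap: "smon u * odd_gen i = odd_gen i * parity_inv (smon u)" for u
  proof -
    have "parity_inv (parity_inv (smon u)) = smon u" by (simp add: par_smon par_scale flip: power_mult_distrib)
    then show ?thesis by (simp add: odd_gen_par)
  qed
  have base: "deriv_odd i (smon u * smon v) = deriv_odd i (smon u) * smon v + parity_inv (smon u) * deriv_odd i (smon v)"
    for u v
  proof -
    obtain c u' where u: "i |\<notin>| snd u'" "smon u = scale c (smon u') \<or> smon u = scale c (odd_gen i * smon u')"
      using split by blast
    obtain d v' where v: "i |\<notin>| snd v'" "smon v = scale d (smon v') \<or> smon v = scale d (odd_gen i * smon v')"
      using split by blast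
    have pp: "parity_inv (smon u') * smon w = scale ((-1) ^ fcard (snd u')) (smon u' * smon w)" for w
      by (simp add: par_smon scale_mult)
    have A: "smon u' * (odd_gen i * smon v') = odd_gen i * (parity_inv (smon u') * smon v')"
      by (simp add: par_swap flip: mult.assoc)
    have B: "odd_gen i * smon u' * (odd_gen i * smon v') = 0"
    proof -
      have "odd_gen i * smon u' * (odd_gen i * smon v') = odd_gen i * (smon u' * (odd_gen i * smon v'))"
        by (simp add: mult.assoc)
      also have "\<dots> = odd_gen i * odd_gen i * (parity_inv (smon u') * smon v')"
        unfolding A by (simp only: mult.assoc)
      finally show ?thesis by (simp only: odd_gen_square mult_zero_left)
    qed
    have 1: "deriv_odd i (smon u' * smon v') = deriv_odd i (smon u') * smon v' + parity_inv (smon u') * deriv_odd i (smon v')"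
      using u(1) v(1) by (simp add: free free_mult)
    have 2: "deriv_odd i (odd_gen i * smon u' * smon v') =
        deriv_odd i (odd_gen i * smon u') * smon v' + parity_inv (odd_gen i * smon u') * deriv_odd i (smon v')"
      using u(1) v(1) by (simp add: free free_mult deriv_odd_odd_gen_mult mult.assoc)
    have 3: "deriv_odd i (smon u' * (odd_gen i * smon v')) =
        deriv_odd i (smon u') * (odd_gen i * smon v') + parity_inv (smon u') * deriv_odd i (odd_gen i * smon v')"
      using u(1) v(1) by (simp add: A pp scale_mult deriv_scale free free_mult deriv_odd_odd_gen_mult)
    have 4: "deriv_odd i (odd_gen i * smon u' * (odd_gen i * smon v')) =
        deriv_odd i (odd_gen i * smon u') * (odd_gen i * smon v') +
        parity_inv (odd_gen i * smon u') * deriv_odd i (odd_gen i * smon v')"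
      by (simp only: B par_gen[OF u(1)] deriv_odd_odd_gen_mult[OF u(1)] deriv_odd_odd_gen_mult[OF v(1)] A)
        (simp add: mult.assoc)
    show ?thesis
      using u(2) v(2) by (elim disjE) (simp_all add: 1 2 3 4 scale_mult deriv_scale par_scale
          superpoly.scale_right_distrib)
  qed
  have "deriv_odd i (smon u * q) = deriv_odd i (smon u) * q + parity_inv (smon u) * deriv_odd i q" for u
    by (induction q rule: superpoly_induct)
      (simp_all add: base algebra_simps deriv_add deriv_scale scale_mult superpoly.scale_right_distrib)
  then show ?thesis
    by (induction p rule: superpoly_induct)
      (simp_all add: algebra_simps deriv_add deriv_scale par_add par_scale scale_mult superpoly.scale_right_distrib)
qed

subsection \<open>Substitution homomorphisms\<close>

text \<open>
  The algebra homomorphism with \<open>even_gen i \<mapsto> f i\<close> and \<open>odd_gen i \<mapsto> g i\<close>, for even \<open>f i\<close> and odd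
  \<open>g i\<close>; see \<open>subst_hom_mult\<close>.
\<close>

definition subst_hom :: "('i::linorder \<Rightarrow> 'j::linorder superpoly) \<Rightarrow> ('i \<Rightarrow> 'j superpoly) \<Rightarrow>
    'i superpoly \<Rightarrow> 'j superpoly" where
  "subst_hom f g = lin_ext (\<lambda>(\<mu>, A). prod_list (map f (sorted_list_of_multiset \<mu>)) *
     prod_list (map g (sorted_list_of_fset A)))"

lemma par_par [simp]: "parity_inv (parity_inv p) = p"
  by (induction p rule: superpoly_induct)
    (simp_all add: par_add par_scale par_smon flip: power_mult_distrib)

lemma scoeff_par: "scoeff (parity_inv p) u = (-1) ^ fcard (snd u) * scoeff p u"
  by (induction p rule: superpoly_induct) (simp_all add: par_add par_scale par_smon algebra_simps)

lemma mon_commute: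
  "smon u * q = (if even (fcard (snd u)) then q else parity_inv q) * smon u"
proof (induction q rule: superpoly_induct)
  case (smon v)
  then show ?case
    using supercommutative[of u v] by (simp add: par_smon scale_mult power_mult minus_one_power_iff)
qed (auto simp: algebra_simps par_add par_scale scale_mult)

lemma superpoly_even_commute:
  assumes "superpoly_even p"
  shows "p * q = q * p"
proof -
  have ev: "even (fcard (snd u))" if "u \<in> ssupport p" for u
  proof (rule ccontr)
    assume "odd (fcard (snd u))"
    then have "scoeff p u = - scoeff p u"
      using assms scoeff_par[of p u] by (simp add: superpoly_even_def)
    then show False using that by (simp add: in_support_iff)
  qed
  have "p * q = (\<Sum>u\<in>ssupport p. scale (scoeff p u) (smon u * q))"
    by (subst superpoly_expand[of p]) (simp add: sum_distrib_right scale_mult)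
  also have "\<dots> = (\<Sum>u\<in>ssupport p. scale (scoeff p u) (q * smon u))"
    using ev by (intro sum.cong) (simp_all add: mon_commute[of _ q])
  also have "\<dots> = q * (\<Sum>u\<in>ssupport p. scale (scoeff p u) (smon u))"
    by (simp add: sum_distrib_left scale_mult)
  finally show ?thesis by (simp flip: superpoly_expand)
qed

lemma superpoly_odd_commute:
  assumes "superpoly_odd p"
  shows "p * q = parity_inv q * p"
proof -
  have odd: "odd (fcard (snd u))" if "u \<in> ssupport p" for u
  proof
    assume "even (fcard (snd u))"
    then have "scoeff p u = - scoeff p u"
      using assms scoeff_par[of p u] by (simp add: superpoly_odd_def)
    then show False using that by (simp add: in_support_iff)
  qed
  have "p * q = (\<Sum>u\<in>ssupport p. scale (scoeff p u) (smon u * q))"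
    by (subst superpoly_expand[of p]) (simp add: sum_distrib_right scale_mult)
  also have "\<dots> = (\<Sum>u\<in>ssupport p. scale (scoeff p u) (parity_inv q * smon u))"
    using odd by (intro sum.cong) (simp_all add: mon_commute[of _ q])
  also have "\<dots> = parity_inv q * (\<Sum>u\<in>ssupport p. scale (scoeff p u) (smon u))"
    by (simp add: sum_distrib_left scale_mult)
  finally show ?thesis by (simp flip: superpoly_expand)
qed

lemma superpoly_odd_anticommute:
  assumes "superpoly_odd p" "superpoly_odd q"
  shows "p * q = - (q * p)"
  using superpoly_odd_commute[OF assms(1), of q] assms(2) by (simp add: superpoly_odd_def)

lemma superpoly_odd_square:
  assumes "superpoly_odd p"
  shows "p * p = 0"
proof -
  have "scale 2 (p * p) = p * p + p * p"
    using superpoly.scale_left_distrib[of 1 1 "p * p"] by simp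
  also have "\<dots> = 0"
    using superpoly_odd_anticommute[OF assms assms] by (metis add.right_inverse)
  finally show ?thesis by simp
qed

lemma fset_min_induct [case_names empty insert]:
  assumes "P {||}" "\<And>b A. (\<And>a. a |\<in>| A \<Longrightarrow> b < a) \<Longrightarrow> P A \<Longrightarrow> P (finsert b A)"
  shows "P (A :: 'a::linorder fset)"
proof (induction "fcard A" arbitrary: A)
  case 0
  then show ?case using assms(1) by (simp add: fcard_0_eq)
next
  case (Suc n)
  then have ne: "fset A \<noteq> {}" by (auto simp: fcard.rep_eq)
  let ?b = "Min (fset A)"
  have b: "?b |\<in>| A" using Min_in[OF finite_fset ne] by simp
  have "P (A |-| {|?b|})"
    using Suc b by (intro Suc(1)) (simp add: fcard_fminus_fsingleton)
  moreover have "?b < a" if "a |\<in>| A |-| {|?b|}" for a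
    using that by (auto simp: order_less_le)
  ultimately have "P (finsert ?b (A |-| {|?b|}))" by (intro assms(2))
  then show ?case using b by (simp add: finsert_absorb)
qed

lemma sorted_list_of_fset_finsert_min:
  assumes "\<And>a. a |\<in>| A \<Longrightarrow> b < a"
  shows "sorted_list_of_fset (finsert b A) = b # sorted_list_of_fset A"
proof -
  have "b \<notin> fset A" using assms by blast
  then have "sorted_list_of_set (insert b (fset A)) = insort b (sorted_list_of_set (fset A))"
    by (simp add: sorted_list_of_set_insert)
  also have "\<dots> = b # sorted_list_of_set (fset A)"
    by (intro insort_is_Cons) (use assms in \<open>auto simp: order_less_imp_le\<close>)
  finally show ?thesis by (simp add: sorted_list_of_fset.rep_eq)
qed

context
  fixes f g :: "'i::linorder \<Rightarrow> 'j::linorder superpoly"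
  assumes f: "\<And>i. superpoly_even (f i)" and g: "\<And>i. superpoly_odd (g i)"
begin

private definition "F \<mu> = prod_list (map f (sorted_list_of_multiset \<mu>))"
private definition "G A = prod_list (map g (sorted_list_of_fset A))"

private lemma F_add_mset: "F (add_mset x \<mu>) = f x * F \<mu>"
proof -
  have "prod_list (map f (insort x xs)) = f x * prod_list (map f xs)" for xs
  proof (induction xs)
    case (Cons y xs)
    have "f y * (f x * prod_list (map f xs)) = f x * (f y * prod_list (map f xs))"
      by (metis mult.assoc superpoly_even_commute[OF f])
    then show ?case by (simp add: Cons)
  qed simp
  then show ?thesis by (simp add: F_def)
qed

private lemma F_plus: "F (\<mu> + \<nu>) = F \<mu> * F \<nu>"
  by (induction \<mu>) (simp_all add: F_add_mset mult.assoc F_def[of "{#}"])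

private lemma F_commute: "F \<mu> * p = p * F \<mu>"
proof (induction \<mu>)
  case (add x \<mu>)
  then have "f x * F \<mu> * p = f x * p * F \<mu>" by (simp only: mult.assoc)
  also have "\<dots> = p * (f x * F \<mu>)"
    by (simp only: superpoly_even_commute[OF f, of x p] mult.assoc)
  finally show ?case by (simp only: F_add_mset)
qed (simp add: F_def)

private lemma G_empty [simp]: "G {||} = 1"
  by (simp add: G_def sorted_list_of_fset.rep_eq)

private lemma G_finsert_min: "(\<And>a. a |\<in>| A \<Longrightarrow> b < a) \<Longrightarrow> G (finsert b A) = g b * G A"
  by (simp add: G_def sorted_list_of_fset_finsert_min)

private lemma gen_mult_G:
  "g a * G C = (if a |\<in>| C then 0 else scale ((-1) ^ inversions {|a|} C) (G (finsert a C)))"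
proof (induction C rule: fset_min_induct)
  case empty
  then show ?case using G_finsert_min[of "{||}" a] by simp
next
  case (insert b A)
  have bA: "b |\<notin>| A" using insert(1) by blast
  have inv: "inversions {|a|} (finsert b A) = (if b < a then 1 else 0) + inversions {|a|} A"
    using inversions_union_right[of "{|b|}" A "{|a|}"] bA by simp
  show ?case
  proof (cases a b rule: linorder_cases)
    case less
    then have lt: "a < c" if "c |\<in>| finsert b A" for c
      using that insert(1) by (auto intro: less_trans)
    then have "a |\<notin>| finsert b A" by blast
    moreover have "inversions {|a|} (finsert b A) = 0"
    proof -
      have "{(x, y). x |\<in>| {|a|} \<and> y |\<in>| finsert b A \<and> y < x} = {}"
        using lt by (auto dest: less_asym)
      then show ?thesis by (simp only: inversions_def card.empty)
    qed
    ultimately show ?thesis using G_finsert_min[of "finsert b A" a] lt by simp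
  next
    case equal
    then show ?thesis
      using insert(1) by (simp add: G_finsert_min superpoly_odd_square[OF g] flip: mult.assoc)
  next
    case greater
    have "g a * G (finsert b A) = g a * g b * G A"
      using insert(1) by (simp add: G_finsert_min mult.assoc)
    also have "\<dots> = - (g b * (g a * G A))"
      by (simp add: superpoly_odd_anticommute[OF g g, of a b] mult.assoc)
    also have "\<dots> = (if a |\<in>| A then 0 else
        - scale ((-1) ^ inversions {|a|} A) (g b * G (finsert a A)))"
      by (simp add: insert(2) scale_mult)
    also have "g b * G (finsert a A) = G (finsert b (finsert a A))"
      using insert(1) greater by (subst G_finsert_min) auto
    also have "finsert b (finsert a A) = finsert a (finsert b A)" by (rule finsert_commute)
    finally show ?thesis using greater by (auto simp: inv)
  qed
qed

private lemma G_mult: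
  "G A * G B = (if A |\<inter>| B = {||} then scale ((-1) ^ inversions A B) (G (A |\<union>| B)) else 0)"
proof (induction A rule: fset_min_induct)
  case empty
  then show ?case by simp
next
  case (insert a A)
  have aA: "a |\<notin>| A" using insert(1) by blast
  then have inv: "inversions (finsert a A) C = inversions {|a|} C + inversions A C" for C
    using inversions_union_left[of "{|a|}" A C] by simp
  have "{(x, y). x |\<in>| {|a|} \<and> y |\<in>| A \<and> y < x} = {}"
    using insert(1) by (auto dest: less_asym)
  then have inv0: "inversions {|a|} A = 0" by (simp only: inversions_def card.empty)
  have "G (finsert a A) * G B = g a * (G A * G B)"
    using insert(1) by (simp add: G_finsert_min mult.assoc)
  also have "\<dots> = (if A |\<inter>| B = {||} then scale ((-1) ^ inversions A B) (g a * G (A |\<union>| B)) else 0)"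
    by (simp add: insert(2) scale_mult)
  also have "\<dots> = (if finsert a A |\<inter>| B = {||} then
      scale ((-1) ^ inversions (finsert a A) B) (G (finsert a A |\<union>| B)) else 0)"
    using aA by (auto simp: gen_mult_G inv inv0 inversions_union_right power_add mult.commute)
  finally show ?case .
qed

lemma subst_hom_mult: "subst_hom f g (p * q) = subst_hom f g p * subst_hom f g q"
proof -
  have smon: "subst_hom f g (smon u) = F (fst u) * G (snd u)" for u
    by (simp add: subst_hom_def F_def G_def case_prod_beta)
  have lin: "subst_hom f g (p + q) = subst_hom f g p + subst_hom f g q"
    "subst_hom f g (scale c p) = scale c (subst_hom f g p)" "subst_hom f g 0 = 0" for p q c
    by (simp_all add: subst_hom_def lin_ext_add lin_ext_scale)
  have base: "subst_hom f g (smon u * smon v) = subst_hom f g (smon u) * subst_hom f g (smon v)" for u v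
  proof -
    have "subst_hom f g (smon u) * subst_hom f g (smon v) =
        F (fst u) * (G (snd u) * F (fst v)) * G (snd v)"
      by (simp add: smon mult.assoc)
    also have "\<dots> = F (fst u + fst v) * (G (snd u) * G (snd v))"
      by (simp only: F_plus mult.assoc F_commute[of "fst v" "G (snd u)", symmetric])
    finally show ?thesis
      by (simp add: smon lin G_mult mon_mult_mon mon_mult_def scale_mult)
  qed
  have "subst_hom f g (smon u * q) = subst_hom f g (smon u) * subst_hom f g q" for u
    by (induction q rule: superpoly_induct) (simp_all add: base algebra_simps lin scale_mult)
  then show ?thesis
    by (induction p rule: superpoly_induct) (simp_all add: algebra_simps lin scale_mult)
qed

end

lemma subst_hom_simps:
  "subst_hom f g (even_gen i) = f i" "subst_hom f g (odd_gen i) = g i" "subst_hom f g 1 = 1"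
  "subst_hom f g (p + q) = subst_hom f g p + subst_hom f g q"
  "subst_hom f g (scale c p) = scale c (subst_hom f g p)"
proof -
  have smon: "subst_hom f g (smon u) = prod_list (map f (sorted_list_of_multiset (fst u))) *
      prod_list (map g (sorted_list_of_fset (snd u)))" for u
    by (simp add: subst_hom_def case_prod_beta)
  show "subst_hom f g (even_gen i) = f i" "subst_hom f g (odd_gen i) = g i"
    by (simp_all add: even_gen_def odd_gen_def smon sorted_list_of_fset.rep_eq)
  have "subst_hom f g (smon ({#}, {||})) = 1" by (simp add: smon sorted_list_of_fset.rep_eq)
  then show "subst_hom f g 1 = 1" by (simp add: one_superpoly_def)
  show "subst_hom f g (p + q) = subst_hom f g p + subst_hom f g q"
    "subst_hom f g (scale c p) = scale c (subst_hom f g p)"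
    by (simp_all add: subst_hom_def lin_ext_add lin_ext_scale)
qed


section \<open>The orthosymplectic supergroup\<close>

text \<open>Indices start at \<open>0\<close>: \<open>e_a\<close> is even for \<open>a < m\<close> and odd for \<open>m \<le> a < m + 2 * n\<close>.\<close>

definition eta :: "nat \<Rightarrow> complex mat" where
  "eta n = four_block_mat (0\<^sub>m n n) (1\<^sub>m n) (- 1\<^sub>m n) (0\<^sub>m n n)"

definition kappa :: "nat \<Rightarrow> nat \<Rightarrow> complex mat" where
  "kappa m n = four_block_mat (1\<^sub>m m) (0\<^sub>m m (2 * n)) (0\<^sub>m (2 * n) m) (eta n)"

definition kappa_inv :: "nat \<Rightarrow> nat \<Rightarrow> complex mat" where
  "kappa_inv m n = four_block_mat (1\<^sub>m m) (0\<^sub>m m (2 * n)) (0\<^sub>m (2 * n) m) (- eta n)"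

lemma eta_carrier: "eta n \<in> carrier_mat (2 * n) (2 * n)"
  using four_block_carrier_mat[of "0\<^sub>m n n" n n "0\<^sub>m n n :: complex mat" n n]
  by (simp add: eta_def mult_2)

lemma eta_square: "eta n * eta n = - 1\<^sub>m (2 * n)"
proof -
  have "eta n * eta n = four_block_mat (- 1\<^sub>m n) (0\<^sub>m n n) (0\<^sub>m n n) (- 1\<^sub>m n)"
    unfolding eta_def by (subst mult_four_block_mat[of _ n n _ n _ n _ _ n _ n]) auto
  also have "\<dots> = - four_block_mat (1\<^sub>m n) (0\<^sub>m n n) (0\<^sub>m n n) (1\<^sub>m n)"
    by (rule eq_matI) auto
  finally show ?thesis by (simp add: mult_2)
qed

lemma kappa_kappa_inv: "kappa m n * kappa_inv m n = 1\<^sub>m (m + 2 * n)"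
  and kappa_inv_kappa: "kappa_inv m n * kappa m n = 1\<^sub>m (m + 2 * n)"
proof -
  note [simp] = eta_carrier uminus_carrier_mat[OF eta_carrier]
  have z: "eta n * 0\<^sub>m (2 * n) m = 0\<^sub>m (2 * n) m" "0\<^sub>m m (2 * n) * eta n = 0\<^sub>m m (2 * n)"
    "- eta n * 0\<^sub>m (2 * n) m = 0\<^sub>m (2 * n) m" "0\<^sub>m m (2 * n) * - eta n = 0\<^sub>m m (2 * n)"
    by (rule right_mult_zero_mat left_mult_zero_mat, simp)+
  have e: "eta n * - eta n = 1\<^sub>m (2 * n)" "- eta n * eta n = 1\<^sub>m (2 * n)"
    using carrier_matD[OF eta_carrier[of n]] by (simp_all add: eta_square)
  show "kappa m n * kappa_inv m n = 1\<^sub>m (m + 2 * n)"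
    unfolding kappa_def kappa_inv_def
    by (subst mult_four_block_mat[of _ m m _ "2 * n" _ "2 * n" _ _ m _ "2 * n"]) (auto simp: e z simp del: uminus_mult_left_mat uminus_mult_right_mat)
  show "kappa_inv m n * kappa m n = 1\<^sub>m (m + 2 * n)"
    unfolding kappa_def kappa_inv_def
    by (subst mult_four_block_mat[of _ m m _ "2 * n" _ "2 * n" _ _ m _ "2 * n"]) (auto simp: e z simp del: uminus_mult_left_mat uminus_mult_right_mat)
qed

definition bform :: "nat \<Rightarrow> nat \<Rightarrow> complex vec \<Rightarrow> complex vec \<Rightarrow> complex" where
  "bform m n v w = v \<bullet> (kappa m n *\<^sub>v w)"

text \<open>Parities are represented by the natural numbers \<open>0\<close> and \<open>1\<close>.\<close>

definition parity_idx :: "nat \<Rightarrow> nat \<Rightarrow> nat" where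
  "parity_idx m a = (if a < m then 0 else 1)"

definition V_homog :: "nat \<Rightarrow> nat \<Rightarrow> nat \<Rightarrow> complex vec set" where
  "V_homog m n c = {v \<in> carrier_vec (m + 2 * n).
     \<forall>a < m + 2 * n. v $ a \<noteq> 0 \<longrightarrow> parity_idx m a = c}"

definition gl_homog :: "nat \<Rightarrow> nat \<Rightarrow> nat \<Rightarrow> complex mat set" where
  "gl_homog m n p = {Y \<in> carrier_mat (m + 2 * n) (m + 2 * n).
     \<forall>a < m + 2 * n. \<forall>b < m + 2 * n.
       Y $$ (a, b) \<noteq> 0 \<longrightarrow> (parity_idx m a + parity_idx m b) mod 2 = p}"

definition osp_homog :: "nat \<Rightarrow> nat \<Rightarrow> nat \<Rightarrow> complex mat set" where
  "osp_homog m n p = {Y \<in> gl_homog m n p.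
     \<forall>c \<in> {0, 1}. \<forall>d \<in> {0, 1}. \<forall>v \<in> V_homog m n c. \<forall>w \<in> V_homog m n d.
       bform m n (Y *\<^sub>v v) w + (-1) ^ (p * c) * bform m n v (Y *\<^sub>v w) = 0}"

text \<open>As \<open>osp_homog m n 0\<close> and \<open>osp_homog m n 1\<close> are subspaces, this is their span.\<close>

definition osp :: "nat \<Rightarrow> nat \<Rightarrow> complex mat set" where
  "osp m n = {Y0 + Y1 | Y0 Y1. Y0 \<in> osp_homog m n 0 \<and> Y1 \<in> osp_homog m n 1}"

definition O_group :: "nat \<Rightarrow> complex mat set" where
  "O_group m = {A \<in> carrier_mat m m. transpose_mat A * A = 1\<^sub>m m}"

definition Sp_group :: "nat \<Rightarrow> complex mat set" where
  "Sp_group n = {B \<in> carrier_mat (2 * n) (2 * n). transpose_mat B * eta n * B = eta n}"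


section \<open>The superalgebra \<open>S(N)\<close> and the actions on it\<close>

datatype index = Index nat nat

instantiation index :: linorder
begin

fun less_eq_index :: "index \<Rightarrow> index \<Rightarrow> bool" where
  "Index a t \<le> Index b s \<longleftrightarrow> a < b \<or> a = b \<and> t \<le> s"

definition less_index :: "index \<Rightarrow> index \<Rightarrow> bool" where
  "i < j \<longleftrightarrow> i \<le> j \<and> \<not> j \<le> (i :: index)"

instance
proof
  fix i j k :: index
  show "i \<le> i" by (cases i) auto
  show "i \<le> j \<Longrightarrow> j \<le> k \<Longrightarrow> i \<le> k" by (cases i; cases j; cases k) auto
  show "i \<le> j \<Longrightarrow> j \<le> i \<Longrightarrow> i = j" by (cases i; cases j) auto
  show "i \<le> j \<or> j \<le> i" by (cases i; cases j) auto
qed (rule less_index_def)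

end

text \<open>\<open>Xgen m a t\<close> is the generator \<open>e_a \<otimes> f_t\<close>, and \<open>dXgen m a t\<close> the (left) partial derivative by it.\<close>

definition Xgen :: "nat \<Rightarrow> nat \<Rightarrow> nat \<Rightarrow> index superpoly" where
  "Xgen m a t = (if a < m then even_gen (Index a t) else odd_gen (Index (a - m) t))"

definition dXgen :: "nat \<Rightarrow> nat \<Rightarrow> nat \<Rightarrow> index superpoly \<Rightarrow> index superpoly" where
  "dXgen m a t = (if a < m then deriv_even (Index a t) else deriv_odd (Index (a - m) t))"

lemma dXgen_Xgen: "dXgen m a t (Xgen m b s) = (if a = b \<and> t = s then 1 else 0)"
  by (auto simp: dXgen_def Xgen_def deriv_gen)

lemma Xgen_dXgen_mult:
  "Xgen m b s * dXgen m a t (p * q) = Xgen m b s * dXgen m a t p * q +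
     (if parity_idx m a = parity_idx m b then p else parity_inv p) * (Xgen m b s * dXgen m a t q)"
  using even_gen_central[of "Index b s" p] even_gen_central[of "Index b s" "parity_inv p"]
    odd_gen_par[of _ p] odd_gen_par[of _ "parity_inv p"]
  by (auto simp: Xgen_def dXgen_def parity_idx_def deriv_even_mult deriv_odd_mult distrib_left mult.assoc[symmetric])

definition sym_superalg :: "nat \<Rightarrow> nat \<Rightarrow> nat \<Rightarrow> index superpoly set" where
  "sym_superalg m n N = {p. \<forall>(\<mu>, A) \<in> ssupport p.
     set_mset \<mu> \<subseteq> {Index a t | a t. a < m \<and> t < N} \<and>
     fset A \<subseteq> {Index a t | a t. a < 2 * n \<and> t < N}}"

definition E_gl :: "nat \<Rightarrow> nat \<Rightarrow> nat \<Rightarrow> nat \<Rightarrow> index superpoly \<Rightarrow> index superpoly" where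
  "E_gl m n s t p = (\<Sum>a<m + 2 * n. Xgen m a s * dXgen m a t p)"

text \<open>
  The superderivation with \<open>Xgen m a t \<mapsto> (\<Sum>b. Y $$ (b, a) * Xgen m b t)\<close>; by \<open>Xgen_dXgen_mult\<close> it has the
  parity of \<open>Y\<close> when \<open>Y\<close> is homogeneous.
\<close>

definition osp_act :: "nat \<Rightarrow> nat \<Rightarrow> nat \<Rightarrow> complex mat \<Rightarrow> index superpoly \<Rightarrow> index superpoly" where
  "osp_act m n N Y p =
     (\<Sum>a<m + 2 * n. \<Sum>b<m + 2 * n. \<Sum>t<N. scale (Y $$ (b, a)) (Xgen m b t * dXgen m a t p))"

definition group_act :: "nat \<Rightarrow> nat \<Rightarrow> complex mat \<Rightarrow> complex mat \<Rightarrow> index superpoly \<Rightarrow> index superpoly" where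
  "group_act m n A B = subst_hom
     (\<lambda>i. case i of Index a t \<Rightarrow> \<Sum>b<m. scale (A $$ (b, a)) (Xgen m b t))
     (\<lambda>i. case i of Index a t \<Rightarrow> \<Sum>b<2 * n. scale (B $$ (b, a)) (Xgen m (m + b) t))"

lemma group_act_mult: "group_act m n A B (p * q) = group_act m n A B p * group_act m n A B q"
proof -
  have par_sum: "parity_inv (sum f S) = (\<Sum>x\<in>S. parity_inv (f x))" for f :: "nat \<Rightarrow> index superpoly" and S
    by (induction S rule: infinite_finite_induct) (simp_all add: par_add)
  have X: "parity_inv (Xgen m b t) = (if b < m then Xgen m b t else - Xgen m b t)" for b t
    by (simp add: Xgen_def par_smon even_gen_def odd_gen_def fcard.rep_eq)
  have "superpoly_even (\<Sum>b<m. scale (A $$ (b, a)) (Xgen m b t))" for a t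
    unfolding superpoly_even_def par_sum par_scale by (rule sum.cong) (simp_all add: X)
  moreover have "superpoly_odd (\<Sum>b<2 * n. scale (B $$ (b, a)) (Xgen m (m + b) t))" for a t
    unfolding superpoly_odd_def par_sum par_scale by (simp add: X sum_negf)
  ultimately show ?thesis
    unfolding group_act_def by (intro subst_hom_mult) (simp_all split: index.split)
qed

definition osp_invariants :: "nat \<Rightarrow> nat \<Rightarrow> nat \<Rightarrow> index superpoly set" where
  "osp_invariants m n N = {p \<in> sym_superalg m n N.
     (\<forall>Y \<in> osp m n. osp_act m n N Y p = 0) \<and>
     (\<forall>A \<in> O_group m. \<forall>B \<in> Sp_group n. group_act m n A B p = p)}"

definition is_subalgebra :: "'i::linorder superpoly set \<Rightarrow> bool" where
  "is_subalgebra W \<longleftrightarrow> superpoly.subspace W \<and> 1 \<in> W \<and> (\<forall>p \<in> W. \<forall>q \<in> W. p * q \<in> W)"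


section \<open>\<open>gl_N\<close>-modules inside \<open>S(N)\<close>\<close>

definition gl_submodule :: "nat \<Rightarrow> nat \<Rightarrow> nat \<Rightarrow> index superpoly set \<Rightarrow> bool" where
  "gl_submodule m n N W \<longleftrightarrow> W \<subseteq> sym_superalg m n N \<and> superpoly.subspace W \<and>
     (\<forall>s<N. \<forall>t<N. \<forall>p \<in> W. E_gl m n s t p \<in> W)"

definition gl_simple :: "nat \<Rightarrow> nat \<Rightarrow> nat \<Rightarrow> index superpoly set \<Rightarrow> bool" where
  "gl_simple m n N W \<longleftrightarrow> gl_submodule m n N W \<and> W \<noteq> {0} \<and>
     (\<forall>U. gl_submodule m n N U \<and> U \<subseteq> W \<longrightarrow> U = {0} \<or> U = W)"

text \<open>A weight \<open>lam\<close> of \<open>gl_N\<close> is given by its entries \<open>lam 0, \<dots>, lam (N - 1)\<close>.\<close>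

definition highest_weight_vector ::
    "nat \<Rightarrow> nat \<Rightarrow> nat \<Rightarrow> (nat \<Rightarrow> nat) \<Rightarrow> index superpoly \<Rightarrow> bool" where
  "highest_weight_vector m n N lam v \<longleftrightarrow> v \<noteq> 0 \<and>
     (\<forall>i<N. E_gl m n i i v = scale (of_nat (lam i)) v) \<and>
     (\<forall>j<N. \<forall>i<j. E_gl m n i j v = 0)"

definition is_simple_with_highest_weight ::
    "nat \<Rightarrow> nat \<Rightarrow> nat \<Rightarrow> (nat \<Rightarrow> nat) \<Rightarrow> index superpoly set \<Rightarrow> bool" where
  "is_simple_with_highest_weight m n N lam W \<longleftrightarrow>
     gl_simple m n N W \<and> (\<exists>v \<in> W. highest_weight_vector m n N lam v)"

definition internal_direct_sum ::
    "'k set \<Rightarrow> ('k \<Rightarrow> 'i superpoly set) \<Rightarrow> 'i superpoly set \<Rightarrow> bool" where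
  "internal_direct_sum K L W \<longleftrightarrow>
     W = {(\<Sum>k\<in>F. v k) | F v. finite F \<and> F \<subseteq> K \<and> (\<forall>k \<in> F. v k \<in> L k)} \<and>
     (\<forall>F v. finite F \<and> F \<subseteq> K \<and> (\<forall>k \<in> F. v k \<in> L k) \<and> (\<Sum>k\<in>F. v k) = 0 \<longrightarrow>
        (\<forall>k \<in> F. v k = 0))"

text \<open>Parts are numbered from \<open>0\<close>, so the part \<open>lam\<^sub>k\<close> of the usual notation is \<open>lam (k - 1)\<close>.\<close>

definition partitions_length_le :: "nat \<Rightarrow> (nat \<Rightarrow> nat) set" where
  "partitions_length_le N = {lam. (\<forall>i j. i \<le> j \<longrightarrow> lam j \<le> lam i) \<and> (\<forall>k\<ge>N. lam k = 0)}"

definition even_hook_partitions :: "nat \<Rightarrow> nat \<Rightarrow> nat \<Rightarrow> (nat \<Rightarrow> nat) set" where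
  "even_hook_partitions m n N =
     {lam \<in> partitions_length_le N. (\<forall>k. even (lam k)) \<and> lam m \<le> 2 * n}"

definition fund_weight :: "nat \<Rightarrow> nat \<Rightarrow> nat" where
  "fund_weight i k = (if k < i then 1 else 0)"

definition q_elem :: "nat \<Rightarrow> nat \<Rightarrow> nat \<Rightarrow> nat \<Rightarrow> index superpoly" where
  "q_elem m n t s = (\<Sum>a<m + 2 * n. \<Sum>b<m + 2 * n. scale (kappa_inv m n $$ (a, b)) (Xgen m a t * Xgen m b s))"

text \<open>
  Leibniz expansion of the determinant of the \<open>k \<times> k\<close> matrix of the \<open>q_elem m n i j\<close>. These are even,
  hence central, so the order of the factors is irrelevant.
\<close>

definition D_minor :: "nat \<Rightarrow> nat \<Rightarrow> nat \<Rightarrow> index superpoly" where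
  "D_minor m n k = (\<Sum>\<sigma> | \<sigma> permutes {..<k}.
     of_int (sign \<sigma>) * prod_list (map (\<lambda>i. q_elem m n i (\<sigma> i)) [0..<k]))"

definition D_prod :: "nat \<Rightarrow> nat \<Rightarrow> nat \<Rightarrow> (nat \<Rightarrow> nat) \<Rightarrow> index superpoly" where
  "D_prod m n N l = prod_list (map (\<lambda>i. D_minor m n i ^ l i) [1..<N + 1])"

end

theory Submission
  imports Defs "Jordan_Normal_Form.Determinant"
begin

text \<open>
  Let \<open>f\<close> be an invariant that is a highest weight vector of weight \<open>\<lambda>\<close>. The raising operators and the
  elements of \<open>osp(V)\<close> mixing an even basis vector with the others show that \<open>f\<close> is determined by its
  restriction to a slice on which the even part of the \<open>V \<times> N\<close> matrix of generators is diagonal and the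
  odd part is supported in the columns after the \<open>m\<close>-th. On the slice one is left with an \<open>sp(2n)\<close>-invariant
  highest weight vector in an exterior algebra. There the Casimir identity of skew Howe duality shows that
  an invariant killed by all Laplacians is constant, and a commutation argument with raising operators
  shows that the vector is detected by the single scalar obtained from powers of the diagonal Laplacians.
  Hence there is at most one invariant highest weight vector of each weight, and its weight is an even
  partition in the hook. Conversely, a Cayley type identity for the Laplacian in one column and the minors
  \<open>D(k)\<close> shows that the \<open>D\<^sub>\<lambda>\<close> of weight in the hook do not vanish. Complete reducibility comes from
  the Fock space inner product, for which \<open>E\<^sub>i\<^sub>j\<close> and \<open>E\<^sub>j\<^sub>i\<close> are adjoint.
\<close>

section \<open>Calculus in the free supercommutative superalgebra\<close>

text \<open>Modules over \<open>osp(V)\<close> need not be completely reducible, so the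
  decomposition is built entirely on the \<open>gl_N\<close> side: a multiplicity bound for each
  weight, explicit vectors attaining it, and a positive form. The slice imitates a normal form:
  orthogonal row operations and unipotent upper triangular column operations bring a generic even
  block to diagonal shape. Odd coordinates have no points, so instead of moving along orbits one
  looks at the component of lowest degree in the coordinates off the slice. The conditions on
  \<lambda> have separate sources. In the first \<open>min m N\<close> columns evenness comes from
  reflections in O(m); the Lie superalgebra cannot supply it, since for n = 0 the determinant of m
  columns is annihilated by so(m). In later columns the diagonal Laplacian lowers the weight by two
  until nothing is left. The bound by 2n counts the odd generators in one column of the slice. The
  bound is also what makes the Cayley constant nonzero: up to a positive factor it is m - 2n - p +
  2j with p \<ge> m, and at p = m it first vanishes for j = n.\<close>

lemma scoeff_sum: "scoeff (sum f S) u = (\<Sum>x\<in>S. scoeff (f x) u)"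
  by (induction S rule: infinite_finite_induct) auto

text \<open>Monomials are built by left multiplication, the smallest odd index going on last, so no
  sign appears. Operators known only through their commutation with generators can then be compared
  without computing on monomials.\<close>

lemma superpoly_gen_induct [consumes 1, case_names one add scale even odd]:
  assumes supp: "\<And>u. u \<in> ssupport p \<Longrightarrow> set_mset (fst u) \<subseteq> I \<and> fset (snd u) \<subseteq> J"
    and one: "P 1" and add: "\<And>p q. P p \<Longrightarrow> P q \<Longrightarrow> P (p + q)"
    and scale: "\<And>c p. P p \<Longrightarrow> P (scale c p)"
    and even: "\<And>i p. i \<in> I \<Longrightarrow> P p \<Longrightarrow> P (even_gen i * p)"
    and odd: "\<And>i p. i \<in> J \<Longrightarrow> P p \<Longrightarrow> P (odd_gen i * p)"
  shows "P p"
proof -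
  have zero: "P 0" using scale[OF one, of 0] by simp
  have A: "P (smon ({#}, A))" if "fset A \<subseteq> J" for A
    using that
  proof (induction A rule: fset_min_induct)
    case empty
    then show ?case using one by (simp add: one_superpoly_def)
  next
    case (insert b A)
    have "{(x, y). x |\<in>| {|b|} \<and> y |\<in>| A \<and> y < x} = {}"
      using insert(1) by (auto dest: less_asym)
    then have "inversions {|b|} A = 0" by (simp only: inversions_def card.empty)
    moreover have "b |\<notin>| A" using insert(1) by blast
    ultimately have "smon ({#}, finsert b A) = odd_gen b * smon ({#}, A)"
      by (simp add: odd_gen_def mon_mult_mon mon_mult_def)
    then show ?case using insert odd by simp
  qed
  have B: "P (smon (\<mu>, A))" if "fset A \<subseteq> J" "set_mset \<mu> \<subseteq> I" for \<mu> A
    using that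
  proof (induction \<mu>)
    case empty
    then show ?case using A by simp
  next
    case (add x \<mu>)
    have "smon (add_mset x \<mu>, A) = even_gen x * smon (\<mu>, A)"
      by (simp add: even_gen_def mon_mult_mon mon_mult_def)
    then show ?case using add even by simp
  qed
  have "P (\<Sum>u\<in>S. scale (scoeff p u) (smon u))" if "finite S" "S \<subseteq> ssupport p" for S
    using that
  proof (induction S)
    case (insert u S)
    then have "P (smon u)" using B[of "snd u" "fst u"] supp[of u] by simp
    with insert show ?case by (simp add: add scale)
  qed (simp add: zero)
  then show ?thesis by (subst superpoly_expand) simp
qed

lemma deriv_even_gen_mult:
  "deriv_even i (even_gen j * p) = (if i = j then p else 0) + even_gen j * deriv_even i p"
  "deriv_even i (odd_gen j * p) = odd_gen j * deriv_even i p"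
  by (simp_all add: deriv_even_mult deriv_gen)

lemma parity_inv_gen: "parity_inv (even_gen i) = even_gen i" "parity_inv (odd_gen i) = - odd_gen i"
  by (simp_all add: even_gen_def odd_gen_def par_smon fcard.rep_eq)

lemma deriv_odd_gen_mult:
  "deriv_odd i (odd_gen j * p) = (if i = j then p else 0) - odd_gen j * deriv_odd i p"
  "deriv_odd i (even_gen j * p) = even_gen j * deriv_odd i p"
  by (simp_all add: deriv_odd_mult deriv_gen parity_inv_gen)

lemma deriv_one: "deriv_even i 1 = 0" "deriv_odd i' 1 = 0"
  by (simp_all add: one_superpoly_def deriv_smon)

lemma deriv_even_minus: "deriv_even i (p - q) = deriv_even i p - deriv_even i q"
  and deriv_odd_minus: "deriv_odd i' (p' - q') = deriv_odd i' p' - deriv_odd i' q'"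
  using deriv_add(1)[of i "p - q" q] deriv_add(2)[of i' "p' - q'" q'] by simp_all

lemma deriv_even_commute: "deriv_even i (deriv_even j p) = deriv_even j (deriv_even i (p :: 'i::linorder superpoly))"
  by (rule superpoly_gen_induct[of p UNIV UNIV])
    (auto simp: deriv_one deriv_add deriv_scale deriv_even_gen_mult)

lemma deriv_even_odd_commute: "deriv_even i (deriv_odd j p) = deriv_odd j (deriv_even i p)"
  by (rule superpoly_gen_induct[of p UNIV UNIV])
    (auto simp: deriv_one deriv_add deriv_scale deriv_even_gen_mult deriv_odd_gen_mult deriv_even_minus)

lemma deriv_odd_anticommute: "deriv_odd i (deriv_odd j p) = - deriv_odd j (deriv_odd i p)"
  by (rule superpoly_gen_induct[of p UNIV UNIV])
    (auto simp: deriv_one deriv_add deriv_scale deriv_even_gen_mult deriv_odd_gen_mult deriv_odd_minus)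

text \<open>The sign in the commutation of generators from rows \<open>a\<close> and
  \<open>b\<close>. With it, even and odd generators obey one set of formulas.\<close>

definition eps :: "nat \<Rightarrow> nat \<Rightarrow> nat \<Rightarrow> complex" where
  "eps m a b = (if m \<le> a \<and> m \<le> b then - 1 else 1)"

lemma eps_sym: "eps m a b = eps m b a"
  and eps_square [simp]: "eps m a b * eps m a b = 1"
  by (auto simp: eps_def)

lemma Xgen_swap: "Xgen m a t * (Xgen m b s * p) = scale (eps m a b) (Xgen m b s * (Xgen m a t * p))"
  using odd_gen_anticommute[of "Index (a - m) t" "Index (b - m) s"]
  by (auto simp: Xgen_def eps_def even_gen_central simp flip: mult.assoc)

lemma dXgen_add: "dXgen m a t (p + q) = dXgen m a t p + dXgen m a t q"
  and dXgen_scale: "dXgen m a t (scale c p) = scale c (dXgen m a t p)"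
  and dXgen_zero [simp]: "dXgen m a t 0 = 0"
  and dXgen_one [simp]: "dXgen m a t 1 = 0"
  by (simp_all add: dXgen_def deriv_add deriv_scale deriv_one)

lemma dXgen_sum: "dXgen m a t (sum f S) = (\<Sum>x\<in>S. dXgen m a t (f x))"
  by (induction S rule: infinite_finite_induct) (simp_all add: dXgen_add)

lemma dXgen_minus: "dXgen m a t (p - q) = dXgen m a t p - dXgen m a t q"
  by (metis add_diff_cancel diff_add_cancel dXgen_add)

lemma dXgen_Xgen_mult: "dXgen m a t (Xgen m b s * p) =
    (if a = b \<and> t = s then p else 0) + scale (eps m a b) (Xgen m b s * dXgen m a t p)"
  by (auto simp: dXgen_def Xgen_def eps_def deriv_even_gen_mult deriv_odd_gen_mult)

lemma dXgen_swap: "dXgen m a t (dXgen m b s p) = scale (eps m a b) (dXgen m b s (dXgen m a t p))"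
  using deriv_odd_anticommute[of "Index (a - m) t" "Index (b - m) s" p]
  by (auto simp: dXgen_def eps_def deriv_even_commute deriv_even_odd_commute)

section \<open>The operators of \<open>gl_N\<close> and their commutators\<close>

lemma E_gl_add: "E_gl m n s t (p + q) = E_gl m n s t p + E_gl m n s t q"
  and E_gl_scale: "E_gl m n s t (scale c p) = scale c (E_gl m n s t p)"
  and E_gl_zero [simp]: "E_gl m n s t 0 = 0"
  and E_gl_one [simp]: "E_gl m n s t 1 = 0"
  by (simp_all add: E_gl_def dXgen_add dXgen_scale distrib_left sum.distrib scale_mult
      superpoly.scale_sum_right)

lemma E_gl_minus: "E_gl m n s t (p - q) = E_gl m n s t p - E_gl m n s t q"
  by (metis add_diff_cancel diff_add_cancel E_gl_add)

lemma E_gl_sum: "E_gl m n s t (sum f S) = (\<Sum>x\<in>S. E_gl m n s t (f x))"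
  by (induction S rule: infinite_finite_induct) (simp_all add: E_gl_add)

lemma E_gl_mult: "E_gl m n s t (p * q) = E_gl m n s t p * q + p * E_gl m n s t q"
  by (simp add: E_gl_def Xgen_dXgen_mult sum.distrib sum_distrib_left sum_distrib_right)

lemma E_gl_Xgen: "E_gl m n s t (Xgen m b u) = (if b < m + 2 * n \<and> t = u then Xgen m b s else 0)"
proof -
  have "E_gl m n s t (Xgen m b u) = (\<Sum>a<m + 2 * n. if a = b then (if t = u then Xgen m b s else 0) else 0)"
    unfolding E_gl_def by (intro sum.cong) (auto simp: dXgen_Xgen)
  then show ?thesis by simp
qed

lemma E_gl_Xgen_mult: "E_gl m n s t (Xgen m b u * p) =
    (if b < m + 2 * n \<and> t = u then Xgen m b s * p else 0) + Xgen m b u * E_gl m n s t p"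
  by (simp add: E_gl_mult E_gl_Xgen)

lemma E_gl_dXgen: "E_gl m n s t (dXgen m b u p) =
    dXgen m b u (E_gl m n s t p) - (if b < m + 2 * n \<and> s = u then dXgen m b t p else 0)"
proof -
  have "dXgen m b u (E_gl m n s t p) = (\<Sum>a<m + 2 * n. (if a = b then (if s = u then dXgen m b t p else 0) else 0)
      + Xgen m a s * dXgen m a t (dXgen m b u p))"
    unfolding E_gl_def dXgen_sum
    by (intro sum.cong refl, subst dXgen_swap[of m _ t b])
      (auto simp: dXgen_Xgen_mult scale_mult eps_sym)
  then show ?thesis by (simp add: sum.distrib E_gl_def)
qed

lemma E_gl_bracket: "E_gl m n s t (E_gl m n u v p) = E_gl m n u v (E_gl m n s t p) +
    (if t = u then E_gl m n s v p else 0) - (if s = v then E_gl m n u t p else 0)"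
proof -
  have "E_gl m n s t (E_gl m n u v p) = (\<Sum>b<m + 2 * n. Xgen m b u * dXgen m b v (E_gl m n s t p) +
      (if t = u then Xgen m b s * dXgen m b v p else 0) - (if s = v then Xgen m b u * dXgen m b t p else 0))"
    unfolding E_gl_def[of m n u v p] E_gl_sum
    by (intro sum.cong) (auto simp: E_gl_Xgen_mult E_gl_dXgen algebra_simps)
  then show ?thesis by (simp add: sum.distrib sum_subtractf E_gl_def)
qed

section \<open>Weights of monomials\<close>

definition wt :: "nat \<Rightarrow> nat \<Rightarrow> nat \<Rightarrow> index smonom \<Rightarrow> nat" where
  "wt m n t u = (\<Sum>a<m. count (fst u) (Index a t)) + card {b. b < 2 * n \<and> Index b t |\<in>| snd u}"

lemma even_gen_deriv_smon: "even_gen i * deriv_even i (smon u) = scale (of_nat (count (fst u) i)) (smon u)"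
proof (cases "i \<in># fst u")
  case True
  then have "smon ({#i#} + (fst u - {#i#}), snd u) = smon u" by simp
  then show ?thesis by (simp add: deriv_smon scale_mult even_gen_def mon_mult_mon mon_mult_def)
qed (simp add: deriv_smon not_in_iff)

lemma scoeff_even_gen_deriv: "scoeff (even_gen i * deriv_even i p) u = of_nat (count (fst u) i) * scoeff p u"
proof (induction p rule: superpoly_induct)
  case (scale c p)
  then show ?case by (simp add: deriv_scale scale_mult)
qed (auto simp: deriv_add distrib_left even_gen_deriv_smon)

lemma odd_gen_deriv_smon: "odd_gen i * deriv_odd i (smon u) = (if i |\<in>| snd u then smon u else 0)"
proof (cases "i |\<in>| snd u")
  case True
  have "inversions {|i|} ({|i|} |\<union>| (snd u |-| {|i|})) = inversions {|i|} {|i|} + inversions {|i|} (snd u |-| {|i|})"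
    by (rule inversions_union_right) auto
  moreover have "{|i|} |\<union>| (snd u |-| {|i|}) = snd u" using True by auto
  ultimately have "inversions {|i|} (snd u) = inversions {|i|} (snd u |-| {|i|})" by simp
  moreover have "finsert i (snd u) = snd u" using True by auto
  ultimately show ?thesis using True
    by (simp add: deriv_smon odd_gen_def scale_mult mon_mult_mon mon_mult_def flip: power_mult_distrib)
qed (simp add: deriv_smon)

lemma scoeff_odd_gen_deriv: "scoeff (odd_gen i * deriv_odd i p) u = (if i |\<in>| snd u then scoeff p u else 0)"
proof (induction p rule: superpoly_induct)
  case (scale c p)
  then show ?case by (simp add: deriv_scale scale_mult)
qed (auto simp: deriv_add distrib_left odd_gen_deriv_smon)

lemma sum_split_parity: "(\<Sum>a<m + k. f a) = (\<Sum>a<m. f a) + (\<Sum>b<k. f (m + b))"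
  for f :: "nat \<Rightarrow> 'a::comm_monoid_add"
  by (induction k) (simp_all add: add.assoc)

text \<open>The diagonal operators count the generators in a column, so every monomial is an
  eigenvector. Eigenvector equations become conditions on single coefficients, and weights are
  natural numbers.\<close>

lemma scoeff_E_gl_diag: "scoeff (E_gl m n t t p) u = of_nat (wt m n t u) * scoeff p u"
proof -
  have "scoeff (E_gl m n t t p) u = (\<Sum>a<m. of_nat (count (fst u) (Index a t)) * scoeff p u) +
      (\<Sum>b<2 * n. if Index b t |\<in>| snd u then scoeff p u else 0)"
    unfolding E_gl_def sum_split_parity
    by (simp add: scoeff_sum Xgen_def dXgen_def scoeff_even_gen_deriv scoeff_odd_gen_deriv)
  also have "(\<Sum>b<2 * n. if Index b t |\<in>| snd u then scoeff p u else 0) =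
      of_nat (card {b. b < 2 * n \<and> Index b t |\<in>| snd u}) * scoeff p u"
    by (simp add: sum.If_cases Int_def)
  finally show ?thesis
    by (simp add: wt_def sum_distrib_right distrib_right)
qed

section \<open>Subalgebras spanned by monomials\<close>

definition mono_span :: "'i set \<Rightarrow> 'i set \<Rightarrow> 'i superpoly set" where
  "mono_span I J = {p. \<forall>u\<in>ssupport p. set_mset (fst u) \<subseteq> I \<and> fset (snd u) \<subseteq> J}"

lemma mono_spanD: "p \<in> mono_span I J \<Longrightarrow> scoeff p u \<noteq> 0 \<Longrightarrow> set_mset (fst u) \<subseteq> I \<and> fset (snd u) \<subseteq> J"
  by (auto simp: mono_span_def in_support_iff)

lemma mono_spanI: "(\<And>u. scoeff p u \<noteq> 0 \<Longrightarrow> set_mset (fst u) \<subseteq> I \<and> fset (snd u) \<subseteq> J) \<Longrightarrow> p \<in> mono_span I J"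
  by (auto simp: mono_span_def in_support_iff)

lemma mono_span_simps [simp]:
  "0 \<in> mono_span I J"
  "p \<in> mono_span I J \<Longrightarrow> scale c p \<in> mono_span I J"
  "p \<in> mono_span I J \<Longrightarrow> - p \<in> mono_span I J"
  by (auto simp: mono_span_def in_support_iff)

lemma mono_span_one [simp]: "1 \<in> mono_span I J"
  by (auto simp: mono_span_def in_support_iff one_superpoly_def split: if_splits)

lemma mono_span_add [simp]: "p \<in> mono_span I J \<Longrightarrow> q \<in> mono_span I J \<Longrightarrow> p + q \<in> mono_span I J"
proof (rule mono_spanI)
  fix u assume "p \<in> mono_span I J" "q \<in> mono_span I J" "scoeff (p + q) u \<noteq> 0"
  moreover from this(3) have "scoeff p u \<noteq> 0 \<or> scoeff q u \<noteq> 0" by auto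
  ultimately show "set_mset (fst u) \<subseteq> I \<and> fset (snd u) \<subseteq> J"
    using mono_spanD by blast
qed

lemma mono_span_diff [simp]: "p \<in> mono_span I J \<Longrightarrow> q \<in> mono_span I J \<Longrightarrow> p - q \<in> mono_span I J"
  using mono_span_add[of p I J "- q"] by simp

lemma mono_span_sum: "(\<And>x. x \<in> S \<Longrightarrow> f x \<in> mono_span I J) \<Longrightarrow> sum f S \<in> mono_span I J"
  by (induction S rule: infinite_finite_induct) auto

lemma subspace_mono_span: "superpoly.subspace (mono_span I J)"
  by (simp add: superpoly.subspace_def)

lemma mono_span_smon: "set_mset (fst u) \<subseteq> I \<Longrightarrow> fset (snd u) \<subseteq> J \<Longrightarrow> smon u \<in> mono_span I J"
  by (auto intro!: mono_spanI split: if_splits)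

lemma mono_span_lin_ext:
  assumes "p \<in> mono_span I J"
    and "\<And>u. set_mset (fst u) \<subseteq> I \<Longrightarrow> fset (snd u) \<subseteq> J \<Longrightarrow> F u \<in> mono_span I' J'"
  shows "lin_ext F p \<in> mono_span I' J'"
  unfolding lin_ext_def
proof (rule mono_span_sum)
  fix u assume "u \<in> ssupport p"
  then have "F u \<in> mono_span I' J'" using assms(1) by (intro assms(2)) (auto simp: mono_span_def)
  then show "scale (scoeff p u) (F u) \<in> mono_span I' J'" by simp
qed

lemma mono_span_mult: "p \<in> mono_span I J \<Longrightarrow> q \<in> mono_span I J \<Longrightarrow> p * q \<in> mono_span I J"
  unfolding times_superpoly_def
  by (intro mono_span_lin_ext)
    (auto simp: mon_mult_def intro!: mono_span_smon mono_span_simps(2))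

lemma mono_span_gen: "i \<in> I \<Longrightarrow> even_gen i \<in> mono_span I J" "i \<in> J \<Longrightarrow> odd_gen i \<in> mono_span I J"
  by (auto simp: even_gen_def odd_gen_def intro!: mono_span_smon)

lemma mono_span_deriv:
  "p \<in> mono_span I J \<Longrightarrow> deriv_even i p \<in> mono_span I J"
  "q \<in> mono_span I' J' \<Longrightarrow> deriv_odd i' q \<in> mono_span I' J'"
proof -
  show "deriv_even i p \<in> mono_span I J" if "p \<in> mono_span I J"
    unfolding deriv_even_def using that
  proof (rule mono_span_lin_ext)
    fix u :: "'a smonom" assume "set_mset (fst u) \<subseteq> I" "fset (snd u) \<subseteq> J"
    moreover have "set_mset (fst u - {#i#}) \<subseteq> set_mset (fst u)" by (auto dest: in_diffD)
    ultimately show "(case u of (\<mu>, A) \<Rightarrow> scale (of_nat (count \<mu> i)) (smon (\<mu> - {#i#}, A))) \<in> mono_span I J"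
      by (auto simp: case_prod_beta intro!: mono_span_smon mono_span_simps(2))
  qed
  show "deriv_odd i' q \<in> mono_span I' J'" if "q \<in> mono_span I' J'"
    unfolding deriv_odd_def using that
  proof (rule mono_span_lin_ext)
    fix u :: "'b smonom" assume "set_mset (fst u) \<subseteq> I'" "fset (snd u) \<subseteq> J'"
    moreover have "fset (snd u |-| {|i'|}) \<subseteq> fset (snd u)" by auto
    ultimately show "(case u of (\<mu>, A) \<Rightarrow> if i' |\<in>| A
        then scale ((-1) ^ inversions {|i'|} A) (smon (\<mu>, A |-| {|i'|})) else 0) \<in> mono_span I' J'"
      by (auto simp: case_prod_beta intro!: mono_span_smon mono_span_simps(2))
  qed
qed

lemma mono_span_induct [consumes 1, case_names one add scale even odd]:
  assumes "p \<in> mono_span I J" "P 1"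
    "\<And>p q. p \<in> mono_span I J \<Longrightarrow> q \<in> mono_span I J \<Longrightarrow> P p \<Longrightarrow> P q \<Longrightarrow> P (p + q)"
    "\<And>c p. p \<in> mono_span I J \<Longrightarrow> P p \<Longrightarrow> P (scale c p)"
    "\<And>i p. i \<in> I \<Longrightarrow> p \<in> mono_span I J \<Longrightarrow> P p \<Longrightarrow> P (even_gen i * p)"
    "\<And>i p. i \<in> J \<Longrightarrow> p \<in> mono_span I J \<Longrightarrow> P p \<Longrightarrow> P (odd_gen i * p)"
  shows "P p"
proof -
  have "p \<in> mono_span I J \<and> P p"
  proof (rule superpoly_gen_induct[of p I J])
    show "set_mset (fst u) \<subseteq> I \<and> fset (snd u) \<subseteq> J" if "u \<in> ssupport p" for u
      using assms(1) that by (simp add: mono_span_def)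
  qed (use assms(2-) in \<open>simp_all add: mono_span_mult mono_span_gen\<close>)
  then show ?thesis ..
qed

lemma sym_superalg_eq: "sym_superalg m n N =
    mono_span {Index a t | a t. a < m \<and> t < N} {Index a t | a t. a < 2 * n \<and> t < N}"
  unfolding sym_superalg_def mono_span_def by (simp add: case_prod_beta)

lemma sym_induct [consumes 1, case_names one add scale gen]:
  assumes "p \<in> sym_superalg m n N" "P 1"
    "\<And>p q. p \<in> sym_superalg m n N \<Longrightarrow> q \<in> sym_superalg m n N \<Longrightarrow> P p \<Longrightarrow> P q \<Longrightarrow> P (p + q)"
    "\<And>c p. p \<in> sym_superalg m n N \<Longrightarrow> P p \<Longrightarrow> P (scale c p)"
    "\<And>a t p. a < m + 2 * n \<Longrightarrow> t < N \<Longrightarrow> p \<in> sym_superalg m n N \<Longrightarrow> P p \<Longrightarrow> P (Xgen m a t * p)"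
  shows "P p"
  using assms(1) unfolding sym_superalg_eq
proof (induction p rule: mono_span_induct)
  case (even i p)
  then obtain a t where i: "i = Index a t" "a < m" "t < N" by auto
  then show ?case using assms(5)[of a t p] even by (simp add: sym_superalg_eq Xgen_def)
next
  case (odd i p)
  then obtain a t where i: "i = Index a t" "a < 2 * n" "t < N" by auto
  then show ?case using assms(5)[of "m + a" t p] odd by (simp add: sym_superalg_eq Xgen_def)
qed (use assms in \<open>auto simp: sym_superalg_eq\<close>)

lemma sym_Xgen: "a < m + 2 * n \<Longrightarrow> t < N \<Longrightarrow> Xgen m a t \<in> sym_superalg m n N"
  by (auto simp: sym_superalg_eq Xgen_def intro!: mono_span_gen)

lemma sym_dXgen: "p \<in> sym_superalg m n N \<Longrightarrow> dXgen m a t p \<in> sym_superalg m n N"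
  by (auto simp: sym_superalg_eq dXgen_def intro!: mono_span_deriv)

lemma sym_mult: "p \<in> sym_superalg m n N \<Longrightarrow> q \<in> sym_superalg m n N \<Longrightarrow> p * q \<in> sym_superalg m n N"
  by (simp add: sym_superalg_eq mono_span_mult)

lemma subspace_sym: "superpoly.subspace (sym_superalg m n N)"
  by (simp add: sym_superalg_eq subspace_mono_span)

lemma sym_E_gl: "p \<in> sym_superalg m n N \<Longrightarrow> s < N \<Longrightarrow> E_gl m n s t p \<in> sym_superalg m n N"
  unfolding E_gl_def
  by (intro superpoly.subspace_sum[OF subspace_sym] sym_mult sym_Xgen sym_dXgen) auto

section \<open>The parity involution as an algebra automorphism\<close>

lemma parity_inv_sum: "parity_inv (sum f S) = (\<Sum>x\<in>S. parity_inv (f x))"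
  by (induction S rule: infinite_finite_induct) (simp_all add: par_add)

lemma fset_disj: "A |\<inter>| B = {||} \<Longrightarrow> fset A \<inter> fset B = {}"
  by (metis bot_fset.rep_eq inf_fset.rep_eq)

lemma parity_inv_mult: "parity_inv (p * q) = parity_inv p * parity_inv q"
proof -
  have base: "parity_inv (smon u * smon v) = parity_inv (smon u) * parity_inv (smon v)" for u v :: "'a smonom"
    by (simp add: mon_mult_mon mon_mult_def par_smon par_scale scale_mult fcard.rep_eq card_Un_disjoint fset_disj power_add mult_ac)
  have "parity_inv (smon u * q) = parity_inv (smon u) * parity_inv q" for u
    by (induction q rule: superpoly_induct) (simp_all add: base algebra_simps par_add par_scale scale_mult)
  then show ?thesis
    by (induction p rule: superpoly_induct) (simp_all add: algebra_simps par_add par_scale scale_mult)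
qed

lemma parity_inv_one [simp]: "parity_inv 1 = 1"
  by (simp add: one_superpoly_def par_smon fcard.rep_eq)

lemma parity_inv_Xgen: "parity_inv (Xgen m a t) = scale ((- 1) ^ parity_idx m a) (Xgen m a t)"
  by (simp add: Xgen_def parity_inv_gen parity_idx_def)

section \<open>The matrix form of the orthosymplectic condition\<close>

text \<open>The row paired with \<open>a\<close> by the form: row \<open>a\<close> of
  \<open>kappa_inv\<close> has its only nonzero entry, \<open>kv m n a\<close>, in column
  \<open>star m n a\<close>. Double sums over the form thereby become single sums.\<close>

definition star :: "nat \<Rightarrow> nat \<Rightarrow> nat \<Rightarrow> nat" where
  "star m n a = (if a < m then a else if a < m + n then a + n else a - n)"

definition kv :: "nat \<Rightarrow> nat \<Rightarrow> nat \<Rightarrow> complex" where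
  "kv m n a = (if m \<le> a \<and> a < m + n then - 1 else 1)"

lemma star_less: "a < m + 2 * n \<Longrightarrow> star m n a < m + 2 * n"
  and star_star: "a < m + 2 * n \<Longrightarrow> star m n (star m n a) = a"
  and star_ge: "m \<le> star m n a \<longleftrightarrow> m \<le> a"
  and kv_star: "a < m + 2 * n \<Longrightarrow> kv m n (star m n a) = eps m a a * kv m n a"
  and kv_square [simp]: "kv m n a * kv m n a = 1"
  by (auto simp: star_def kv_def eps_def)

lemma eps_star: "eps m (star m n a) b = eps m a b" "eps m b (star m n a) = eps m b a"
  by (simp_all add: eps_def star_ge)

lemma parity_star: "parity_idx m (star m n a) = parity_idx m a"
  using star_ge[of m n a] by (auto simp: parity_idx_def)

lemma sum_star: "(\<Sum>a<m + 2 * n. f (star m n a)) = (\<Sum>a<m + 2 * n. f a)"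
  by (rule sum.reindex_bij_witness[of _ "star m n" "star m n"]) (auto simp: star_less star_star)

lemma eta_index: "a < 2 * n \<Longrightarrow> b < 2 * n \<Longrightarrow>
    eta n $$ (a, b) = (if a < n then (if b = a + n then 1 else 0) else if a = b + n then - 1 else 0)"
  by (simp add: eta_def) auto

lemma kappa_inv_index:
  assumes "a < m + 2 * n" "b < m + 2 * n"
  shows "kappa_inv m n $$ (a, b) = (if b = star m n a then kv m n a else 0)"
proof (cases "a < m \<or> b < m")
  case True
  then show ?thesis using assms carrier_matD[OF eta_carrier[of n]]
    by (cases "a < m"; cases "b < m") (auto simp: kappa_inv_def star_def kv_def eps_def)
next
  case False
  then obtain a' b' where ab: "a = m + a'" "b = m + b'" by (metis le_iff_add linorder_not_less)
  have "kappa_inv m n $$ (a, b) = - (eta n $$ (a', b'))"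
    using assms carrier_matD[OF eta_carrier[of n]] unfolding ab by (simp add: kappa_inv_def)
  then show ?thesis using assms unfolding ab by (simp add: eta_index star_def kv_def eps_def) arith
qed

lemma kappa_index:
  assumes "a < m + 2 * n" "b < m + 2 * n"
  shows "kappa m n $$ (a, b) = (if b = star m n a then eps m a a * kv m n a else 0)"
proof (cases "a < m \<or> b < m")
  case True
  then show ?thesis using assms carrier_matD[OF eta_carrier[of n]]
    by (cases "a < m"; cases "b < m") (auto simp: kappa_def star_def kv_def eps_def)
next
  case False
  then obtain a' b' where ab: "a = m + a'" "b = m + b'" by (metis le_iff_add linorder_not_less)
  have "kappa m n $$ (a, b) = (eta n $$ (a', b'))"
    using assms carrier_matD[OF eta_carrier[of n]] unfolding ab by (simp add: kappa_def)
  then show ?thesis using assms unfolding ab by (simp add: eta_index star_def kv_def eps_def) arith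
qed

lemma kappa_carrier: "kappa m n \<in> carrier_mat (m + 2 * n) (m + 2 * n)"
  using eta_carrier by (simp add: kappa_def four_block_carrier_mat)

lemma bform_eq:
  assumes "v \<in> carrier_vec (m + 2 * n)" "w \<in> carrier_vec (m + 2 * n)"
  shows "bform m n v w = (\<Sum>a<m + 2 * n. v $ a * (eps m a a * kv m n a) * w $ star m n a)"
proof -
  have "(kappa m n *\<^sub>v w) $ a = eps m a a * kv m n a * w $ star m n a" if "a < m + 2 * n" for a
  proof -
    have "(kappa m n *\<^sub>v w) $ a = (\<Sum>b<m + 2 * n. kappa m n $$ (a, b) * w $ b)"
      using that assms carrier_matD[OF kappa_carrier[of m n]]
      by (simp add: scalar_prod_def atLeast0LessThan)
    also have "\<dots> = (\<Sum>b<m + 2 * n. if b = star m n a then eps m a a * kv m n a * w $ b else 0)"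
      by (rule sum.cong) (auto simp: kappa_index that)
    finally show ?thesis using star_less[OF that] by simp
  qed
  then show ?thesis
    using assms carrier_matD[OF kappa_carrier[of m n]]
    by (simp add: bform_def scalar_prod_def atLeast0LessThan mult.assoc)
qed

lemma mult_mat_vec_index: "Y \<in> carrier_mat k k \<Longrightarrow> v \<in> carrier_vec k \<Longrightarrow> a < k \<Longrightarrow>
    (Y *\<^sub>v v) $ a = (\<Sum>b<k. Y $$ (a, b) * v $ b)"
  by (simp add: scalar_prod_def atLeast0LessThan)

text \<open>Apart from a sign that depends only on the parity of \<open>v\<close>, the condition is
  bilinear, so it may be tested on basis vectors.\<close>

lemma osp_homog_iff:
  "Y \<in> osp_homog m n p \<longleftrightarrow> Y \<in> gl_homog m n p \<and> (\<forall>a<m + 2 * n. \<forall>b<m + 2 * n.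
     Y $$ (star m n b, a) * (eps m b b * kv m n (star m n b)) +
     (-1) ^ (p * parity_idx m a) * (eps m a a * kv m n a) * Y $$ (star m n a, b) = 0)"
  (is "_ \<longleftrightarrow> _ \<and> (\<forall>a<_. \<forall>b<_. ?C a b = 0)")
proof -
  let ?M = "m + 2 * n"
  have L: "bform m n (Y *\<^sub>v v) w =
      (\<Sum>a<?M. \<Sum>b<?M. v $ a * w $ b * (Y $$ (star m n b, a) * (eps m b b * kv m n (star m n b))))"
    and R: "bform m n v (Y *\<^sub>v w) =
      (\<Sum>a<?M. \<Sum>b<?M. v $ a * w $ b * (eps m a a * kv m n a * Y $$ (star m n a, b)))"
    if Y: "Y \<in> carrier_mat ?M ?M" and vw: "v \<in> carrier_vec ?M" "w \<in> carrier_vec ?M" for v w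
  proof -
    have "bform m n (Y *\<^sub>v v) w = (\<Sum>b<?M. (\<Sum>a<?M. Y $$ (b, a) * v $ a) * (eps m b b * kv m n b) * w $ star m n b)"
      using bform_eq[of "Y *\<^sub>v v" m n w] Y vw by (simp add: mult_mat_vec_index del: index_mult_mat_vec)
    also have "\<dots> = (\<Sum>b<?M. (\<Sum>a<?M. Y $$ (star m n b, a) * v $ a) * (eps m b b * kv m n (star m n b)) * w $ b)"
      by (subst sum_star[of _ m n, symmetric]) (simp add: star_star eps_star)
    also have "\<dots> = (\<Sum>b<?M. \<Sum>a<?M. v $ a * w $ b * (Y $$ (star m n b, a) * (eps m b b * kv m n (star m n b))))"
      by (simp add: sum_distrib_right sum_distrib_left mult_ac)
    also have "\<dots> = (\<Sum>a<?M. \<Sum>b<?M. v $ a * w $ b * (Y $$ (star m n b, a) * (eps m b b * kv m n (star m n b))))"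
      by (rule sum.swap)
    finally show "bform m n (Y *\<^sub>v v) w = \<dots>" .
    have "bform m n v (Y *\<^sub>v w) = (\<Sum>a<?M. v $ a * (eps m a a * kv m n a) * (\<Sum>b<?M. Y $$ (star m n a, b) * w $ b))"
      using bform_eq[of v m n "Y *\<^sub>v w"] Y vw by (simp add: mult_mat_vec_index star_less del: index_mult_mat_vec)
    then show "bform m n v (Y *\<^sub>v w) = (\<Sum>a<?M. \<Sum>b<?M. v $ a * w $ b * (eps m a a * kv m n a * Y $$ (star m n a, b)))"
      by (simp add: sum_distrib_left mult_ac)
  qed
  show ?thesis
  proof (intro iffI conjI allI impI)
    assume Y: "Y \<in> osp_homog m n p"
    then show "Y \<in> gl_homog m n p" by (simp add: osp_homog_def)
    then have Yc: "Y \<in> carrier_mat ?M ?M" by (simp add: gl_homog_def)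
    fix a b assume ab: "a < ?M" "b < ?M"
    have h: "unit_vec ?M c \<in> V_homog m n (parity_idx m c)" if "c < ?M" for c
      using that by (auto simp: V_homog_def)
    have "parity_idx m c \<in> {0, 1}" for c by (simp add: parity_idx_def)
    then have "bform m n (Y *\<^sub>v unit_vec ?M a) (unit_vec ?M b) +
        (-1) ^ (p * parity_idx m a) * bform m n (unit_vec ?M a) (Y *\<^sub>v unit_vec ?M b) = 0"
      using Y h[OF ab(1)] h[OF ab(2)] unfolding osp_homog_def by blast
    moreover have s: "(\<Sum>a'<?M. \<Sum>b'<?M. (unit_vec ?M a $ a') * (unit_vec ?M b $ b') * f a' b') = f a b" for f :: "nat \<Rightarrow> nat \<Rightarrow> complex"
    proof -
      have "(\<Sum>a'<?M. \<Sum>b'<?M. (unit_vec ?M a $ a') * (unit_vec ?M b $ b') * f a' b') =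
          (\<Sum>a'<?M. \<Sum>b'<?M. if b' = b then (if a' = a then f a' b' else 0) else 0)"
        using ab by (intro sum.cong refl) (simp add: unit_vec_def)
      also have "\<dots> = (\<Sum>a'<?M. if a' = a then f a' b else 0)"
        using ab by (intro sum.cong refl) (simp add: sum.delta)
      finally show ?thesis using ab by simp
    qed
    ultimately show "?C a b = 0"
      using L[OF Yc, of "unit_vec ?M a" "unit_vec ?M b"] R[OF Yc, of "unit_vec ?M a" "unit_vec ?M b"]
      by (simp add: s mult.assoc)
  next
    assume A: "Y \<in> gl_homog m n p \<and> (\<forall>a<?M. \<forall>b<?M. ?C a b = 0)"
    then have Yc: "Y \<in> carrier_mat ?M ?M" by (simp add: gl_homog_def)
    have "bform m n (Y *\<^sub>v v) w + (-1) ^ (p * c) * bform m n v (Y *\<^sub>v w) = 0"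
      if v: "v \<in> V_homog m n c" and w: "w \<in> V_homog m n d" for c d v w
    proof -
      have vw: "v \<in> carrier_vec ?M" "w \<in> carrier_vec ?M" using v w by (auto simp: V_homog_def)
      have "bform m n (Y *\<^sub>v v) w + (-1) ^ (p * c) * bform m n v (Y *\<^sub>v w) =
          (\<Sum>a<?M. \<Sum>b<?M. v $ a * w $ b * (Y $$ (star m n b, a) * (eps m b b * kv m n (star m n b)) +
           (-1) ^ (p * c) * (eps m a a * kv m n a) * Y $$ (star m n a, b)))"
        unfolding L[OF Yc vw] R[OF Yc vw]
        by (simp add: sum_distrib_left sum.distrib[symmetric] algebra_simps)
      \<comment> \<open>Only coordinates of parity \<open>c\<close> occur in \<open>v\<close>, so
        the common sign can be replaced by the sign attached to each row.\<close>
      also have "\<dots> = (\<Sum>a<?M. \<Sum>b<?M. v $ a * w $ b * ?C a b)"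
        using v by (intro sum.cong refl) (auto simp: V_homog_def)
      also have "\<dots> = 0" using A by (intro sum.neutral ballI) simp
      finally show ?thesis .
    qed
    then show "Y \<in> osp_homog m n p" using A unfolding osp_homog_def by blast
  qed
qed

section \<open>The algebra of invariants\<close>

text \<open>The matrix unit of \<open>gl(V)\<close> taking \<open>e_b\<close> to \<open>e_a\<close>:
  the row counterpart of \<open>E_gl\<close>. A single unit need not lie in \<open>osp(V)\<close>,
  but elements of \<open>osp(V)\<close> are combinations of units.\<close>

definition unit_act :: "nat \<Rightarrow> nat \<Rightarrow> nat \<Rightarrow> nat \<Rightarrow> index superpoly \<Rightarrow> index superpoly" where
  "unit_act m N a b p = (\<Sum>t<N. Xgen m a t * dXgen m b t p)"

lemma osp_act_eq: "osp_act m n N Y p =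
    (\<Sum>a<m + 2 * n. \<Sum>b<m + 2 * n. scale (Y $$ (b, a)) (unit_act m N b a p))"
  by (simp add: osp_act_def unit_act_def superpoly.scale_sum_right)

lemma unit_act_add: "unit_act m N a b (p + q) = unit_act m N a b p + unit_act m N a b q"
  and unit_act_scale: "unit_act m N a b (scale c p) = scale c (unit_act m N a b p)"
  and unit_act_zero [simp]: "unit_act m N a b 0 = 0"
  and unit_act_one [simp]: "unit_act m N a b 1 = 0"
  by (simp_all add: unit_act_def dXgen_add dXgen_scale distrib_left sum.distrib scale_mult
      superpoly.scale_sum_right)

lemma unit_act_mult: "unit_act m N a b (p * q) = unit_act m N a b p * q +
    (if parity_idx m a = parity_idx m b then p else parity_inv p) * unit_act m N a b q"
  by (simp add: unit_act_def Xgen_dXgen_mult sum.distrib sum_distrib_left sum_distrib_right)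

text \<open>Row and column operations commute. The bounds on \<open>s\<close> and \<open>t\<close>
  matter because \<open>unit_act\<close> only sees the columns below \<open>N\<close>; the two
  correction terms of the commutator cancel inside that range.\<close>

lemma unit_act_E_gl:
  assumes "a < m + 2 * n" "b < m + 2 * n" "s < N" "t < N"
  shows "unit_act m N a b (E_gl m n s t p) = E_gl m n s t (unit_act m N a b p)"
proof -
  have "E_gl m n s t (unit_act m N a b p) = (\<Sum>r<N. (if t = r then Xgen m a s * dXgen m b t p else 0)
      + Xgen m a r * dXgen m b r (E_gl m n s t p) - (if s = r then Xgen m a s * dXgen m b t p else 0))"
    unfolding unit_act_def E_gl_sum using assms(1,2)
    by (intro sum.cong) (auto simp: E_gl_Xgen_mult E_gl_dXgen algebra_simps)
  then show ?thesis using assms(3,4) by (simp add: sum.distrib sum_subtractf unit_act_def)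
qed

lemma osp_act_E_gl:
  assumes "s < N" "t < N"
  shows "osp_act m n N Y (E_gl m n s t p) = E_gl m n s t (osp_act m n N Y p)"
  using assms by (simp add: osp_act_eq E_gl_sum E_gl_scale unit_act_E_gl)

lemma osp_act_add: "osp_act m n N Y (p + q) = osp_act m n N Y p + osp_act m n N Y q"
  and osp_act_scale: "osp_act m n N Y (scale c p) = scale c (osp_act m n N Y p)"
  and osp_act_zero [simp]: "osp_act m n N Y 0 = 0"
  and osp_act_one [simp]: "osp_act m n N Y 1 = 0"
  by (simp_all add: osp_act_eq unit_act_add unit_act_scale superpoly.scale_right_distrib sum.distrib
      superpoly.scale_sum_right mult.commute)

lemma osp_act_sum: "osp_act m n N Y (sum f S) = (\<Sum>x\<in>S. osp_act m n N Y (f x))"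
  by (induction S rule: infinite_finite_induct) (simp_all add: osp_act_add)

lemma osp_act_mult:
  assumes "Y \<in> gl_homog m n k"
  shows "osp_act m n N Y (p * q) = osp_act m n N Y p * q + (if k = 0 then p else parity_inv p) * osp_act m n N Y q"
proof -
  have "scale (Y $$ (b, a)) (unit_act m N b a (p * q)) = scale (Y $$ (b, a)) (unit_act m N b a p) * q +
      (if k = 0 then p else parity_inv p) * scale (Y $$ (b, a)) (unit_act m N b a q)"
    if "a < m + 2 * n" "b < m + 2 * n" for a b
  proof (cases "Y $$ (b, a) = 0")
    case False
    then have "(parity_idx m b + parity_idx m a) mod 2 = k"
      using assms that by (simp add: gl_homog_def)
    then have "parity_idx m b = parity_idx m a \<longleftrightarrow> k = 0"
      by (auto simp: parity_idx_def split: if_splits)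
    then show ?thesis
      by (simp add: unit_act_mult superpoly.scale_right_distrib scale_mult)
  qed simp
  then show ?thesis
    by (simp add: osp_act_eq sum.distrib sum_distrib_left sum_distrib_right)
qed

lemma osp_act_mat_add:
  assumes "Y \<in> carrier_mat (m + 2 * n) (m + 2 * n)" "Z \<in> carrier_mat (m + 2 * n) (m + 2 * n)"
  shows "osp_act m n N (Y + Z) p = osp_act m n N Y p + osp_act m n N Z p"
  using assms by (simp add: osp_act_eq superpoly.scale_left_distrib sum.distrib)

lemma zero_osp_homog: "0\<^sub>m (m + 2 * n) (m + 2 * n) \<in> osp_homog m n k"
  by (simp add: osp_homog_iff gl_homog_def star_less)

lemma osp_homog_carrier: "Y \<in> osp_homog m n k \<Longrightarrow> Y \<in> carrier_mat (m + 2 * n) (m + 2 * n)"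
  by (simp add: osp_homog_def gl_homog_def)

lemma osp_homog_subset: "osp_homog m n 0 \<subseteq> osp m n" "osp_homog m n 1 \<subseteq> osp m n"
proof -
  have "Y = Y + 0\<^sub>m (m + 2 * n) (m + 2 * n)" "Y = 0\<^sub>m (m + 2 * n) (m + 2 * n) + Y" if "Y \<in> osp_homog m n k" for Y k
    using osp_homog_carrier[OF that] by simp_all
  then show "osp_homog m n 0 \<subseteq> osp m n" "osp_homog m n 1 \<subseteq> osp m n"
    unfolding osp_def using zero_osp_homog by blast+
qed

lemma osp_act_osp_iff: "(\<forall>Y\<in>osp m n. osp_act m n N Y p = 0) \<longleftrightarrow>
    (\<forall>k\<in>{0, 1}. \<forall>Y\<in>osp_homog m n k. osp_act m n N Y p = 0)"
  using osp_homog_subset[of m n]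
  by (auto simp: osp_def osp_act_mat_add osp_homog_carrier) fastforce+

lemma group_act_add: "group_act m n A B (p + q) = group_act m n A B p + group_act m n A B q"
  and group_act_scale: "group_act m n A B (scale c p) = scale c (group_act m n A B p)"
  and group_act_one [simp]: "group_act m n A B 1 = 1"
  by (simp_all add: group_act_def subst_hom_simps)

lemma group_act_zero [simp]: "group_act m n A B 0 = 0"
  using group_act_scale[of m n A B 0 0] by simp

lemma group_act_sum: "group_act m n A B (sum f S) = (\<Sum>x\<in>S. group_act m n A B (f x))"
  by (induction S rule: infinite_finite_induct) (simp_all add: group_act_add)

lemma group_act_Xgen: "group_act m n A B (Xgen m c r) =
    (if c < m then \<Sum>b<m. scale (A $$ (b, c)) (Xgen m b r)
     else \<Sum>b<2 * n. scale (B $$ (b, c - m)) (Xgen m (m + b) r))"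
  by (simp add: Xgen_def[of m c] group_act_def subst_hom_simps)

lemma group_act_E_gl:
  assumes "p \<in> sym_superalg m n N"
  shows "group_act m n A B (E_gl m n s t p) = E_gl m n s t (group_act m n A B p)"
  using assms
proof (induction p rule: sym_induct)
  case (gen a r p)
  have "E_gl m n s t (group_act m n A B (Xgen m a r)) = (if t = r then group_act m n A B (Xgen m a s) else 0)"
    by (auto simp: group_act_Xgen E_gl_sum E_gl_scale E_gl_Xgen)
  then show ?case using gen
    by (simp add: E_gl_mult E_gl_Xgen group_act_add group_act_mult)
qed (simp_all add: E_gl_add E_gl_scale group_act_add group_act_scale)

lemma osp_invariantsD:
  assumes "p \<in> osp_invariants m n N"
  shows "p \<in> sym_superalg m n N" "k \<in> {0, 1} \<Longrightarrow> Y \<in> osp_homog m n k \<Longrightarrow> osp_act m n N Y p = 0"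
    "Y \<in> osp_homog m n 0 \<Longrightarrow> osp_act m n N Y p = 0"
    "Y \<in> osp_homog m n (Suc 0) \<Longrightarrow> osp_act m n N Y p = 0"
    "A \<in> O_group m \<Longrightarrow> B \<in> Sp_group n \<Longrightarrow> group_act m n A B p = p"
  using assms osp_homog_subset[of m n] by (auto simp: osp_invariants_def)

lemma osp_invariantsI:
  assumes "p \<in> sym_superalg m n N" "\<And>k Y. k \<in> {0, 1} \<Longrightarrow> Y \<in> osp_homog m n k \<Longrightarrow> osp_act m n N Y p = 0"
    "\<And>A B. A \<in> O_group m \<Longrightarrow> B \<in> Sp_group n \<Longrightarrow> group_act m n A B p = p"
  shows "p \<in> osp_invariants m n N"
  unfolding osp_invariants_def using assms osp_act_osp_iff[of m n N p] by simp

lemma sym_one: "1 \<in> sym_superalg m n N"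
  by (simp add: sym_superalg_eq)

lemma subalgebra_osp_invariants: "is_subalgebra (osp_invariants m n N)"
proof -
  note S = subspace_sym[of m n N]
  have "superpoly.subspace (osp_invariants m n N)"
    unfolding superpoly.subspace_def
    by (auto intro!: osp_invariantsI simp: superpoly.subspace_0[OF S] superpoly.subspace_add[OF S]
        superpoly.subspace_scale[OF S] osp_invariantsD osp_act_add osp_act_scale group_act_add group_act_scale)
  moreover have "1 \<in> osp_invariants m n N"
    by (intro osp_invariantsI) (auto simp: sym_one)
  moreover have "p * q \<in> osp_invariants m n N" if pq: "p \<in> osp_invariants m n N" "q \<in> osp_invariants m n N" for p q
  proof (rule osp_invariantsI)
    fix k :: nat and Y assume Y: "k \<in> {0, 1}" "Y \<in> osp_homog m n k"
    then have "Y \<in> gl_homog m n k" by (simp add: osp_homog_def)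
    then show "osp_act m n N Y (p * q) = 0"
      using pq[THEN osp_invariantsD(2), OF Y] by (simp add: osp_act_mult)
  qed (use pq in \<open>simp_all add: sym_mult group_act_mult osp_invariantsD\<close>)
  ultimately show ?thesis by (simp add: is_subalgebra_def)
qed

lemma gl_submodule_osp_invariants: "gl_submodule m n N (osp_invariants m n N)"
  using subalgebra_osp_invariants[of m n N]
  unfolding gl_submodule_def is_subalgebra_def
  by (auto intro!: osp_invariantsI simp: sym_E_gl osp_invariantsD osp_act_E_gl
      group_act_E_gl[of _ m n N])

subsection \<open>The quadratic invariants\<close>

lemma q_elem_eq: "q_elem m n t s = (\<Sum>a<m + 2 * n. scale (kv m n a) (Xgen m a t * Xgen m (star m n a) s))"
proof -
  have "q_elem m n t s = (\<Sum>a<m + 2 * n. \<Sum>b<m + 2 * n.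
      if b = star m n a then scale (kv m n a) (Xgen m a t * Xgen m b s) else 0)"
    unfolding q_elem_def by (intro sum.cong refl) (simp add: kappa_inv_index)
  then show ?thesis by (simp add: star_less)
qed

lemma q_elem_sym_superalg: "t < N \<Longrightarrow> s < N \<Longrightarrow> q_elem m n t s \<in> sym_superalg m n N"
  unfolding q_elem_eq
  by (intro superpoly.subspace_sum[OF subspace_sym] superpoly.subspace_scale[OF subspace_sym] sym_mult sym_Xgen)
    (auto simp: star_less)

lemma unit_act_Xgen: "unit_act m N a b (Xgen m c t) = (if b = c \<and> t < N then Xgen m a t else 0)"
proof -
  have "unit_act m N a b (Xgen m c t) = (\<Sum>r<N. if r = t then (if b = c then Xgen m a t else 0) else 0)"
    unfolding unit_act_def by (intro sum.cong) (auto simp: dXgen_Xgen)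
  then show ?thesis by simp
qed

lemma osp_act_Xgen: "c < m + 2 * n \<Longrightarrow> t < N \<Longrightarrow>
    osp_act m n N Y (Xgen m c t) = (\<Sum>b<m + 2 * n. scale (Y $$ (b, c)) (Xgen m b t))"
proof -
  assume c: "c < m + 2 * n" and t: "t < N"
  have "osp_act m n N Y (Xgen m c t) = (\<Sum>a<m + 2 * n. if a = c then (\<Sum>b<m + 2 * n. scale (Y $$ (b, a)) (Xgen m b t)) else 0)"
    unfolding osp_act_eq by (intro sum.cong refl) (simp add: unit_act_Xgen t)
  then show ?thesis using c by simp
qed

text \<open>Applying the superderivation to both factors and reindexing one of the sums by
  \<open>star\<close> leaves a combination of the products \<open>Xgen m c t * Xgen m d s\<close>
  whose coefficients are the defining relations of \<open>osp(V)\<close>.\<close>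

lemma osp_act_q_elem:
  assumes Y: "Y \<in> osp_homog m n k" and k: "k \<in> {0, 1}" and ts: "t < N" "s < N"
  shows "osp_act m n N Y (q_elem m n t s) = 0"
proof -
  let ?M = "m + 2 * n"
  have gl: "Y \<in> gl_homog m n k" using Y by (simp add: osp_homog_def)
  \<comment> \<open>The coefficient of \<open>Xgen m c t * Xgen m d s\<close>. It is the matrix
    condition for the pair \<open>star m n d\<close>, \<open>star m n c\<close>, rewritten by means
    of the parity of \<open>Y\<close>.\<close>
  have rel: "kv m n (star m n d) * Y $$ (c, star m n d) + (-1) ^ (k * parity_idx m c) * kv m n c * Y $$ (d, star m n c) = 0"
    if cd: "c < ?M" "d < ?M" for c d
  proof -
    have r: "Y $$ (c, star m n d) * (eps m c c * kv m n c) +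
        (-1) ^ (k * parity_idx m d) * (eps m d d * kv m n (star m n d)) * Y $$ (d, star m n c) = 0"
      using Y cd star_less[OF cd(1)] star_less[OF cd(2)]
      unfolding osp_homog_iff
      by (metis (no_types, lifting) star_star eps_star(1) eps_star(2) parity_star)
    show ?thesis
    \<comment> \<open>If one of the entries is nonzero, the degree of \<open>Y\<close> ties the
      parities of \<open>c\<close> and \<open>d\<close> to \<open>k\<close>, and this is what makes
      the two sign conventions agree.\<close>
    proof (cases "Y $$ (c, star m n d) = 0 \<and> Y $$ (d, star m n c) = 0")
      case False
      have nz: "eps m c c * kv m n c \<noteq> 0" "eps m d d * kv m n (star m n d) \<noteq> 0"
        by (auto simp: eps_def kv_def)
      have par: "(parity_idx m c + parity_idx m d) mod 2 = k"
      proof (cases "Y $$ (c, star m n d) = 0")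
        case True
        then have "(parity_idx m d + parity_idx m (star m n c)) mod 2 = k"
          using gl cd False star_less[OF cd(1)] unfolding gl_homog_def by blast
        then show ?thesis by (simp add: parity_star add.commute)
      next
        case False
        then have "(parity_idx m c + parity_idx m (star m n d)) mod 2 = k"
          using gl cd star_less[OF cd(2)] unfolding gl_homog_def by blast
        then show ?thesis by (simp add: parity_star)
      qed
      show ?thesis
      proof -
        define \<alpha> \<beta> x y s where "\<alpha> = kv m n c" "\<beta> = kv m n (star m n d)"
          "x = Y $$ (c, star m n d)" "y = Y $$ (d, star m n c)" "s = (-1 :: complex) ^ (k * parity_idx m c)"
        note defs = this
        have "\<alpha> * x + s * \<beta> * y = 0 \<or> - (\<alpha> * x + s * \<beta> * y) = 0"
          using r par k unfolding defs[symmetric]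
          by (cases "m \<le> c"; cases "m \<le> d") (auto simp: parity_idx_def eps_def defs(5) algebra_simps)
        then have "\<alpha> * x + s * \<beta> * y = 0" by (metis neg_equal_0_iff_equal)
        moreover have "\<beta> * x + s * \<alpha> * y = \<alpha> * \<alpha> * (\<beta> * x) + s * \<alpha> * (\<beta> * \<beta> * y)"
          by (simp add: defs)
        then have "\<beta> * x + s * \<alpha> * y = \<alpha> * \<beta> * (\<alpha> * x + s * \<beta> * y)"
          by (simp add: algebra_simps)
        ultimately show ?thesis unfolding defs[symmetric] by simp
      qed
    qed simp
  qed
  have par: "(if k = 0 then Xgen m a t else parity_inv (Xgen m a t)) = scale ((-1) ^ (k * parity_idx m a)) (Xgen m a t)" for a
    using k by (auto simp: parity_inv_Xgen)
  have "osp_act m n N Y (q_elem m n t s) = (\<Sum>a<?M. scale (kv m n a)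
      ((\<Sum>c<?M. scale (Y $$ (c, a)) (Xgen m c t)) * Xgen m (star m n a) s +
       scale ((-1) ^ (k * parity_idx m a)) (Xgen m a t) * (\<Sum>d<?M. scale (Y $$ (d, star m n a)) (Xgen m d s))))"
    unfolding q_elem_eq osp_act_sum osp_act_scale
    by (intro sum.cong refl) (simp add: osp_act_mult[OF gl] osp_act_Xgen star_less ts par)
  also have "\<dots> = (\<Sum>a<?M. \<Sum>c<?M. scale (kv m n a * Y $$ (c, a)) (Xgen m c t * Xgen m (star m n a) s)) +
      (\<Sum>a<?M. \<Sum>d<?M. scale ((-1) ^ (k * parity_idx m a) * kv m n a * Y $$ (d, star m n a)) (Xgen m a t * Xgen m d s))"
    by (simp add: superpoly.scale_right_distrib sum.distrib sum_distrib_left sum_distrib_right scale_mult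
        superpoly.scale_sum_right mult_ac)
  also have "(\<Sum>a<?M. \<Sum>c<?M. scale (kv m n a * Y $$ (c, a)) (Xgen m c t * Xgen m (star m n a) s)) =
      (\<Sum>a<?M. \<Sum>c<?M. scale (kv m n (star m n a) * Y $$ (c, star m n a)) (Xgen m c t * Xgen m a s))"
    by (subst sum_star[of _ m n, symmetric]) (simp add: star_star)
  also have "\<dots> = (\<Sum>c<?M. \<Sum>a<?M. scale (kv m n (star m n a) * Y $$ (c, star m n a)) (Xgen m c t * Xgen m a s))"
    by (rule sum.swap)
  finally have "osp_act m n N Y (q_elem m n t s) = (\<Sum>c<?M. \<Sum>d<?M.
      scale (kv m n (star m n d) * Y $$ (c, star m n d) + (-1) ^ (k * parity_idx m c) * kv m n c * Y $$ (d, star m n c))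
        (Xgen m c t * Xgen m d s))"
    by (simp add: superpoly.scale_left_distrib sum.distrib)
  also have "\<dots> = 0" by (intro sum.neutral ballI) (simp add: rel)
  finally show ?thesis .
qed

section \<open>The contravariant Hermitian form\<close>

text \<open>The squared Fock norm of a monomial. The factorials make multiplication by an even
  generator adjoint to differentiation; odd generators occur at most once and contribute 1.\<close>

definition mon_norm :: "'i smonom \<Rightarrow> real" where
  "mon_norm u = (\<Prod>i\<in>set_mset (fst u). fact (count (fst u) i))"

lemma mon_norm_pos: "mon_norm u > 0"
  by (auto simp: mon_norm_def intro!: prod_pos)

definition herm :: "'i superpoly \<Rightarrow> 'i superpoly \<Rightarrow> complex" where
  "herm p q = (\<Sum>u\<in>ssupport p. scoeff p u * cnj (scoeff q u) * of_real (mon_norm u))"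

lemma herm_superset: "finite S \<Longrightarrow> ssupport p \<subseteq> S \<Longrightarrow>
    herm p q = (\<Sum>u\<in>S. scoeff p u * cnj (scoeff q u) * of_real (mon_norm u))"
  unfolding herm_def by (rule sum.mono_neutral_left) (auto simp: in_support_iff)

lemma herm_add_left: "herm (p + q) r = herm p r + herm q r"
proof -
  let ?S = "ssupport p \<union> ssupport q"
  have "ssupport (p + q) \<subseteq> ?S" by (auto simp: in_support_iff)
  then show ?thesis
    by (simp add: herm_superset[of ?S] sum.distrib algebra_simps)
qed

lemma herm_scale_left: "herm (scale c p) r = c * herm p r"
proof -
  have "ssupport (scale c p) \<subseteq> ssupport p" by (auto simp: in_support_iff)
  then show ?thesis
    by (simp add: herm_superset[of "ssupport p"] sum_distrib_left mult.assoc)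
qed

lemma herm_zero_left [simp]: "herm 0 r = 0"
  by (simp add: herm_def in_support_iff)

lemma herm_cnj: "herm q p = cnj (herm p q)"
proof -
  let ?S = "ssupport p \<union> ssupport q"
  have "herm q p = (\<Sum>u\<in>?S. scoeff q u * cnj (scoeff p u) * of_real (mon_norm u))"
    "herm p q = (\<Sum>u\<in>?S. scoeff p u * cnj (scoeff q u) * of_real (mon_norm u))"
    by (rule herm_superset; auto)+
  then show ?thesis by (simp add: mult_ac)
qed

lemma herm_add_right: "herm r (p + q) = herm r p + herm r q"
  and herm_scale_right: "herm r (scale c p) = cnj c * herm r p"
  and herm_zero_right [simp]: "herm r 0 = 0"
  using herm_add_left[of p q r] herm_scale_left[of c p r]
  by (simp_all add: herm_cnj[of r "p + q"] herm_cnj[of r "scale c p"] herm_cnj[of r 0] herm_cnj[of r p] herm_cnj[of r q])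

lemma herm_diff_left: "herm (p - q) r = herm p r - herm q r"
  using herm_add_left[of "p - q" q r] by simp

lemma herm_sum_left: "herm (sum f S) r = (\<Sum>x\<in>S. herm (f x) r)"
  by (induction S rule: infinite_finite_induct) (simp_all add: herm_add_left)

lemma herm_sum_right: "herm r (sum f S) = (\<Sum>x\<in>S. herm r (f x))"
  by (induction S rule: infinite_finite_induct) (simp_all add: herm_add_right)

lemma herm_self: "herm p p = of_real (\<Sum>u\<in>ssupport p. (cmod (scoeff p u))\<^sup>2 * mon_norm u)"
  by (simp add: herm_def complex_norm_square[symmetric])

lemma herm_self_real: "herm p p = of_real (Re (herm p p))" and herm_self_nonneg: "Re (herm p p) \<ge> 0"
  by (auto simp: herm_self intro!: sum_nonneg mult_nonneg_nonneg less_imp_le[OF mon_norm_pos])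

lemma herm_self_eq_0 [simp]: "herm p p = 0 \<longleftrightarrow> p = 0"
proof
  assume "herm p p = 0"
  then have "(\<Sum>u\<in>ssupport p. (cmod (scoeff p u))\<^sup>2 * mon_norm u) = 0"
    unfolding herm_self by (simp only: of_real_eq_0_iff)
  then have "\<forall>u\<in>ssupport p. (cmod (scoeff p u))\<^sup>2 * mon_norm u = 0"
    by (subst (asm) sum_nonneg_eq_0_iff) (auto intro!: mult_nonneg_nonneg less_imp_le[OF mon_norm_pos])
  then have "scoeff p u = 0" for u
    using mon_norm_pos[of u] by (cases "u \<in> ssupport p") (auto simp: in_support_iff)
  then show "p = 0" by (intro superpoly_eqI) simp
qed simp

lemma herm_smon: "herm (smon u) (smon v) = (if u = v then of_real (mon_norm u) else 0)"
proof -
  have "ssupport (smon u) \<subseteq> {u}" by (auto simp: in_support_iff split: if_splits)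
  then show ?thesis by (simp add: herm_superset[of "{u}"])
qed

lemma mon_norm_add_mset: "mon_norm (add_mset i \<mu>, A) = of_nat (Suc (count \<mu> i)) * mon_norm (\<mu>, A')"
proof -
  have ext: "mon_norm (\<nu>, B) = (\<Prod>j\<in>S. fact (count \<nu> j))" if "finite S" "set_mset \<nu> \<subseteq> S" for \<nu> S and B :: "'a fset"
    unfolding mon_norm_def fst_conv using that by (intro prod.mono_neutral_left) (auto simp: not_in_iff)
  let ?S = "insert i (set_mset \<mu>)"
  have "mon_norm (add_mset i \<mu>, A) = (\<Prod>j\<in>?S. fact (count (add_mset i \<mu>) j))"
    by (rule ext) auto
  also have "\<dots> = fact (Suc (count \<mu> i)) * (\<Prod>j\<in>?S - {i}. fact (count \<mu> j))"
    by (subst prod.remove[of _ i], simp, simp, rule arg_cong2[where f = "(*)"], simp, rule prod.cong) auto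
  also have "\<dots> = of_nat (Suc (count \<mu> i)) * (fact (count \<mu> i) * (\<Prod>j\<in>?S - {i}. fact (count \<mu> j)))"
    by simp
  also have "fact (count \<mu> i) * (\<Prod>j\<in>?S - {i}. fact (count \<mu> j)) = (\<Prod>j\<in>?S. fact (count \<mu> j) :: real)"
    by (subst prod.remove[of ?S i]) auto
  also have "\<dots> = mon_norm (\<mu>, A')" by (rule ext[symmetric]) auto
  finally show ?thesis .
qed

lemma herm_bilinear_induct:
  assumes "\<And>u v. herm (f (smon u)) (smon v) = herm (smon u) (g (smon v))"
    and f: "\<And>p q. f (p + q) = f p + f q" "\<And>c p. f (scale c p) = scale c (f p)"
    and g: "\<And>p q. g (p + q) = g p + g q" "\<And>c p. g (scale c p) = scale c (g p)"
  shows "herm (f p) q = herm p (g q)"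
proof -
  have f0: "f 0 = 0" and g0: "g 0 = 0" using f(2)[of 0 0] g(2)[of 0 0] by simp_all
  have "herm (f (smon u)) q = herm (smon u) (g q)" for u
    by (induction q rule: superpoly_induct) (simp_all add: assms(1) g g0 herm_add_right herm_scale_right)
  then show ?thesis
    by (induction p rule: superpoly_induct) (simp_all add: f f0 herm_add_left herm_scale_left)
qed

lemma herm_even: "herm (even_gen i * p) q = herm p (deriv_even i q)"
proof (rule herm_bilinear_induct)
  fix u v :: "'a smonom"
  have m: "even_gen i * smon u = smon (add_mset i (fst u), snd u)"
    by (simp add: even_gen_def mon_mult_mon mon_mult_def)
  show "herm (even_gen i * smon u) (smon v) = herm (smon u) (deriv_even i (smon v))"
  proof (cases "v = (add_mset i (fst u), snd u)")
    case True
    then show ?thesis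
      using mon_norm_add_mset[of i "fst u" "snd u" "snd u"]
      by (simp add: m herm_smon deriv_smon herm_scale_right)
  next
    case False
    then have "i \<in># fst v \<Longrightarrow> u \<noteq> (fst v - {#i#}, snd v)"
      by (metis insert_DiffM prod.collapse fst_conv snd_conv)
    then have "count (fst v) i = 0 \<or> u \<noteq> (fst v - {#i#}, snd v)"
      by (metis not_in_iff)
    then show ?thesis using False
      by (auto simp: m herm_smon deriv_smon herm_scale_right)
  qed
qed (simp_all add: deriv_add deriv_scale algebra_simps scale_mult)

lemma herm_odd: "herm (odd_gen i * p) q = herm p (deriv_odd i q)"
proof (rule herm_bilinear_induct)
  fix u v :: "'a smonom"
  show "herm (odd_gen i * smon u) (smon v) = herm (smon u) (deriv_odd i (smon v))"
  proof (cases "i |\<notin>| snd u \<and> v = (fst u, finsert i (snd u))")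
    case True
    have "inversions {|i|} ({|i|} |\<union>| snd u) = inversions {|i|} {|i|} + inversions {|i|} (snd u)"
      using True by (intro inversions_union_right) auto
    then have inv: "inversions {|i|} (finsert i (snd u)) = inversions {|i|} (snd u)" by simp
    have "snd v |-| {|i|} = snd u" "fst v = fst u" using True by auto
    moreover have "mon_norm v = mon_norm u" using True by (simp add: mon_norm_def)
    ultimately show ?thesis using True inv
      by (simp add: odd_gen_def mon_mult_mon mon_mult_def herm_scale_left herm_scale_right herm_smon deriv_smon)
  next
    case False
    then have "i |\<in>| snd v \<Longrightarrow> u \<noteq> (fst v, snd v |-| {|i|})"
      by (metis finsert_fminus fminus_finsert_absorb fst_conv snd_conv prod.collapse finsertI1 fminusE)
    then show ?thesis using False
      by (auto simp: odd_gen_def mon_mult_mon mon_mult_def herm_scale_left herm_scale_right herm_smon deriv_smon)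
  qed
qed (simp_all add: deriv_add deriv_scale algebra_simps scale_mult)

lemma herm_Xgen: "herm (Xgen m a t * p) q = herm p (dXgen m a t q)"
  by (simp add: Xgen_def dXgen_def herm_even herm_odd)

lemma herm_dXgen: "herm (dXgen m a t p) q = herm p (Xgen m a t * q)"
  by (metis herm_Xgen herm_cnj)

lemma herm_E_gl: "herm (E_gl m n s t p) q = herm p (E_gl m n t s q)"
  by (simp add: E_gl_def herm_sum_left herm_sum_right herm_Xgen herm_dXgen)

text \<open>One step of Gram-Schmidt per generator: the new generator is first made orthogonal to
  the old span. If it already lies there, the remainder \<open>c'\<close> is 0 and the coefficient
  \<open>k\<close> is set to 0.\<close>

lemma exists_orthogonal_projection:
  assumes "finite B"
  shows "\<exists>b\<in>superpoly.span B. \<forall>x\<in>superpoly.span B. herm (p - b) x = 0"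
  using assms
proof (induction B arbitrary: p)
  case empty
  then show ?case by (auto simp: superpoly.span_empty)
next
  case (insert c B)
  obtain d where d: "d \<in> superpoly.span B" "\<forall>x\<in>superpoly.span B. herm (c - d) x = 0"
    using insert.IH by blast
  obtain e where e: "e \<in> superpoly.span B" "\<forall>x\<in>superpoly.span B. herm (p - e) x = 0"
    using insert.IH by blast
  define c' where "c' = c - d"
  define k where "k = (if c' = 0 then 0 else herm (p - e) c' / herm c' c')"
  define b where "b = e + scale k c'"
  have sub: "superpoly.span B \<subseteq> superpoly.span (insert c B)" by (rule superpoly.span_mono) auto
  have "c' \<in> superpoly.span (insert c B)"
    unfolding c'_def using sub d(1) by (intro superpoly.span_diff) (auto intro: superpoly.span_base)
  then have "b \<in> superpoly.span (insert c B)"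
    unfolding b_def using sub e(1) by (intro superpoly.span_add superpoly.span_scale) auto
  moreover have "herm (p - b) x = 0" if "x \<in> superpoly.span (insert c B)" for x
  proof -
    obtain a where a: "x - scale a c \<in> superpoly.span B"
      using \<open>x \<in> _\<close> unfolding superpoly.span_breakdown_eq by blast
    define y where "y = x - scale a c + scale a d"
    have y: "y \<in> superpoly.span B"
      unfolding y_def using a d(1) by (intro superpoly.span_add superpoly.span_scale)
    have x: "x = y + scale a c'"
      by (simp add: y_def c'_def superpoly.scale_right_diff_distrib)
    have 1: "herm (p - b) z = 0" if "z \<in> superpoly.span B" for z
      using d(2) e(2) that
      by (simp add: b_def diff_diff_add[symmetric] herm_diff_left[of "p - e"] herm_scale_left c'_def)
    have 2: "herm (p - b) c' = 0"
      by (simp add: b_def diff_diff_add[symmetric] herm_diff_left[of "p - e"] herm_scale_left k_def)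
    show ?thesis using 1[OF y] 2 by (simp add: x herm_add_right herm_scale_right)
  qed
  ultimately show ?case by blast
qed

section \<open>Highest weight vectors\<close>

lemma superpoly_nonzero_coeff: "p \<noteq> 0 \<Longrightarrow> \<exists>u. scoeff p u \<noteq> 0"
  by (metis scoeff_simps(1) superpoly_eqI)

lemma E_gl_diag_eigen:
  assumes "E_gl m n t t p = scale c p" "scoeff p u \<noteq> 0"
  shows "c = of_nat (wt m n t u)"
  using assms scoeff_E_gl_diag[of m n t p u] by simp

text \<open>A nonzero element of minimal support is a weight vector, since \<open>E_gl m n i i - c\<close> removes monomials.\<close>

lemma exists_weight_vector:
  assumes U: "superpoly.subspace U" and cl: "\<And>i p. i \<in> T \<Longrightarrow> p \<in> U \<Longrightarrow> E_gl m n i i p \<in> U"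
    and ne: "\<exists>p\<in>U. p \<noteq> 0"
  shows "\<exists>p\<in>U. p \<noteq> 0 \<and> (\<exists>lam. \<forall>i\<in>T. E_gl m n i i p = scale (of_nat (lam i)) p)"
proof -
  have "\<exists>p. (p \<in> U \<and> p \<noteq> 0) \<and> (\<forall>q. q \<in> U \<and> q \<noteq> 0 \<longrightarrow> card (ssupport p) \<le> card (ssupport q))"
    using ne ex_has_least_nat[of "\<lambda>p. p \<in> U \<and> p \<noteq> 0" _ "\<lambda>p. card (ssupport p)"] by blast
  then obtain p where p: "p \<in> U" "p \<noteq> 0"
    and min: "\<And>q. q \<in> U \<Longrightarrow> q \<noteq> 0 \<Longrightarrow> card (ssupport p) \<le> card (ssupport q)"
    by blast
  obtain u where u: "scoeff p u \<noteq> 0" using superpoly_nonzero_coeff[OF p(2)] by blast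
  have "E_gl m n i i p = scale (of_nat (wt m n i u)) p" if i: "i \<in> T" for i
  proof (rule ccontr)
    define q where "q = E_gl m n i i p - scale (of_nat (wt m n i u)) p"
    assume "E_gl m n i i p \<noteq> scale (of_nat (wt m n i u)) p"
    then have "q \<noteq> 0" by (simp add: q_def)
    moreover have "q \<in> U"
      unfolding q_def by (intro superpoly.subspace_diff[OF U] superpoly.subspace_scale[OF U] cl i p)
    moreover have q: "scoeff q v = (of_nat (wt m n i v) - of_nat (wt m n i u)) * scoeff p v" for v
      by (simp add: q_def scoeff_E_gl_diag algebra_simps)
    have "ssupport q \<subset> ssupport p"
    proof
      show "ssupport q \<subseteq> ssupport p" by (auto simp: in_support_iff q)
      have "u \<notin> ssupport q" "u \<in> ssupport p" using u by (auto simp: in_support_iff q)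
      then show "ssupport q \<noteq> ssupport p" by blast
    qed
    then have "card (ssupport q) < card (ssupport p)" by (rule psubset_card_mono[OF finite_support])
    ultimately show False using min[of q] by simp
  qed
  then show ?thesis using p by (intro bexI[of _ p]) auto
qed

text \<open>Among weight vectors in \<open>U\<close> take one minimising the sum of
  \<open>i * lam i\<close>. A raising operator moves one unit of weight from \<open>j\<close> to a
  smaller \<open>i\<close>, which lowers this number, so it must annihilate the chosen vector.
  Columns below \<open>k\<close> are left out so that the lemma also serves the exterior algebra on
  the last columns.\<close>

lemma exists_highest_weight_vector:
  assumes U: "superpoly.subspace U"
    and cl: "\<And>i j p. k \<le> i \<Longrightarrow> i \<le> j \<Longrightarrow> j < N \<Longrightarrow> p \<in> U \<Longrightarrow> E_gl m n i j p \<in> U"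
    and ne: "\<exists>p\<in>U. p \<noteq> 0"
  shows "\<exists>p\<in>U. \<exists>lam. p \<noteq> 0 \<and> (\<forall>i\<in>{k..<N}. E_gl m n i i p = scale (of_nat (lam i)) p) \<and>
    (\<forall>j\<in>{k..<N}. \<forall>i\<in>{k..<j}. E_gl m n i j p = 0)"
proof -
  define P where "P x \<longleftrightarrow> fst x \<in> U \<and> fst x \<noteq> 0 \<and> (\<forall>i\<in>{k..<N}. E_gl m n i i (fst x) = scale (of_nat (snd x i)) (fst x))"
    for x :: "index superpoly \<times> (nat \<Rightarrow> nat)"
  define f where "f x = (\<Sum>i\<in>{k..<N}. i * snd x i)" for x :: "index superpoly \<times> (nat \<Rightarrow> nat)"
  have "\<exists>x. P x"
    using exists_weight_vector[OF U _ ne, of "{k..<N}" m n] cl by (fastforce simp: P_def)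
  then obtain x where x: "P x" "\<And>y. P y \<Longrightarrow> f x \<le> f y"
    using ex_has_least_nat[of P _ f] by blast
  obtain p lam where [simp]: "x = (p, lam)" by (cases x)
  have "E_gl m n i j p = 0" if j: "j \<in> {k..<N}" and i: "i \<in> {k..<j}" for i j
  proof (rule ccontr)
    let ?q = "E_gl m n i j p"
    assume q: "?q \<noteq> 0"
    have diag: "E_gl m n l l ?q = scale (of_nat (lam l) + (if l = i then 1 else 0) - (if l = j then 1 else 0)) ?q"
      if "l \<in> {k..<N}" for l
      using x(1) that i j unfolding E_gl_bracket[of m n l l i j p]
      by (auto simp: P_def E_gl_scale superpoly.scale_left_distrib superpoly.scale_left_diff_distrib)
    obtain u where u: "scoeff ?q u \<noteq> 0" using superpoly_nonzero_coeff[OF q] by blast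
    \<comment> \<open>The weight of the nonzero \<open>?q\<close> at \<open>j\<close> is a natural
      number, whence \<open>lam j\<close> is at least 1 and the shifted weight is natural
      again.\<close>
    have "of_nat (lam j) + (if j = i then 1 else 0) - (if j = j then 1 else 0) = (of_nat (wt m n j u) :: complex)"
      using E_gl_diag_eigen[OF diag[OF j] u] .
    then have "of_nat (lam j) = (of_nat (wt m n j u + 1) :: complex)" using i by (simp add: algebra_simps)
    then have lj: "lam j \<ge> 1" by (simp only: of_nat_eq_iff)
    define lam' where "lam' = lam(i := lam i + 1, j := lam j - 1)"
    have "P (?q, lam')"
      using x(1) q i j lj diag by (auto simp: P_def lam'_def cl of_nat_diff add.commute)
    then have "f (p, lam) \<le> f (?q, lam')" using x(2) by simp
    moreover have "f (?q, lam') + j = f (p, lam) + i"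
    proof -
      have s: "(\<Sum>l\<in>{k..<N}. l * g l) = (\<Sum>l\<in>{k..<N} - {i, j}. l * g l) + i * g i + j * g j" for g :: "nat \<Rightarrow> nat"
        using i j by (simp add: sum.remove[of "{k..<N}" j] sum.remove[of "{k..<N} - {j}" i] insert_commute Diff_insert2[symmetric])
      have "(\<Sum>l\<in>{k..<N} - {i, j}. l * lam' l) = (\<Sum>l\<in>{k..<N} - {i, j}. l * lam l)"
        by (intro sum.cong) (auto simp: lam'_def)
      moreover have "j * lam j = j * (lam j - 1) + j" using lj by (cases "lam j") auto
      moreover have "i * lam' i = i * lam i + i" "j * lam' j = j * (lam j - 1)"
        using i by (auto simp: lam'_def)
      ultimately show ?thesis unfolding f_def snd_conv s[of lam] s[of lam'] by linarith
    qed
    ultimately show False using i by simp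
  qed
  then show ?thesis using x(1) by (intro bexI[of _ p] exI[of _ lam]) (auto simp: P_def)
qed

text \<open>By adjointness the squared norm of \<open>E_gl m n j i v\<close> is
  \<open>lam i - lam j\<close> times that of \<open>v\<close>, so positivity of the form yields
  dominance.\<close>

lemma highest_weight_decreasing:
  assumes "highest_weight_vector m n N lam v" "i \<le> j" "j < N"
  shows "lam j \<le> lam i"
proof (cases "i = j")
  case False
  then have ij: "i < j" using assms by simp
  have v: "v \<noteq> 0" "E_gl m n i j v = 0" "E_gl m n i i v = scale (of_nat (lam i)) v" "E_gl m n j j v = scale (of_nat (lam j)) v"
    using assms ij by (auto simp: highest_weight_vector_def)
  have "herm (E_gl m n j i v) (E_gl m n j i v) = herm (E_gl m n i j (E_gl m n j i v)) v"
    by (simp add: herm_E_gl)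
  also have "E_gl m n i j (E_gl m n j i v) = scale (of_nat (lam i) - of_nat (lam j)) v"
    using ij v by (simp add: E_gl_bracket[of m n i j j i] superpoly.scale_left_diff_distrib)
  finally have "Re (herm (E_gl m n j i v) (E_gl m n j i v)) = (of_nat (lam i) - of_nat (lam j)) * Re (herm v v)"
    by (subst (asm) herm_scale_left, subst (asm) herm_self_real) simp
  then have "(of_nat (lam i) - of_nat (lam j)) * Re (herm v v) \<ge> 0"
    using herm_self_nonneg by metis
  moreover have "Re (herm v v) > 0"
    using herm_self_nonneg[of v] herm_self_real[of v] herm_self_eq_0[of v] v(1) by (metis of_real_0 order_le_less)
  ultimately show ?thesis by (simp add: zero_le_mult_iff)
qed simp

section \<open>Laplacians\<close>

text \<open>The element \<open>q_elem m n t s\<close> with generators replaced by derivatives.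
  Taking \<open>m = 0\<close> gives the Laplacians in the odd generators alone.\<close>

definition Lap :: "nat \<Rightarrow> nat \<Rightarrow> nat \<Rightarrow> nat \<Rightarrow> index superpoly \<Rightarrow> index superpoly" where
  "Lap m n t s p = (\<Sum>a<m + 2 * n. scale (kv m n a) (dXgen m a t (dXgen m (star m n a) s p)))"

lemma Lap_add: "Lap m n t s (p + q) = Lap m n t s p + Lap m n t s q"
  and Lap_scale: "Lap m n t s (scale c p) = scale c (Lap m n t s p)"
  and Lap_zero [simp]: "Lap m n t s 0 = 0"
  by (simp_all add: Lap_def dXgen_add dXgen_scale superpoly.scale_right_distrib sum.distrib
      superpoly.scale_sum_right mult.commute)

lemma Lap_sum: "Lap m n t s (sum f S) = (\<Sum>x\<in>S. Lap m n t s (f x))"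
  by (induction S rule: infinite_finite_induct) (simp_all add: Lap_add)

lemma Lap_minus: "Lap m n t s (p - q) = Lap m n t s p - Lap m n t s q"
  by (metis add_diff_cancel diff_add_cancel Lap_add)

lemma Lap_sym: "Lap m n t s p = Lap m n s t p"
proof -
  have "Lap m n t s p = (\<Sum>a<m + 2 * n. scale (kv m n a * eps m a a) (dXgen m (star m n a) s (dXgen m a t p)))"
    unfolding Lap_def by (intro sum.cong refl, subst dXgen_swap) (simp add: eps_star)
  also have "\<dots> = Lap m n s t p"
    unfolding Lap_def
    by (subst sum_star[of _ m n, symmetric]) (simp add: star_star kv_star eps_star mult_ac)
  finally show ?thesis .
qed

lemma dXgen_Lap: "dXgen m b u (Lap m n t s p) = Lap m n t s (dXgen m b u p)"
proof -
  have "dXgen m b u (dXgen m a t (dXgen m (star m n a) s p)) = dXgen m a t (dXgen m (star m n a) s (dXgen m b u p))" for a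
    by (subst dXgen_swap, subst (2) dXgen_swap) (simp add: dXgen_scale eps_star)
  then show ?thesis by (simp add: Lap_def dXgen_sum dXgen_scale)
qed

lemma Lap_commute: "Lap m n t s (Lap m n u v p) = Lap m n u v (Lap m n t s p)"
  by (simp add: Lap_def[of m n u v] Lap_sum Lap_scale dXgen_Lap)

lemma E_gl_Lap: "E_gl m n i j (Lap m n t s p) = Lap m n t s (E_gl m n i j p) -
    (if i = t then Lap m n j s p else 0) - (if i = s then Lap m n t j p else 0)"
proof -
  have "E_gl m n i j (Lap m n t s p) = (\<Sum>a<m + 2 * n. scale (kv m n a) (dXgen m a t (dXgen m (star m n a) s (E_gl m n i j p))
      - (if i = s then dXgen m a t (dXgen m (star m n a) j p) else 0)
      - (if i = t then dXgen m a j (dXgen m (star m n a) s p) else 0)))"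
    unfolding Lap_def E_gl_sum E_gl_scale
    by (intro sum.cong refl) (auto simp: E_gl_dXgen star_less dXgen_minus)
  then show ?thesis
    by (auto simp: Lap_def superpoly.scale_right_diff_distrib sum_subtractf)
qed

lemma E_gl_diag_Lap:
  assumes "E_gl m n i i p = scale c p"
  shows "E_gl m n i i (Lap m n t s p) = scale (c - (if i = t then 1 else 0) - (if i = s then 1 else 0)) (Lap m n t s p)"
  using assms by (auto simp: E_gl_Lap Lap_scale superpoly.scale_left_diff_distrib)

lemma sum_const_scale: "(\<Sum>x\<in>A. p) = scale (of_nat (card A)) p" for p :: "'i superpoly"
  by (induction A rule: infinite_finite_induct) (simp_all add: superpoly.scale_left_distrib)

section \<open>The symplectic group acting on odd variables\<close>

text \<open>
  For \<open>m = 0\<close> the operators only see the odd generators: the even ones are constants.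
  \<open>odd_sp n N p\<close> says that \<open>p\<close> is annihilated by \<open>sp(2n)\<close>.
\<close>

definition odd_span :: "nat \<Rightarrow> nat \<Rightarrow> nat \<Rightarrow> index superpoly set" where
  "odd_span n k N = mono_span UNIV {Index b t | b t. b < 2 * n \<and> k \<le> t \<and> t < N}"

definition odd_sp :: "nat \<Rightarrow> nat \<Rightarrow> index superpoly \<Rightarrow> bool" where
  "odd_sp n N p \<longleftrightarrow> (\<forall>a<2 * n. \<forall>b<2 * n. unit_act 0 N a b p =
     scale (kv 0 n a * kv 0 n b) (unit_act 0 N (star 0 n b) (star 0 n a) p))"

lemma eps_0 [simp]: "eps 0 a b = - 1"
  by (simp add: eps_def)

lemma odd_span_dXgen: "p \<in> odd_span n k N \<Longrightarrow> dXgen 0 b t p \<in> odd_span n k N"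
  by (auto simp: odd_span_def dXgen_def intro: mono_span_deriv)

lemma odd_span_Lap: "p \<in> odd_span n k N \<Longrightarrow> Lap 0 n t s p \<in> odd_span n k N"
  unfolding Lap_def odd_span_def
  by (intro mono_span_sum mono_span_simps(2)) (metis odd_span_def odd_span_dXgen)

lemma odd_span_E_gl: "p \<in> odd_span n k N \<Longrightarrow> k \<le> i \<Longrightarrow> i < N \<Longrightarrow> E_gl 0 n i j p \<in> odd_span n k N"
  unfolding E_gl_def odd_span_def
  by (intro mono_span_sum mono_span_mult) (auto simp: Xgen_def intro!: mono_span_gen odd_span_dXgen[unfolded odd_span_def])

lemma scoeff_deriv_odd: "scoeff (deriv_odd i p) u =
    (if i |\<in>| snd u then 0 else (-1) ^ inversions {|i|} (snd u) * scoeff p (fst u, finsert i (snd u)))"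
proof (induction p rule: superpoly_induct)
  case (smon v)
  have inv: "inversions {|i|} (finsert i A) = inversions {|i|} A" if "i |\<notin>| A" for A
    using inversions_union_right[of "{|i|}" A "{|i|}"] that by simp
  show ?case
  proof (cases "i |\<in>| snd v")
    case True
    show ?thesis
    proof (cases "i |\<in>| snd u")
      case True
      then have "(fst v, snd v |-| {|i|}) \<noteq> u" by (metis fminusE finsertI1 snd_conv)
      then show ?thesis using True \<open>i |\<in>| snd v\<close> by (simp add: deriv_smon)
    next
      case False
      then have "(fst v, snd v |-| {|i|}) = u \<longleftrightarrow> v = (fst u, finsert i (snd u))"
        using True by (cases u; cases v) auto
      then show ?thesis using True False inv[of "snd u"] by (auto simp: deriv_smon)
    qed
  next
    case False
    then have "v \<noteq> (fst u, finsert i (snd u))" by auto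
    then show ?thesis using False by (auto simp: deriv_smon)
  qed
qed (auto simp: deriv_add deriv_scale algebra_simps)

lemma scoeff_deriv_even: "scoeff (deriv_even i p) u = of_nat (Suc (count (fst u) i)) * scoeff p (add_mset i (fst u), snd u)"
proof (induction p rule: superpoly_induct)
  case (smon v)
  show ?case
  proof (cases "i \<in># fst v")
    case True
    then have "(fst v - {#i#}, snd v) = u \<longleftrightarrow> v = (add_mset i (fst u), snd u)"
      by (cases u; cases v) auto
    then show ?thesis using True by (auto simp: deriv_smon)
  next
    case False
    then have "v \<noteq> (add_mset i (fst u), snd u)" by auto
    then show ?thesis using False by (simp add: deriv_smon not_in_iff)
  qed
qed (simp_all add: deriv_add deriv_scale algebra_simps)

lemma odd_span_dXgen_0:
  assumes "p \<in> odd_span n k N" "t < k \<or> N \<le> t"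
  shows "dXgen 0 b t p = 0"
proof (rule superpoly_eqI)
  fix u
  have "scoeff p (fst u, finsert (Index b t) (snd u)) = 0"
    using assms mono_spanD[of p UNIV _ "(fst u, finsert (Index b t) (snd u))"] by (fastforce simp: odd_span_def)
  then show "scoeff (dXgen 0 b t p) u = scoeff 0 u"
    by (simp add: dXgen_def scoeff_deriv_odd)
qed

lemma odd_span_Lap_0:
  assumes "p \<in> odd_span n k N" "t < k \<or> s < k"
  shows "Lap 0 n t s p = 0"
  using assms unfolding Lap_def
  by (intro sum.neutral ballI) (auto simp: odd_span_dXgen_0[OF assms(1)] odd_span_dXgen_0[OF odd_span_dXgen[OF assms(1)]])

lemma unit_act_dXgen: "unit_act 0 N a b (dXgen 0 c s p) = dXgen 0 c s (unit_act 0 N a b p) -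
    (if a = c \<and> s < N then dXgen 0 b s p else 0)"
proof -
  have "dXgen 0 c s (unit_act 0 N a b p) = (\<Sum>t<N. (if t = s then (if a = c then dXgen 0 b s p else 0) else 0)
      + Xgen 0 a t * dXgen 0 b t (dXgen 0 c s p))"
    unfolding unit_act_def dXgen_sum
    by (intro sum.cong refl, subst dXgen_swap[of 0 b]) (auto simp: dXgen_Xgen_mult)
  then show ?thesis by (simp add: sum.distrib unit_act_def)
qed

lemma unit_act_Lap:
  assumes "a < 2 * n" "t < N" "s < N"
  shows "unit_act 0 N a b (Lap 0 n t s p) = Lap 0 n t s (unit_act 0 N a b p) +
    scale (kv 0 n a) (dXgen 0 (star 0 n a) t (dXgen 0 b s p) - dXgen 0 b t (dXgen 0 (star 0 n a) s p))"
proof -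
  have sum_act: "unit_act 0 N a b (sum f S) = (\<Sum>x\<in>S. unit_act 0 N a b (f x))" for f :: "nat \<Rightarrow> index superpoly" and S
    by (induction S rule: infinite_finite_induct) (simp_all add: unit_act_add)
  have eq: "a = star 0 n c \<longleftrightarrow> c = star 0 n a" if "c < 2 * n" for c
    using star_star[of c 0 n] star_star[of a 0 n] assms(1) that by auto
  have "unit_act 0 N a b (Lap 0 n t s p) = (\<Sum>c<2 * n. scale (kv 0 n c) (dXgen 0 c t (dXgen 0 (star 0 n c) s (unit_act 0 N a b p)))
      - (if c = star 0 n a then scale (kv 0 n c) (dXgen 0 c t (dXgen 0 b s p)) else 0)
      - (if c = a then scale (kv 0 n c) (dXgen 0 b t (dXgen 0 (star 0 n c) s p)) else 0))"
    unfolding Lap_def sum_act unit_act_scale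
  proof (intro sum.cong)
    fix c assume c: "c \<in> {..<2 * n}"
    have "unit_act 0 N a b (dXgen 0 c t (dXgen 0 (star 0 n c) s p)) = dXgen 0 c t (dXgen 0 (star 0 n c) s (unit_act 0 N a b p))
        - (if c = star 0 n a then dXgen 0 c t (dXgen 0 b s p) else 0) - (if c = a then dXgen 0 b t (dXgen 0 (star 0 n c) s p) else 0)"
      using eq[of c] c assms by (cases "c = star 0 n a"; cases "c = a") (simp_all add: unit_act_dXgen dXgen_minus)
    then show "scale (kv 0 n c) (unit_act 0 N a b (dXgen 0 c t (dXgen 0 (star 0 n c) s p))) =
        scale (kv 0 n c) (dXgen 0 c t (dXgen 0 (star 0 n c) s (unit_act 0 N a b p)))
        - (if c = star 0 n a then scale (kv 0 n c) (dXgen 0 c t (dXgen 0 b s p)) else 0)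
        - (if c = a then scale (kv 0 n c) (dXgen 0 b t (dXgen 0 (star 0 n c) s p)) else 0)"
      by (simp add: superpoly.scale_right_diff_distrib)
  qed simp
  also have "\<dots> = Lap 0 n t s (unit_act 0 N a b p)
      - scale (kv 0 n (star 0 n a)) (dXgen 0 (star 0 n a) t (dXgen 0 b s p))
      - scale (kv 0 n a) (dXgen 0 b t (dXgen 0 (star 0 n a) s p))"
    using assms star_less[of a 0 n] by (simp add: sum_subtractf Lap_def)
  finally show ?thesis using assms kv_star[of a 0 n]
    by (simp add: superpoly.scale_right_diff_distrib superpoly.scale_minus_left)
qed

text \<open>A single matrix unit does not commute with a Laplacian, but the correction
  \<open>D\<close> is the same for the pair \<open>a\<close>, \<open>b\<close> and for its
  reflection \<open>star 0 n b\<close>, \<open>star 0 n a\<close>. It therefore cancels in the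
  relation defining \<open>sp(2n)\<close>-invariance.\<close>

lemma odd_sp_Lap:
  assumes p: "odd_sp n N p" and ts: "t < N" "s < N"
  shows "odd_sp n N (Lap 0 n t s p)"
  unfolding odd_sp_def
proof (intro allI impI)
  fix a b assume ab: "a < 2 * n" "b < 2 * n"
  define D where "D = dXgen 0 (star 0 n a) t (dXgen 0 b s p) - dXgen 0 b t (dXgen 0 (star 0 n a) s p)"
  have sb: "star 0 n b < 2 * n" "kv 0 n (star 0 n b) = - kv 0 n b" "star 0 n (star 0 n b) = b"
    using star_less[of b 0 n] kv_star[of b 0 n] star_star[of b 0 n] ab by simp_all
  have 1: "unit_act 0 N a b (Lap 0 n t s p) = Lap 0 n t s (unit_act 0 N a b p) + scale (kv 0 n a) D"
    using ab ts by (simp add: unit_act_Lap D_def)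
  have 2: "unit_act 0 N (star 0 n b) (star 0 n a) (Lap 0 n t s p) =
      Lap 0 n t s (unit_act 0 N (star 0 n b) (star 0 n a) p) + scale (kv 0 n b) D"
    using sb ts by (simp add: unit_act_Lap D_def superpoly.scale_right_diff_distrib superpoly.scale_minus_left)
  have "unit_act 0 N a b p = scale (kv 0 n a * kv 0 n b) (unit_act 0 N (star 0 n b) (star 0 n a) p)"
    using p ab unfolding odd_sp_def by blast
  moreover have "kv 0 n a * kv 0 n b * kv 0 n b = kv 0 n a" by (simp add: mult.assoc)
  ultimately show "unit_act 0 N a b (Lap 0 n t s p) =
      scale (kv 0 n a * kv 0 n b) (unit_act 0 N (star 0 n b) (star 0 n a) (Lap 0 n t s p))"
    unfolding 1 2 by (simp add: Lap_scale superpoly.scale_right_distrib)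
qed

lemma odd_sp_E_gl:
  assumes "odd_sp n N p" "i < N" "j < N"
  shows "odd_sp n N (E_gl 0 n i j p)"
  unfolding odd_sp_def
proof (intro allI impI)
  fix a b assume ab: "a < 2 * n" "b < 2 * n"
  then have "star 0 n a < 2 * n" "star 0 n b < 2 * n" using star_less[of _ 0 n] by auto
  moreover have "unit_act 0 N a b p = scale (kv 0 n a * kv 0 n b) (unit_act 0 N (star 0 n b) (star 0 n a) p)"
    using assms(1) ab unfolding odd_sp_def by blast
  ultimately show "unit_act 0 N a b (E_gl 0 n i j p) =
      scale (kv 0 n a * kv 0 n b) (unit_act 0 N (star 0 n b) (star 0 n a) (E_gl 0 n i j p))"
    using ab assms(2,3) by (simp add: unit_act_E_gl[where m = 0 and n = n] E_gl_scale)
qed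

lemma odd_sp_linear: "odd_sp n N 0" "odd_sp n N p \<Longrightarrow> odd_sp n N q \<Longrightarrow> odd_sp n N (p + q)"
  "odd_sp n N p \<Longrightarrow> odd_sp n N (scale c p)"
  by (auto simp: odd_sp_def unit_act_add unit_act_scale superpoly.scale_right_distrib mult.commute)

text \<open>
  The Casimir operators of \<open>gl(2n)\<close> and \<open>gl(N)\<close> agree up to lower order terms; on harmonic
  \<open>sp(2n)\<close>-invariants the former reduces to a multiple of the degree.
\<close>

lemma casimir_harmonic:
  assumes sp: "odd_sp n N p" and harm: "\<And>t s. t < N \<Longrightarrow> s < N \<Longrightarrow> Lap 0 n t s p = 0"
  shows "(\<Sum>t<N. \<Sum>s<N. E_gl 0 n t s (E_gl 0 n s t p)) = scale (of_nat (2 * n + N + 1)) (\<Sum>t<N. E_gl 0 n t t p)"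
proof -
  let ?X = "\<lambda>a t. Xgen 0 a t" and ?d = "\<lambda>a t. dXgen 0 a t" and ?G = "\<lambda>a b. unit_act 0 N a b"
  define Deg where "Deg = (\<Sum>t<N. E_gl 0 n t t p)"
  \<comment> \<open>The normally ordered part shared by the two quadratic Casimir operators, up to
    sign.\<close>
  define Z where "Z = (\<Sum>t<N. \<Sum>s<N. \<Sum>a<2 * n. \<Sum>b<2 * n. ?X b t * (?X a s * ?d a t (?d b s p)))"
  have Deg: "Deg = (\<Sum>b<2 * n. \<Sum>t<N. ?X b t * ?d b t p)"
    unfolding Deg_def E_gl_def by (simp add: sum.swap[of _ "{..<N}"])
  have GG: "?G b a (?G c e p) = (if a = c then \<Sum>t<N. ?X b t * ?d e t p else 0) -
      (\<Sum>t<N. \<Sum>s<N. ?X b t * (?X c s * ?d a t (?d e s p)))" for a b c e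
  proof -
    have "?d a t (?G c e p) = (if a = c then ?d e t p else 0) - (\<Sum>s<N. ?X c s * ?d a t (?d e s p))" if "t < N" for t
    proof -
      have "?d a t (?G c e p) = (\<Sum>s<N. (if t = s then (if a = c then ?d e s p else 0) else 0) - ?X c s * ?d a t (?d e s p))"
        unfolding unit_act_def dXgen_sum by (intro sum.cong refl) (simp add: dXgen_Xgen_mult)
      then show ?thesis using that by (simp add: sum_subtractf)
    qed
    then have "?G b a (?G c e p) = (\<Sum>t<N. ?X b t * ((if a = c then ?d e t p else 0) - (\<Sum>s<N. ?X c s * ?d a t (?d e s p))))"
      by (simp add: unit_act_def[of 0 N b a])
    then show ?thesis
      by (simp add: right_diff_distrib sum_subtractf sum_distrib_left)
  qed
  have perm: "(\<Sum>a<2 * n. \<Sum>b<2 * n. \<Sum>t<N. \<Sum>s<N. f a b t s) = (\<Sum>t<N. \<Sum>s<N. \<Sum>a<2 * n. \<Sum>b<2 * n. f a b t s)"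
    for f :: "nat \<Rightarrow> nat \<Rightarrow> nat \<Rightarrow> nat \<Rightarrow> index superpoly"
    by (simp only: sum.swap[of _ "{..<2 * n}" "{..<N}"])
  \<comment> \<open>First evaluation of the \<open>gl(2n)\<close> Casimir: reordering only, with no
    use of invariance.\<close>
  have "(\<Sum>a<2 * n. \<Sum>b<2 * n. ?G b a (?G a b p)) = scale (of_nat (2 * n)) Deg - Z"
  proof -
    have "(\<Sum>a<2 * n. \<Sum>b<2 * n. ?G b a (?G a b p)) = (\<Sum>a<2 * n. Deg) - Z"
      by (simp add: GG sum_subtractf Deg Z_def perm)
    then show ?thesis by (simp only: sum_const_scale card_lessThan)
  qed
  \<comment> \<open>Second evaluation: invariance replaces the inner operator by its reflection,
    after which the quartic terms assemble into Laplacians of \<open>p\<close> and vanish.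
    Comparison gives \<open>Z\<close> as \<open>2 * n + 1\<close> times the degree.\<close>
  moreover have "(\<Sum>a<2 * n. \<Sum>b<2 * n. ?G b a (?G a b p)) = - Deg"
  proof -
    have "?G b a (?G a b p) = (if a = star 0 n b then - (\<Sum>t<N. ?X b t * ?d b t p) else 0) -
        (\<Sum>t<N. \<Sum>s<N. scale (kv 0 n a * kv 0 n b) (?X b t * (?X (star 0 n b) s * ?d a t (?d (star 0 n a) s p))))"
      if ab: "a < 2 * n" "b < 2 * n" for a b
    proof -
      have "?G a b p = scale (kv 0 n a * kv 0 n b) (?G (star 0 n b) (star 0 n a) p)"
        using sp ab unfolding odd_sp_def by blast
      then have "?G b a (?G a b p) = scale (kv 0 n a * kv 0 n b) (?G b a (?G (star 0 n b) (star 0 n a) p))"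
        by (simp add: unit_act_scale)
      moreover have "kv 0 n (star 0 n b) * kv 0 n b = - 1" "star 0 n (star 0 n b) = b"
        using kv_star[of b 0 n] star_star[of b 0 n] ab by simp_all
      then have "scale (kv 0 n a * kv 0 n b) (if a = star 0 n b then \<Sum>t<N. ?X b t * ?d (star 0 n a) t p else 0) =
          (if a = star 0 n b then - (\<Sum>t<N. ?X b t * ?d b t p) else 0)"
        by (auto simp: superpoly.scale_minus_left)
      ultimately show ?thesis
        by (simp only: GG superpoly.scale_right_diff_distrib superpoly.scale_sum_right)
    qed
    then have "(\<Sum>a<2 * n. \<Sum>b<2 * n. ?G b a (?G a b p)) =
        (\<Sum>a<2 * n. \<Sum>b<2 * n. (if a = star 0 n b then - (\<Sum>t<N. ?X b t * ?d b t p) else 0) -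
          (\<Sum>t<N. \<Sum>s<N. scale (kv 0 n a * kv 0 n b) (?X b t * (?X (star 0 n b) s * ?d a t (?d (star 0 n a) s p)))))"
      by (intro sum.cong refl) simp
    also have "\<dots> = (\<Sum>b<2 * n. \<Sum>a<2 * n. if a = star 0 n b then - (\<Sum>t<N. ?X b t * ?d b t p) else 0) -
        (\<Sum>a<2 * n. \<Sum>b<2 * n. \<Sum>t<N. \<Sum>s<N.
          scale (kv 0 n a * kv 0 n b) (?X b t * (?X (star 0 n b) s * ?d a t (?d (star 0 n a) s p))))"
      by (simp only: sum_subtractf) (subst sum.swap, rule refl)
    also have "(\<Sum>b<2 * n. \<Sum>a<2 * n. if a = star 0 n b then - (\<Sum>t<N. ?X b t * ?d b t p) else 0) = - Deg"
      using star_less[of _ 0 n] by (simp add: Deg sum_negf)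
    also have "(\<Sum>a<2 * n. \<Sum>b<2 * n. \<Sum>t<N. \<Sum>s<N.
          scale (kv 0 n a * kv 0 n b) (?X b t * (?X (star 0 n b) s * ?d a t (?d (star 0 n a) s p)))) =
        (\<Sum>t<N. \<Sum>s<N. \<Sum>b<2 * n. scale (kv 0 n b) (?X b t * (?X (star 0 n b) s * Lap 0 n t s p)))"
      unfolding perm by (subst sum.swap[of _ "{..<2 * n}" "{..<2 * n}"])
        (simp add: Lap_def sum_distrib_left superpoly.scale_sum_right scale_mult mult.commute)
    also have "\<dots> = 0" by (intro sum.neutral ballI) (simp add: harm)
    finally show ?thesis by simp
  qed
  \<comment> \<open>The \<open>gl(N)\<close> Casimir has the same quartic part with the opposite
    sign, because odd generators anticommute.\<close>
  moreover have "(\<Sum>t<N. \<Sum>s<N. E_gl 0 n t s (E_gl 0 n s t p)) = scale (of_nat N) Deg + Z"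
  proof -
    have "E_gl 0 n t s (E_gl 0 n s t p) = E_gl 0 n t t p + (\<Sum>a<2 * n. \<Sum>b<2 * n. ?X b s * (?X a t * ?d a s (?d b t p)))" for t s
    proof -
      have "?d a s (E_gl 0 n s t p) = ?d a t p - (\<Sum>b<2 * n. ?X b s * ?d a s (?d b t p))" if "a < 2 * n" for a
      proof -
        have "?d a s (E_gl 0 n s t p) = (\<Sum>b<2 * n. (if b = a then ?d b t p else 0) - ?X b s * ?d a s (?d b t p))"
          unfolding E_gl_def dXgen_sum by (intro sum.cong) (auto simp: dXgen_Xgen_mult)
        then show ?thesis using that by (simp add: sum_subtractf)
      qed
      then have "E_gl 0 n t s (E_gl 0 n s t p) = (\<Sum>a<2 * n. ?X a t * (?d a t p - (\<Sum>b<2 * n. ?X b s * ?d a s (?d b t p))))"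
        by (simp add: E_gl_def[of 0 n t s])
      moreover have "?X a t * (?X b s * q) = - (?X b s * (?X a t * q))" for a b q
        by (subst Xgen_swap) simp
      ultimately show ?thesis
        by (simp add: right_diff_distrib sum_subtractf sum_distrib_left sum_negf sum.distrib E_gl_def[of 0 n t t])
    qed
    then have "(\<Sum>t<N. \<Sum>s<N. E_gl 0 n t s (E_gl 0 n s t p)) = (\<Sum>t<N. scale (of_nat N) (E_gl 0 n t t p)) +
        (\<Sum>t<N. \<Sum>s<N. \<Sum>a<2 * n. \<Sum>b<2 * n. ?X b s * (?X a t * ?d a s (?d b t p)))"
      by (simp only: sum.distrib sum_const_scale card_lessThan)
    also have "(\<Sum>t<N. \<Sum>s<N. \<Sum>a<2 * n. \<Sum>b<2 * n. ?X b s * (?X a t * ?d a s (?d b t p))) = Z"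
      unfolding Z_def by (rule sum.swap)
    finally show ?thesis by (simp add: Deg_def superpoly.scale_sum_right)
  qed
  ultimately have "(\<Sum>t<N. \<Sum>s<N. E_gl 0 n t s (E_gl 0 n s t p)) = scale (of_nat N) Deg + (scale (of_nat (2 * n)) Deg + Deg)"
    by (simp add: algebra_simps)
  then show ?thesis
    unfolding Deg_def[symmetric] by (simp add: superpoly.scale_left_distrib algebra_simps)
qed

lemma odd_span_E_gl_0:
  assumes "p \<in> odd_span n k N" "t < k \<or> N \<le> t"
  shows "E_gl 0 n s t p = 0"
  using assms by (simp add: E_gl_def odd_span_dXgen_0)

lemma wt_0_le: "wt 0 n t u \<le> 2 * n"
proof -
  have "card {b. b < 2 * n \<and> Index b t |\<in>| snd u} \<le> card {..<2 * n}" by (intro card_mono) auto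
  then show ?thesis by (simp add: wt_def)
qed

lemma subspace_odd_span: "superpoly.subspace (odd_span n k N)"
  by (simp add: odd_span_def subspace_mono_span)

text \<open>On a highest weight vector the Casimir is also computable from the weight. In an
  exterior algebra every weight entry is at most \<open>2 * n\<close>, so that value is at most
  \<open>2 * n + N - 1\<close> times the degree, whereas the harmonic identity gives
  \<open>2 * n + N + 1\<close> times the degree. Hence the degree is 0.\<close>

lemma harmonic_weight_zero:
  assumes p: "p \<in> odd_span n k N" "p \<noteq> 0" "odd_sp n N p"
    and harm: "\<And>t s. t < N \<Longrightarrow> s < N \<Longrightarrow> Lap 0 n t s p = 0"
    and wtp: "\<And>t. t \<in> {k..<N} \<Longrightarrow> E_gl 0 n t t p = scale (of_nat (lam t)) p"
    and t: "t \<in> {k..<N}"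
  shows "lam t = 0"
proof -
  define Deg where "Deg q = (\<Sum>t<N. E_gl 0 n t t q)" for q
  have Deg_eq: "Deg q = scale (of_nat (\<Sum>t\<in>{k..<N}. mu t)) q"
    if q: "q \<in> odd_span n k N" "\<And>t. t \<in> {k..<N} \<Longrightarrow> E_gl 0 n t t q = scale (of_nat (mu t)) q" for q mu
  proof -
    have "Deg q = (\<Sum>t\<in>{k..<N}. E_gl 0 n t t q)"
      unfolding Deg_def using q(1) by (intro sum.mono_neutral_right) (auto simp: odd_span_E_gl_0)
    then show ?thesis by (simp add: q(2) superpoly.scale_sum_left)
  qed
  define d where "d = (\<Sum>t\<in>{k..<N}. lam t)"
  \<comment> \<open>The vector \<open>p\<close> need not be a highest weight vector. The space
    \<open>H\<close> is stable under raising operators and has a fixed degree, so it contains a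
    highest weight vector of the same degree as \<open>p\<close>.\<close>
  define H where "H = {q \<in> odd_span n k N. odd_sp n N q \<and> (\<forall>t<N. \<forall>s<N. Lap 0 n t s q = 0) \<and> Deg q = scale (of_nat d) q}"
  have Deg_lin: "Deg 0 = 0" "Deg (x + y) = Deg x + Deg y" "Deg (scale c x) = scale c (Deg x)" for x y c
    by (simp_all add: Deg_def E_gl_add E_gl_scale sum.distrib superpoly.scale_sum_right)
  have "superpoly.subspace H"
    unfolding superpoly.subspace_def
  proof (intro conjI ballI allI)
    show "0 \<in> H" using superpoly.subspace_0[OF subspace_odd_span] by (simp add: H_def odd_sp_linear Deg_lin)
    show "x + y \<in> H" if "x \<in> H" "y \<in> H" for x y
      using that superpoly.subspace_add[OF subspace_odd_span]
      by (simp add: H_def odd_sp_linear Deg_lin Lap_add superpoly.scale_right_distrib)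
    show "scale c x \<in> H" if "x \<in> H" for x c
      using that superpoly.subspace_scale[OF subspace_odd_span]
      by (simp add: H_def odd_sp_linear Deg_lin Lap_scale mult.commute)
  qed
  moreover have "E_gl 0 n i j q \<in> H" if "k \<le> i" "i \<le> j" "j < N" "q \<in> H" for i j q
  proof -
    have "Deg (E_gl 0 n i j q) = E_gl 0 n i j (Deg q)"
    proof -
      have "E_gl 0 n l l (E_gl 0 n i j q) = E_gl 0 n i j (E_gl 0 n l l q) + (if l = i then E_gl 0 n i j q else 0) -
          (if l = j then E_gl 0 n i j q else 0)" for l
        by (rule trans[OF E_gl_bracket]) auto
      moreover have "i < N" using that by simp
      ultimately show ?thesis using \<open>j < N\<close> by (simp only: Deg_def sum.distrib sum_subtractf E_gl_sum) simp
    qed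
    moreover have "Lap 0 n t s (E_gl 0 n i j q) = 0" if ts: "t < N" "s < N" for t s
    proof -
      have "Lap 0 n t s q = 0" "Lap 0 n j s q = 0" "Lap 0 n t j q = 0"
        using \<open>q \<in> H\<close> ts \<open>j < N\<close> by (simp_all add: H_def)
      then have "0 = Lap 0 n t s (E_gl 0 n i j q) - (if i = t then 0 else 0) - (if i = s then 0 else 0)"
        using E_gl_Lap[of 0 n i j t s q] by (simp only: E_gl_zero)
      then show ?thesis by simp
    qed
    ultimately show ?thesis using that
      by (simp add: H_def odd_span_E_gl odd_sp_E_gl E_gl_scale)
  qed
  moreover have "Deg p = scale (of_nat d) p" unfolding d_def by (rule Deg_eq[OF p(1) wtp])
  then have "p \<in> H" using p harm by (simp add: H_def)
  ultimately have "\<exists>q\<in>H. \<exists>mu. q \<noteq> 0 \<and> (\<forall>i\<in>{k..<N}. E_gl 0 n i i q = scale (of_nat (mu i)) q) \<and>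
      (\<forall>j\<in>{k..<N}. \<forall>i\<in>{k..<j}. E_gl 0 n i j q = 0)"
    using p(2) by (intro exists_highest_weight_vector[of H k N 0 n]) auto
  then obtain q mu where q: "q \<in> H" "q \<noteq> 0" "\<And>i. i \<in> {k..<N} \<Longrightarrow> E_gl 0 n i i q = scale (of_nat (mu i)) q"
    and raise: "\<And>i j. j \<in> {k..<N} \<Longrightarrow> i \<in> {k..<j} \<Longrightarrow> E_gl 0 n i j q = 0"
    by blast
  have qs: "q \<in> odd_span n k N" "odd_sp n N q" using q(1) by (auto simp: H_def)
  \<comment> \<open>Columns below \<open>k\<close> carry no generators and have weight 0, while
    \<open>mu\<close> is arbitrary there.\<close>
  define mu' where "mu' t = (if k \<le> t \<and> t < N then mu t else 0)" for t
  have diag: "E_gl 0 n t t q = scale (of_nat (mu' t)) q" if "t < N" for t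
    using that q(3)[of t] odd_span_E_gl_0[OF qs(1), of t t] by (auto simp: mu'_def)
  have mu_le: "mu' t \<le> 2 * n" if "t < N" for t
  proof -
    obtain u where "scoeff q u \<noteq> 0" using superpoly_nonzero_coeff q(2) by blast
    then have "of_nat (mu' t) = (of_nat (wt 0 n t u) :: complex)" using E_gl_diag_eigen[OF diag[OF that]] by blast
    then show ?thesis using wt_0_le[of n t u] by (simp only: of_nat_eq_iff)
  qed
  \<comment> \<open>The eigenvalue of \<open>E_gl 0 n t s\<close> after \<open>E_gl 0 n s t\<close>
    on \<open>q\<close>; for \<open>k \<le> t < s\<close> it comes from the commutator, since
    \<open>E_gl 0 n t s\<close> kills \<open>q\<close>.\<close>
  define c :: "nat \<Rightarrow> nat \<Rightarrow> real" where
    "c t s = (if t < k then 0 else if s = t then real (mu' t) * real (mu' t) else if s < k then real (mu' t)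
      else if s < t then 0 else real (mu' t) - real (mu' s))" for t s
  have EE: "E_gl 0 n t s (E_gl 0 n s t q) = scale (of_real (c t s)) q" if "t < N" "s < N" for t s
  proof -
    consider "t < k" | "k \<le> t" "s = t" | "k \<le> t" "s < k" | "k \<le> s" "s < t" | "k \<le> t" "t < s" by linarith
    then show ?thesis
    proof cases
      case 1
      then show ?thesis by (simp add: c_def odd_span_E_gl_0[OF qs(1)])
    next
      case 2
      then show ?thesis using diag[OF that(1)] by (simp add: c_def E_gl_scale)
    next
      case 3
      then show ?thesis using diag[OF that(1)] odd_span_E_gl_0[OF qs(1), of s]
        by (subst E_gl_bracket) (simp add: c_def)
    next
      case 4
      then show ?thesis using raise[of t s] that by (simp add: c_def)
    next
      case 5
      then have "E_gl 0 n t s q = 0" using raise[of s t] that by simp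
      then show ?thesis using 5 diag[OF that(1)] diag[OF that(2)]
        by (subst E_gl_bracket) (simp add: c_def superpoly.scale_left_diff_distrib)
    qed
  qed
  define S where "S = (\<Sum>t<N. mu' t)"
  have "(\<Sum>t<N. E_gl 0 n t t q) = scale (of_nat S) q"
    using diag by (simp add: S_def superpoly.scale_sum_left)
  moreover have "(\<Sum>t<N. \<Sum>s<N. E_gl 0 n t s (E_gl 0 n s t q)) = scale (of_real (\<Sum>t<N. \<Sum>s<N. c t s)) q"
    unfolding of_real_sum superpoly.scale_sum_left by (intro sum.cong refl) (simp only: lessThan_iff EE)
  ultimately have "scale (of_real (\<Sum>t<N. \<Sum>s<N. c t s)) q = scale (of_nat ((2 * n + N + 1) * S)) q"
  proof -
    have "(\<Sum>t<N. \<Sum>s<N. E_gl 0 n t s (E_gl 0 n s t q)) = scale (of_nat (2 * n + N + 1)) (\<Sum>t<N. E_gl 0 n t t q)"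
      using q(1) by (intro casimir_harmonic qs(2)) (simp add: H_def)
    moreover note \<open>(\<Sum>t<N. E_gl 0 n t t q) = scale (of_nat S) q\<close>
      \<open>(\<Sum>t<N. \<Sum>s<N. E_gl 0 n t s (E_gl 0 n s t q)) = scale (of_real (\<Sum>t<N. \<Sum>s<N. c t s)) q\<close>
    ultimately show ?thesis by (simp only: superpoly.scale_scale of_nat_mult)
  qed
  then have "of_real (\<Sum>t<N. \<Sum>s<N. c t s) = (of_nat ((2 * n + N + 1) * S) :: complex)"
    using q(2) by (simp only: superpoly.scale_cancel_right) simp
  then have "(\<Sum>t<N. \<Sum>s<N. c t s) = real ((2 * n + N + 1) * S)"
    by (metis of_real_of_nat_eq of_real_eq_iff)
  moreover have "(\<Sum>t<N. \<Sum>s<N. c t s) \<le> (2 * n + N - 1) * S"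
  proof -
    \<comment> \<open>The diagonal term is at most \<open>2 * n * mu' t\<close>, and each of the
      other \<open>N - 1\<close> terms at most \<open>mu' t\<close>.\<close>
    have "(\<Sum>s<N. c t s) \<le> (2 * n + N - 1) * mu' t" if "t < N" for t
    proof -
      have "(\<Sum>s<N. c t s) \<le> (\<Sum>s<N. mu' t * (if s = t then 2 * n else 1))"
      proof -
        have "real (mu' t) * real (mu' t) \<le> real (mu' t) * real (2 * n)"
          using mu_le[OF that] by (intro mult_left_mono) auto
        then show ?thesis unfolding of_nat_sum by (intro sum_mono) (auto simp: c_def)
      qed
      also have "(\<Sum>s<N. mu' t * (if s = t then 2 * n else 1)) = mu' t * (\<Sum>s<N. (if s = t then 2 * n else 1))"
        by (simp add: sum_distrib_left)
      also have "(\<Sum>s<N. (if s = t then 2 * n else 1)) = 2 * n + N - 1"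
        using that by (subst sum.remove[of _ t]) (auto simp: sum.If_cases)
      finally show ?thesis by (simp add: mult.commute)
    qed
    then have "(\<Sum>t<N. \<Sum>s<N. c t s) \<le> (\<Sum>t<N. real ((2 * n + N - 1) * mu' t))" by (intro sum_mono) auto
    then show ?thesis by (simp add: S_def sum_distrib_left)
  qed
  ultimately have "(2 * n + N + 1) * S \<le> (2 * n + N - 1) * S" by linarith
  moreover have "(2 * n + N - 1) * S \<le> (2 * n + N) * S" by (intro mult_le_mono1) simp
  ultimately have "S = 0" by (simp add: algebra_simps)
  then have "Deg q = 0" using \<open>(\<Sum>t<N. E_gl 0 n t t q) = scale (of_nat S) q\<close> by (simp add: Deg_def)
  then have "d = 0" using q(1,2) by (simp add: H_def)
  then show ?thesis using t by (simp add: d_def)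
qed

subsection \<open>Reduction of highest weight vectors by Laplacians\<close>

lemma funpow_zero_scale:
  fixes f :: "'i superpoly \<Rightarrow> 'i superpoly"
  assumes "\<And>c p. f (scale c p) = scale c (f p)"
  shows "(f ^^ r) (scale c p) = scale c ((f ^^ r) p)" "(f ^^ r) 0 = 0"
proof -
  show *: "(f ^^ r) (scale c p) = scale c ((f ^^ r) p)" for c p
  proof (induction r)
    case (Suc r)
    then show ?case by (simp add: assms)
  qed simp
  show "(f ^^ r) 0 = 0" using *[of 0 0] by simp
qed

text \<open>Words in the commuting Laplacians are sorted into three kinds: mixed factors joining
  column \<open>k\<close> to another one (\<open>Lap_list\<close>), powers of the diagonal Laplacian
  of column \<open>k\<close>, and factors away from column \<open>k\<close>
  (\<open>Lap_word\<close>). The reduction below tracks the number of mixed factors.\<close>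

definition Lap_list :: "nat \<Rightarrow> nat \<Rightarrow> nat list \<Rightarrow> index superpoly \<Rightarrow> index superpoly" where
  "Lap_list n k bs p = foldr (Lap 0 n k) bs p"

definition Lap_word :: "nat \<Rightarrow> (nat \<times> nat) list \<Rightarrow> index superpoly \<Rightarrow> index superpoly" where
  "Lap_word n ws p = foldr (\<lambda>(t, s). Lap 0 n t s) ws p"

definition Lap_op :: "nat \<Rightarrow> nat \<Rightarrow> nat list \<Rightarrow> nat \<Rightarrow> (nat \<times> nat) list \<Rightarrow> index superpoly \<Rightarrow> index superpoly" where
  "Lap_op n k bs c ws p = Lap_list n k bs ((Lap 0 n k k ^^ c) (Lap_word n ws p))"

lemma Lap_list_simps [simp]: "Lap_list n k [] p = p" "Lap_list n k (b # bs) p = Lap 0 n k b (Lap_list n k bs p)"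
  by (simp_all add: Lap_list_def)

lemma Lap_word_simps [simp]: "Lap_word n [] p = p" "Lap_word n (w # ws) p = Lap 0 n (fst w) (snd w) (Lap_word n ws p)"
  by (simp_all add: Lap_word_def case_prod_beta)

lemma Lap_list_scale: "Lap_list n k bs (scale c p) = scale c (Lap_list n k bs p)"
  by (induction bs) (simp_all add: Lap_scale)

lemma Lap_list_zero [simp]: "Lap_list n k bs 0 = 0"
  by (induction bs) simp_all

lemma Lap_word_zero [simp]: "Lap_word n ws 0 = 0"
  by (induction ws) simp_all

lemma Lap_pow_zero [simp]: "(Lap m n t s ^^ c) 0 = 0"
  by (rule funpow_zero_scale) (rule Lap_scale)

lemma Lap_Lap_list: "Lap 0 n t s (Lap_list n k bs p) = Lap_list n k bs (Lap 0 n t s p)"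
proof (induction bs)
  case (Cons b bs)
  show ?case using Lap_commute[of 0 n t s k b] by (simp add: Cons)
qed simp

lemma Lap_Lap_word: "Lap 0 n t s (Lap_word n ws p) = Lap_word n ws (Lap 0 n t s p)"
proof (induction ws)
  case (Cons w ws)
  show ?case using Lap_commute[of 0 n t s "fst w" "snd w"] by (simp add: Cons)
qed simp

lemma Lap_Lap_pow: "Lap m n t s ((Lap m n u v ^^ c) p) = (Lap m n u v ^^ c) (Lap m n t s p)"
proof (induction c)
  case (Suc c)
  show ?case using Lap_commute[of m n t s u v] by (simp add: Suc)
qed simp

lemma Lap_pow_Lap_word: "(Lap 0 n t s ^^ c) (Lap_word n ws p) = Lap_word n ws ((Lap 0 n t s ^^ c) p)"
  by (induction c) (simp_all add: Lap_Lap_word)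

lemma Lap_op_extend:
  "Lap 0 n k k (Lap_op n k bs c ws p) = Lap_op n k bs (Suc c) ws p"
  "Lap 0 n k b (Lap_op n k bs c ws p) = Lap_op n k (b # bs) c ws p"
  "Lap 0 n t s (Lap_op n k bs c ws p) = Lap_op n k bs c ((t, s) # ws) p"
  by (simp_all add: Lap_op_def Lap_Lap_list Lap_Lap_pow)

text \<open>Commuting past a mixed factor trades its index \<open>k\<close> for \<open>b\<close>, so
  that factor leaves the list and becomes one away from column \<open>k\<close>. Since
  \<open>k\<close> is not in \<open>bs\<close>, each factor is hit only once.\<close>

lemma E_gl_Lap_list:
  assumes "k \<notin> set bs"
  shows "E_gl 0 n k b (Lap_list n k bs p) = Lap_list n k bs (E_gl 0 n k b p) -
    (\<Sum>i<length bs. Lap_list n k (take i bs @ drop (Suc i) bs) (Lap 0 n b (bs ! i) p))"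
  using assms
proof (induction bs)
  case (Cons x xs)
  have "E_gl 0 n k b (Lap_list n k (x # xs) p) = Lap 0 n k x (E_gl 0 n k b (Lap_list n k xs p)) - Lap 0 n b x (Lap_list n k xs p)"
    using Cons.prems by (simp add: E_gl_Lap)
  also have "E_gl 0 n k b (Lap_list n k xs p) = Lap_list n k xs (E_gl 0 n k b p) -
    (\<Sum>i<length xs. Lap_list n k (take i xs @ drop (Suc i) xs) (Lap 0 n b (xs ! i) p))"
    using Cons by simp
  finally show ?case
    by (simp add: Lap_minus Lap_sum Lap_Lap_list sum.lessThan_Suc_shift diff_diff_add add.commute del: sum.lessThan_Suc)
qed simp

text \<open>Each of the \<open>Suc c\<close> factors contains the index \<open>k\<close> twice,
  which gives the constant \<open>2 * Suc c\<close>. Its being nonzero is what lets a mixed factor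
  be eliminated later.\<close>

lemma E_gl_Lap_pow:
  assumes "b \<noteq> k"
  shows "E_gl 0 n k b ((Lap 0 n k k ^^ Suc c) p) = (Lap 0 n k k ^^ Suc c) (E_gl 0 n k b p) -
    scale (of_nat (2 * Suc c)) ((Lap 0 n k k ^^ c) (Lap 0 n k b p))"
proof (induction c)
  case 0
  have "Lap 0 n k b p + Lap 0 n k b p = scale 2 (Lap 0 n k b p)"
    by (metis one_add_one superpoly.scale_left_distrib superpoly.scale_one)
  then show ?case by (simp add: E_gl_Lap Lap_sym[of 0 n b k] diff_diff_add)
next
  case (Suc c)
  define q where "q = (Lap 0 n k k ^^ Suc c) p"
  have r: "Lap 0 n k b q = (Lap 0 n k k ^^ Suc c) (Lap 0 n k b p)"
    unfolding q_def by (rule Lap_Lap_pow)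
  have "E_gl 0 n k b ((Lap 0 n k k ^^ Suc (Suc c)) p) = E_gl 0 n k b (Lap 0 n k k q)"
    by (simp add: q_def)
  also have "\<dots> = Lap 0 n k k (E_gl 0 n k b q) - (Lap 0 n k b q + Lap 0 n k b q)"
    by (simp add: E_gl_Lap Lap_sym[of 0 n b k] diff_diff_add)
  also have "Lap 0 n k b q + Lap 0 n k b q = scale 2 (Lap 0 n k b q)"
    by (metis one_add_one superpoly.scale_left_distrib superpoly.scale_one)
  also have "Lap 0 n k k (E_gl 0 n k b q) = (Lap 0 n k k ^^ Suc (Suc c)) (E_gl 0 n k b p) -
      scale (of_nat (2 * Suc c)) (Lap 0 n k b q)"
    unfolding r using Suc by (simp add: q_def Lap_minus Lap_scale)
  moreover have "scale (of_nat (2 * Suc (Suc c))) x = scale (of_nat (2 * Suc c)) x + scale 2 x" for x :: "index superpoly"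
    by (simp flip: superpoly.scale_left_distrib)
  ultimately show ?case
    by (simp only: r diff_diff_add)
qed

lemma E_gl_Lap_word_0:
  assumes "E_gl 0 n k b p = 0" "\<And>w. w \<in> set ws \<Longrightarrow> fst w \<noteq> k \<and> snd w \<noteq> k"
  shows "E_gl 0 n k b (Lap_word n ws p) = 0"
  using assms by (induction ws) (auto simp: E_gl_Lap)

lemma odd_span_Lap_list: "p \<in> odd_span n k N \<Longrightarrow> Lap_list n j bs p \<in> odd_span n k N"
  by (induction bs) (simp_all add: odd_span_Lap)

lemma odd_span_Lap_word: "p \<in> odd_span n k N \<Longrightarrow> Lap_word n ws p \<in> odd_span n k N"
  by (induction ws) (simp_all add: odd_span_Lap)

lemma odd_span_Lap_pow: "p \<in> odd_span n k N \<Longrightarrow> (Lap 0 n t s ^^ c) p \<in> odd_span n k N"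
  by (induction c) (simp_all add: odd_span_Lap)

lemma odd_sp_Lap_list: "odd_sp n N p \<Longrightarrow> j < N \<Longrightarrow> set bs \<subseteq> {..<N} \<Longrightarrow> odd_sp n N (Lap_list n j bs p)"
  by (induction bs) (simp_all add: odd_sp_Lap)

lemma odd_sp_Lap_word: "odd_sp n N p \<Longrightarrow> set ws \<subseteq> {..<N} \<times> {..<N} \<Longrightarrow> odd_sp n N (Lap_word n ws p)"
  by (induction ws) (auto simp: odd_sp_Lap)

lemma odd_sp_Lap_pow: "odd_sp n N p \<Longrightarrow> t < N \<Longrightarrow> s < N \<Longrightarrow> odd_sp n N ((Lap 0 n t s ^^ c) p)"
  by (induction c) (simp_all add: odd_sp_Lap)

lemma Lap_op_weight:
  assumes "E_gl 0 n i i p = scale x p"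
  shows "E_gl 0 n i i (Lap_op n k bs c ws p) = scale (x - of_nat (
    (\<Sum>w\<leftarrow>ws. of_bool (i = fst w) + of_bool (i = snd w)) + c * (2 * of_bool (i = k)) +
    (\<Sum>b\<leftarrow>bs. of_bool (i = k) + of_bool (i = b)))) (Lap_op n k bs c ws p)"
proof -
  have 1: "E_gl 0 n i i (Lap_word n ws p) = scale (x - of_nat (\<Sum>w\<leftarrow>ws. of_bool (i = fst w) + of_bool (i = snd w))) (Lap_word n ws p)"
    using assms
  proof (induction ws)
    case (Cons w ws)
    show ?case unfolding Lap_word_simps
      by (rule trans[OF E_gl_diag_Lap[OF Cons.IH[OF Cons.prems]]], rule arg_cong2[where f = scale])
        (auto simp: of_bool_def)
  qed simp
  have 2: "E_gl 0 n i i ((Lap 0 n k k ^^ c) q) = scale (y - of_nat (c * (2 * of_bool (i = k)))) ((Lap 0 n k k ^^ c) q)"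
    if "E_gl 0 n i i q = scale y q" for y q
  proof (induction c)
    case (Suc c)
    show ?case unfolding funpow.simps comp_def
      by (rule trans[OF E_gl_diag_Lap[OF Suc]], rule arg_cong2[where f = scale]) (auto simp: of_bool_def)
  qed (simp add: that)
  have 3: "E_gl 0 n i i (Lap_list n k bs q) = scale (y - of_nat (\<Sum>b\<leftarrow>bs. of_bool (i = k) + of_bool (i = b))) (Lap_list n k bs q)"
    if "E_gl 0 n i i q = scale y q" for y q
    using that
  proof (induction bs)
    case (Cons b bs)
    show ?case unfolding Lap_list_simps
      by (rule trans[OF E_gl_diag_Lap[OF Cons.IH[OF Cons.prems]]], rule arg_cong2[where f = scale])
        (auto simp: of_bool_def)
  qed simp
  show ?thesis unfolding Lap_op_def
    by (rule trans[OF 3[OF 2[OF 1]]], rule arg_cong2[where f = scale]) simp_all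
qed

lemma eigen_nat:
  assumes "E_gl m n i i p = scale (of_nat x - of_nat y) p" "p \<noteq> 0"
  shows "y \<le> x"
proof -
  obtain u where "scoeff p u \<noteq> 0" using superpoly_nonzero_coeff assms(2) by blast
  then have "of_nat x - of_nat y = (of_nat (wt m n i u) :: complex)" by (rule E_gl_diag_eigen[OF assms(1)])
  then have "of_nat x = (of_nat (wt m n i u + y) :: complex)" by (simp add: algebra_simps)
  then show ?thesis by (simp only: of_nat_eq_iff)
qed

text \<open>
  Among all words in the Laplacians that send \<open>p\<close> to a nonzero element of weight \<open>0\<close>, one with the
  fewest mixed factors \<open>Lap 0 n k b\<close>, \<open>b > k\<close>, has none: moving the raising operator \<open>E_gl 0 n k b\<close>
  through \<open>Lap 0 n k k ^^ Suc c\<close> replaces two mixed factors by other ones.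
\<close>

theorem highest_weight_reduction:
  assumes p: "p \<in> odd_span n k N" "p \<noteq> 0" "odd_sp n N p" and k: "k < N"
    and wtp: "\<And>t. t \<in> {k..<N} \<Longrightarrow> E_gl 0 n t t p = scale (of_nat (lam t)) p"
    and hw: "\<And>j. j \<in> {k<..<N} \<Longrightarrow> E_gl 0 n k j p = 0"
  shows "even (lam k) \<and> (Lap 0 n k k ^^ (lam k div 2)) p \<noteq> 0"
proof -
  define valid where "valid bs ws \<longleftrightarrow> set bs \<subseteq> {k<..<N} \<and> set ws \<subseteq> {k<..<N} \<times> {k<..<N}"
    for bs :: "nat list" and ws :: "(nat \<times> nat) list"
  \<comment> \<open>How often column \<open>i\<close> occurs in the word, that is, by how much the
    word lowers the weight entry at \<open>i\<close>.\<close>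
  define cnt where "cnt i bs c ws = (\<Sum>w\<leftarrow>ws. of_bool (i = fst w) + of_bool (i = snd w)) + c * (2 * of_bool (i = k)) +
      (\<Sum>b\<leftarrow>bs. of_bool (i = k) + of_bool (i = b))" for i c :: nat and bs and ws :: "(nat \<times> nat) list"
  have weight: "E_gl 0 n t t (Lap_op n k bs c ws p) = scale (of_nat (lam t) - of_nat (cnt t bs c ws)) (Lap_op n k bs c ws p)"
    if "t \<in> {k..<N}" for t bs c ws
    unfolding cnt_def by (rule Lap_op_weight[OF wtp[OF that]])
  have cnt_le: "cnt t bs c ws \<le> lam t" if "t \<in> {k..<N}" "Lap_op n k bs c ws p \<noteq> 0" for t bs c ws
    using eigen_nat[OF weight[OF that(1)] that(2)] .
  have cnt_k: "cnt k bs c ws = 2 * c + length bs" if "valid bs ws" for bs c ws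
  proof -
    have "(\<Sum>w\<leftarrow>ws. of_bool (k = fst w) + of_bool (k = snd w)) = (0::nat)"
      using that unfolding valid_def by (induction ws) auto
    moreover have "(\<Sum>b\<leftarrow>bs. of_bool (k = k) + of_bool (k = b)) = length bs"
      using that unfolding valid_def by (induction bs) auto
    ultimately show ?thesis by (simp add: cnt_def)
  qed
  define len where "len x = (case x of (bs, c, ws) \<Rightarrow> length bs + c + length ws)" for x :: "nat list \<times> nat \<times> (nat \<times> nat) list"
  define Q where "Q x = (case x of (bs, c, ws) \<Rightarrow> valid bs ws \<and> Lap_op n k bs c ws p \<noteq> 0)" for x
  have sum_cnt: "(\<Sum>t\<in>{k..<N}. cnt t bs c ws) = 2 * (length bs + c + length ws)" if "valid bs ws" for bs c ws
  proof -
    have "(\<Sum>t\<in>{k..<N}. \<Sum>w\<leftarrow>ws. of_bool (t = fst w) + of_bool (t = snd w)) = 2 * length ws"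
      using that unfolding valid_def by (induction ws) (auto simp: sum.distrib sum.If_cases of_bool_def)
    moreover have "(\<Sum>t\<in>{k..<N}. \<Sum>b\<leftarrow>bs. of_bool (t = k) + of_bool (t = b)) = 2 * length bs"
      using that k unfolding valid_def by (induction bs) (auto simp: sum.distrib sum.If_cases of_bool_def)
    moreover have "(\<Sum>t\<in>{k..<N}. c * (2 * of_bool (t = k))) = 2 * c"
      using k by (simp add: of_bool_def if_distrib cong: if_cong)
    ultimately show ?thesis by (simp add: cnt_def sum.distrib)
  qed
  have "Q ([], 0, [])" using p(2) by (simp add: Q_def valid_def Lap_op_def)
  moreover have "len x \<le> (\<Sum>t\<in>{k..<N}. lam t)" if "Q x" for x
  proof -
    obtain bs c ws where x: "x = (bs, c, ws)" by (cases x)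
    have "2 * (length bs + c + length ws) \<le> (\<Sum>t\<in>{k..<N}. lam t)"
      using that cnt_le by (subst sum_cnt[symmetric]) (auto simp: Q_def x intro!: sum_mono)
    then show ?thesis by (simp add: len_def x)
  qed
  \<comment> \<open>A longest word not killing \<open>p\<close>; the length is bounded by the total
    weight. Any further Laplacian would give a longer word, so the resulting \<open>g\<close> is
    harmonic.\<close>
  ultimately obtain x where x: "Q x" "\<And>y. Q y \<Longrightarrow> len y \<le> len x"
    using ex_has_greatest_nat[of Q "([], 0, [])" len "Suc (\<Sum>t\<in>{k..<N}. lam t)"] by (metis le_imp_less_Suc less_imp_le)
  obtain bs c ws where xeq: "x = (bs, c, ws)" by (cases x)
  define g where "g = Lap_op n k bs c ws p"
  have g: "valid bs ws" "g \<noteq> 0" using x(1) by (auto simp: Q_def xeq g_def)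
  have g_span: "g \<in> odd_span n k N"
    unfolding g_def Lap_op_def by (intro odd_span_Lap_list odd_span_Lap_pow odd_span_Lap_word p)
  have "set ws \<subseteq> {..<N} \<times> {..<N}" "set bs \<subseteq> {..<N}" using g(1) unfolding valid_def by fastforce+
  then have g_sp: "odd_sp n N g"
    unfolding g_def Lap_op_def by (intro odd_sp_Lap_list odd_sp_Lap_pow odd_sp_Lap_word p k)
  have harm: "Lap 0 n t s g = 0" if ts: "t < N" "s < N" for t s
  proof -
    have ord: "Lap 0 n t s g = 0" if ts: "t < N" "s < N" "t \<le> s" for t s
    proof (rule ccontr)
      assume nz: "Lap 0 n t s g \<noteq> 0"
      then have tk: "k \<le> t" using odd_span_Lap_0[OF g_span] by (metis linorder_not_less)
      have "\<exists>y. Q y \<and> len y = Suc (len x)"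
      proof (cases "t = k")
        case True
        show ?thesis
        proof (cases "s = k")
          case True
          then show ?thesis using \<open>t = k\<close> nz g
            by (intro exI[of _ "(bs, Suc c, ws)"]) (simp add: Q_def len_def xeq g_def Lap_op_extend)
        next
          case False
          then show ?thesis using \<open>t = k\<close> nz g ts
            by (intro exI[of _ "(s # bs, c, ws)"]) (simp add: Q_def len_def xeq g_def Lap_op_extend valid_def)
        qed
      next
        case False
        then show ?thesis using nz g ts tk
          by (intro exI[of _ "(bs, c, (t, s) # ws)"]) (simp add: Q_def len_def xeq g_def Lap_op_extend valid_def)
      qed
      then show False using x(2) by fastforce
    qed
    show ?thesis
      using ord[of t s] ord[of s t] Lap_sym[of 0 n t s g] ts by (metis linorder_le_cases)
  qed
  have g_wt: "E_gl 0 n t t g = scale (of_nat (lam t - cnt t bs c ws)) g" if "t \<in> {k..<N}" for t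
    using weight[OF that, of bs c ws] cnt_le[OF that, of bs c ws] g(2) by (simp add: g_def of_nat_diff)
  \<comment> \<open>Harmonic invariants have weight 0, so the word uses up the whole weight of
    column \<open>k\<close>.\<close>
  have "lam k - cnt k bs c ws = 0"
    by (rule harmonic_weight_zero[OF g_span g(2) g_sp harm g_wt]) (use k in auto)
  then have "cnt k bs c ws = lam k" using cnt_le[of k bs c ws] g(2) k by (simp add: g_def)
  then have lamk: "lam k = 2 * c + length bs" using cnt_k[OF g(1)] by simp
  \<comment> \<open>From here on the length is irrelevant: only words exhausting column
    \<open>k\<close> are kept, and the number of mixed factors is minimised.\<close>
  define R where "R x = (case x of (bs, c, ws) \<Rightarrow> valid bs ws \<and> lam k = 2 * c + length bs \<and> Lap_op n k bs c ws p \<noteq> 0)" for x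
  have "R (bs, c, ws)" using g lamk by (simp add: R_def g_def)
  then obtain y where y: "R y" "\<And>z. R z \<Longrightarrow> length (fst y) \<le> length (fst z)"
    using ex_has_least_nat[of R _ "\<lambda>z. length (fst z)"] by blast
  obtain bs c ws where yeq: "y = (bs, c, ws)" by (cases y)
  have v: "valid bs ws" and lamk: "lam k = 2 * c + length bs" and nz: "Lap_op n k bs c ws p \<noteq> 0"
    using y(1) by (auto simp: R_def yeq)
  have "bs = []"
  proof (rule ccontr)
    assume "bs \<noteq> []"
    then obtain b bs' where bs: "bs = b # bs'" by (cases bs) auto
    have b: "b \<in> {k<..<N}" and bs': "set bs' \<subseteq> {k<..<N}" "valid bs' ws" using v by (auto simp: valid_def bs)
    define W where "W = Lap_word n ws p"
    \<comment> \<open>Replacing the mixed factor by a diagonal one uses column \<open>k\<close> once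
      too often, so the result is 0. Applying \<open>E_gl 0 n k b\<close> to this zero produces the
      relation that is needed.\<close>
    have "\<not> cnt k bs' (Suc c) ws \<le> lam k" by (simp add: cnt_k[OF bs'(2)] lamk bs)
    then have "Lap_op n k bs' (Suc c) ws p = 0" using cnt_le[of k bs' "Suc c" ws] k by auto
    then have z: "Lap_list n k bs' ((Lap 0 n k k ^^ Suc c) W) = 0" by (simp only: Lap_op_def W_def)
    have "E_gl 0 n k b W = 0"
      unfolding W_def using v b by (intro E_gl_Lap_word_0 hw) (auto simp: valid_def)
    then have E: "E_gl 0 n k b ((Lap 0 n k k ^^ Suc c) W) = - scale (of_nat (2 * Suc c)) ((Lap 0 n k k ^^ c) (Lap 0 n k b W))"
      using b by (subst E_gl_Lap_pow) (auto simp del: funpow.simps)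
    \<comment> \<open>When the raising operator hits one of the remaining mixed factors, the word
      keeps its weight in column \<open>k\<close> but has two mixed factors fewer than
      \<open>bs\<close>. By minimality it vanishes, and only the term from the diagonal power
      survives.\<close>
    have "Lap_list n k (take i bs' @ drop (Suc i) bs') (Lap 0 n b (bs' ! i) ((Lap 0 n k k ^^ Suc c) W)) = 0"
      if i: "i < length bs'" for i
    proof (rule ccontr)
      let ?bs = "take i bs' @ drop (Suc i) bs'" and ?ws = "(b, bs' ! i) # ws"
      assume nz': "Lap_list n k ?bs (Lap 0 n b (bs' ! i) ((Lap 0 n k k ^^ Suc c) W)) \<noteq> 0"
      have "bs' ! i \<in> {k<..<N}" using bs'(1) nth_mem[OF i] by blast
      then have "valid ?bs ?ws" using bs' b v by (auto simp: valid_def dest: in_set_takeD in_set_dropD)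
      moreover have l: "length ?bs + 2 = length bs" using i by (simp add: bs)
      moreover have "Lap_op n k ?bs (Suc c) ?ws p \<noteq> 0"
        using nz' by (simp only: Lap_op_def W_def Lap_word_simps fst_conv snd_conv Lap_Lap_pow) simp
      ultimately have "R (?bs, Suc c, ?ws)" using lamk by (simp add: R_def)
      then show False using y(2)[of "(?bs, Suc c, ?ws)"] l by (simp add: yeq)
    qed
    then have "E_gl 0 n k b (Lap_list n k bs' ((Lap 0 n k k ^^ Suc c) W)) =
        Lap_list n k bs' (E_gl 0 n k b ((Lap 0 n k k ^^ Suc c) W))"
      using bs'(1) by (subst E_gl_Lap_list) (auto simp del: funpow.simps)
    then have "Lap_list n k bs' (scale (- of_nat (2 * Suc c)) ((Lap 0 n k k ^^ c) (Lap 0 n k b W))) = 0"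
      unfolding z E by (simp only: E_gl_zero superpoly.scale_minus_left)
    then have "Lap_list n k bs' ((Lap 0 n k k ^^ c) (Lap 0 n k b W)) = 0"
      unfolding Lap_list_scale by (simp only: superpoly.scale_eq_0_iff neg_equal_0_iff_equal of_nat_eq_0_iff) simp
    moreover have "Lap_op n k bs c ws p = Lap_list n k bs' ((Lap 0 n k k ^^ c) (Lap 0 n k b W))"
      by (simp add: Lap_op_def bs W_def Lap_Lap_list Lap_Lap_pow)
    ultimately show False using nz by simp
  qed
  then have "Lap_word n ws ((Lap 0 n k k ^^ c) p) \<noteq> 0"
    using nz by (simp add: Lap_op_def Lap_pow_Lap_word)
  then have "(Lap 0 n k k ^^ c) p \<noteq> 0" by auto
  then show ?thesis using lamk \<open>bs = []\<close> by simp
qed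

section \<open>Stripping the columns one after another\<close>

lemma Lap_pow_scale: "(Lap m n t s ^^ c) (scale x p) = scale x ((Lap m n t s ^^ c) p)"
  by (rule funpow_zero_scale) (rule Lap_scale)

lemma Lap_pow_add: "(Lap m n t s ^^ c) (p + q) = (Lap m n t s ^^ c) p + (Lap m n t s ^^ c) q"
proof (induction c)
  case (Suc c)
  then show ?case by (simp add: Lap_add)
qed simp

text \<open>With \<open>fold\<close> the head of the list acts first, so columns are removed in
  increasing order, as the induction requires.\<close>

definition Lap_diag :: "nat \<Rightarrow> (nat \<Rightarrow> nat) \<Rightarrow> nat list \<Rightarrow> index superpoly \<Rightarrow> index superpoly" where
  "Lap_diag n lam ts p = fold (\<lambda>t. Lap 0 n t t ^^ (lam t div 2)) ts p"

lemma Lap_diag_simps [simp]: "Lap_diag n lam [] p = p"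
  "Lap_diag n lam (t # ts) p = Lap_diag n lam ts ((Lap 0 n t t ^^ (lam t div 2)) p)"
  by (simp_all add: Lap_diag_def)

lemma Lap_diag_add: "Lap_diag n lam ts (p + q) = Lap_diag n lam ts p + Lap_diag n lam ts q"
  and Lap_diag_scale: "Lap_diag n lam ts (scale c p) = scale c (Lap_diag n lam ts p)"
  by (induction ts arbitrary: p q) (simp_all add: Lap_pow_add Lap_pow_scale)

lemma E_gl_diag_Lap_pow:
  assumes "E_gl 0 n i i p = scale y p"
  shows "E_gl 0 n i i ((Lap 0 n k k ^^ c) p) = scale (y - of_nat (c * (2 * of_bool (i = k)))) ((Lap 0 n k k ^^ c) p)"
proof (induction c)
  case (Suc c)
  show ?case unfolding funpow.simps comp_def
    by (rule trans[OF E_gl_diag_Lap[OF Suc]], rule arg_cong2[where f = scale]) (auto simp: of_bool_def)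
qed (simp add: assms)

lemma E_gl_Lap_pow_commute: "i \<noteq> t \<Longrightarrow> E_gl m n i j ((Lap m n t t ^^ c) p) = (Lap m n t t ^^ c) (E_gl m n i j p)"
  by (induction c) (simp_all add: E_gl_Lap)

lemma odd_span_step:
  assumes p: "p \<in> odd_span n k N" and k: "k < N" and "E_gl 0 n k k p = 0"
  shows "p \<in> odd_span n (Suc k) N"
  unfolding odd_span_def
proof (rule mono_spanI)
  fix u assume u: "scoeff p u \<noteq> 0"
  have "of_nat (wt 0 n k u) * scoeff p u = 0" using scoeff_E_gl_diag[of 0 n k p u] assms(3) by simp
  then have "wt 0 n k u = 0" using u by simp
  then have none: "{b. b < 2 * n \<and> Index b k |\<in>| snd u} = {}"
    using finite_subset[of "{b. b < 2 * n \<and> Index b k |\<in>| snd u}" "{..<2 * n}"] by (auto simp: wt_def)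
  have "fset (snd u) \<subseteq> {Index b t | b t. b < 2 * n \<and> k \<le> t \<and> t < N}"
    using mono_spanD[of p UNIV _ u] p u by (simp add: odd_span_def)
  moreover have "t \<noteq> k" if "Index b t |\<in>| snd u" "b < 2 * n" for b t using none that by auto
  ultimately have "fset (snd u) \<subseteq> {Index b t | b t. b < 2 * n \<and> Suc k \<le> t \<and> t < N}"
    by (fastforce simp: Suc_le_eq order_less_le)
  then show "set_mset (fst u) \<subseteq> UNIV \<and> fset (snd u) \<subseteq> {Index b t |b t. b < 2 * n \<and> Suc k \<le> t \<and> t < N}"
    by simp
qed

text \<open>Once the diagonal Laplacian has exhausted column \<open>k\<close>, no odd generator of
  that column is left. Raising operators between later columns commute with this Laplacian, so the
  remaining vector satisfies the same hypotheses from \<open>Suc k\<close> on. At the end no odd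
  generators remain.\<close>

theorem odd_highest_weight:
  assumes "p \<in> odd_span n k N" "p \<noteq> 0" "odd_sp n N p" "k \<le> N"
    and "\<And>t. t \<in> {k..<N} \<Longrightarrow> E_gl 0 n t t p = scale (of_nat (lam t)) p"
    and "\<And>i j. j \<in> {k..<N} \<Longrightarrow> i \<in> {k..<j} \<Longrightarrow> E_gl 0 n i j p = 0"
  shows "(\<forall>t\<in>{k..<N}. even (lam t)) \<and> Lap_diag n lam [k..<N] p \<noteq> 0 \<and> Lap_diag n lam [k..<N] p \<in> odd_span n N N"
  using assms
proof (induction "N - k" arbitrary: k p)
  case 0
  then show ?case by simp
next
  case (Suc x)
  then have k: "k < N" by simp
  define q where "q = (Lap 0 n k k ^^ (lam k div 2)) p"
  have red: "even (lam k)" "q \<noteq> 0"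
  proof -
    have "E_gl 0 n k j p = 0" if "j \<in> {k<..<N}" for j
      using Suc.prems(6)[of j k] that by auto
    then show "even (lam k)" "q \<noteq> 0"
      using highest_weight_reduction[OF Suc.prems(1-3) k Suc.prems(5)] by (simp_all add: q_def)
  qed
  have diag: "E_gl 0 n t t q = scale (of_nat (lam t) - of_nat (lam k div 2 * (2 * of_bool (t = k)))) q"
    if "t \<in> {k..<N}" for t
    unfolding q_def by (rule E_gl_diag_Lap_pow[OF Suc.prems(5)[OF that]])
  have "E_gl 0 n k k q = 0"
    using diag[of k] k red(1) by (simp flip: of_nat_mult)
  moreover have "q \<in> odd_span n k N" unfolding q_def by (intro odd_span_Lap_pow Suc.prems)
  ultimately have "q \<in> odd_span n (Suc k) N" using odd_span_step k by blast
  moreover have "odd_sp n N q" unfolding q_def by (intro odd_sp_Lap_pow Suc.prems k)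
  moreover have "E_gl 0 n t t q = scale (of_nat (lam t)) q" if "t \<in> {Suc k..<N}" for t
    using diag[of t] that by simp
  moreover have "E_gl 0 n i j q = 0" if "j \<in> {Suc k..<N}" "i \<in> {Suc k..<j}" for i j
    unfolding q_def using that Suc.prems(6)[of j i] by (simp add: E_gl_Lap_pow_commute)
  ultimately have IH: "(\<forall>t\<in>{Suc k..<N}. even (lam t)) \<and> Lap_diag n lam [Suc k..<N] q \<noteq> 0 \<and>
      Lap_diag n lam [Suc k..<N] q \<in> odd_span n N N"
    using Suc.hyps(2) k red(2) by (intro Suc.hyps(1)) auto
  have "even (lam t)" if "t \<in> {k..<N}" for t
    using IH red(1) that by (cases "t = k") auto
  moreover have "Lap_diag n lam [k..<N] p = Lap_diag n lam [Suc k..<N] q"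
    using k by (simp add: upt_conv_Cons q_def)
  ultimately show ?case using IH by simp
qed

section \<open>Weight gradings\<close>

definition wdeg :: "nat \<Rightarrow> (nat \<Rightarrow> nat \<Rightarrow> int) \<Rightarrow> index smonom \<Rightarrow> int" where
  "wdeg m w u = (\<Sum>i\<in>#fst u. case i of Index a t \<Rightarrow> w a t) +
     (\<Sum>i\<in>fset (snd u). case i of Index a t \<Rightarrow> w (m + a) t)"

definition proj :: "nat \<Rightarrow> (nat \<Rightarrow> nat \<Rightarrow> int) \<Rightarrow> int \<Rightarrow> index superpoly \<Rightarrow> index superpoly" where
  "proj m w d = lin_ext (\<lambda>u. if wdeg m w u = d then smon u else 0)"

lemma proj_add: "proj m w d (p + q) = proj m w d p + proj m w d q"
  and proj_scale: "proj m w d (scale c p) = scale c (proj m w d p)"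
  and proj_zero [simp]: "proj m w d 0 = 0"
  and proj_smon: "proj m w d (smon u) = (if wdeg m w u = d then smon u else 0)"
  by (simp_all add: proj_def lin_ext_add lin_ext_scale)

lemma proj_sum: "proj m w d (sum f S) = (\<Sum>x\<in>S. proj m w d (f x))"
  by (induction S rule: infinite_finite_induct) (simp_all add: proj_add)

lemma scoeff_proj: "scoeff (proj m w d p) u = (if wdeg m w u = d then scoeff p u else 0)"
  by (induction p rule: superpoly_induct) (auto simp: proj_add proj_scale proj_smon)

lemma proj_Xgen: "proj m w d (Xgen m a t * p) = Xgen m a t * proj m w (d - w a t) p"
proof (induction p rule: superpoly_induct)
  case (smon u)
  show ?case
  proof (cases "a < m")
    case True
    have "wdeg m w (add_mset (Index a t) (fst u), snd u) = w a t + wdeg m w u" by (simp add: wdeg_def)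
    then show ?thesis using True
      by (auto simp: Xgen_def even_gen_def mon_mult_mon mon_mult_def proj_smon)
  next
    case False
    have "wdeg m w (fst u, finsert (Index (a - m) t) (snd u)) = w a t + wdeg m w u"
      if "Index (a - m) t |\<notin>| snd u" using that False by (simp add: wdeg_def)
    then show ?thesis using False
      by (auto simp: Xgen_def odd_gen_def mon_mult_mon mon_mult_def proj_smon proj_scale)
  qed
qed (simp_all add: proj_add proj_scale distrib_left scale_mult)

lemma proj_dXgen: "proj m w d (dXgen m a t p) = dXgen m a t (proj m w (d + w a t) p)"
proof (rule superpoly_eqI)
  fix u
  show "scoeff (proj m w d (dXgen m a t p)) u = scoeff (dXgen m a t (proj m w (d + w a t) p)) u"
  proof (cases "a < m")
    case True
    have "wdeg m w (add_mset (Index a t) (fst u), snd u) = w a t + wdeg m w u" by (simp add: wdeg_def)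
    then show ?thesis using True by (simp add: scoeff_proj dXgen_def scoeff_deriv_even)
  next
    case False
    have "wdeg m w (fst u, finsert (Index (a - m) t) (snd u)) = w a t + wdeg m w u"
      if "Index (a - m) t |\<notin>| snd u" using that False by (simp add: wdeg_def)
    then show ?thesis using False by (auto simp: scoeff_proj dXgen_def scoeff_deriv_odd)
  qed
qed

lemma proj_X_dX: "proj m w d (Xgen m a s * dXgen m b t p) = Xgen m a s * dXgen m b t (proj m w (d - w a s + w b t) p)"
  by (simp add: proj_Xgen proj_dXgen)

lemma even_gen_mult_cancel:
  assumes "even_gen i * p = 0"
  shows "p = 0"
proof (rule superpoly_eqI)
  fix u
  have "scoeff (even_gen i * q) (add_mset i (fst u), snd u) = scoeff q u" for q
    by (induction q rule: superpoly_induct)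
      (auto simp: distrib_left scale_mult even_gen_def mon_mult_mon mon_mult_def prod_eq_iff)
  from this[of p] show "scoeff p u = scoeff 0 u" using assms by simp
qed

text \<open>In characteristic 0 distinct monomials containing a generator have independent
  derivatives by it, so a vanishing derivative excludes the generator from the support.\<close>

lemma dXgen_zero_imp:
  assumes "dXgen m a t p = 0" "scoeff p u \<noteq> 0"
  shows "if a < m then Index a t \<notin># fst u else Index (a - m) t |\<notin>| snd u"
proof (cases "a < m")
  case True
  show ?thesis
  proof (rule ccontr)
    assume "\<not> ?thesis"
    then have "Index a t \<in># fst u" using True by simp
    then have "(add_mset (Index a t) (fst u - {#Index a t#}), snd u) = u" by simp
    then show False
      using assms True scoeff_deriv_even[of "Index a t" p "(fst u - {#Index a t#}, snd u)"]
      by (simp add: dXgen_def del: of_nat_Suc)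
  qed
next
  case False
  show ?thesis
  proof (rule ccontr)
    let ?i = "Index (a - m) t"
    assume "\<not> ?thesis"
    then have "?i |\<in>| snd u" using False by simp
    then have "(fst u, finsert ?i (snd u |-| {|?i|})) = u" by (auto simp: prod_eq_iff)
    then show False
      using assms False scoeff_deriv_odd[of ?i p "(fst u, snd u |-| {|?i|})"]
      by (simp add: dXgen_def)
  qed
qed

section \<open>The slice\<close>

text \<open>
  With \<open>K = min m N\<close>, the slice consists of the matrices whose only nonzero entries are the diagonal
  ones \<open>(t, t)\<close>, \<open>t < K\<close>, and those in rows and columns \<open>\<ge> K\<close>; \<open>off_slice\<close> is the indicator of the
  remaining entries.
\<close>

definition off_slice :: "nat \<Rightarrow> nat \<Rightarrow> nat \<Rightarrow> int" where
  "off_slice K a t = (if (t < K \<or> a < K) \<and> a \<noteq> t then 1 else 0)"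

lemma wdeg_nonneg: "wdeg m (off_slice K) u \<ge> 0"
proof -
  have "(\<Sum>i\<in>#M. case i of Index a t \<Rightarrow> off_slice K a t) \<ge> 0" for M
    by (induction M) (auto simp: off_slice_def split: index.split)
  moreover have "(\<Sum>i\<in>S. case i of Index a t \<Rightarrow> off_slice K (m + a) t) \<ge> 0" for S
    by (intro sum_nonneg) (auto simp: off_slice_def split: index.split)
  ultimately show ?thesis unfolding wdeg_def by (intro add_nonneg_nonneg)
qed

text \<open>
  The component \<open>g\<close> of \<open>f\<close> of lowest degree in the off-slice generators is killed by the parts of
  the operators that lower this degree. These parts are triangular with the regular elements
  \<open>Xgen m i i\<close> on the diagonal, so all off-slice derivatives of \<open>g\<close> vanish.
\<close>

theorem slice_nonzero:
  assumes f: "f \<in> sym_superalg m n N" "f \<noteq> 0" and K: "K \<le> m" "K \<le> N"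
    and raise: "\<And>i j. j < N \<Longrightarrow> i < j \<Longrightarrow> E_gl m n i j f = 0"
    and osp: "\<And>i a. i < K \<Longrightarrow> a < m + 2 * n \<Longrightarrow> \<exists>s. unit_act m N i a f = scale s (unit_act m N (star m n a) i f)"
  shows "proj m (off_slice K) 0 f \<noteq> 0"
proof
  let ?w = "off_slice K" and ?M = "m + 2 * n"
  assume zero: "proj m ?w 0 f = 0"
  have "\<exists>u. scoeff f u \<noteq> 0" by (rule superpoly_nonzero_coeff[OF f(2)])
  then obtain u where u: "scoeff f u \<noteq> 0" and least: "\<And>v. scoeff f v \<noteq> 0 \<Longrightarrow> nat (wdeg m ?w u) \<le> nat (wdeg m ?w v)"
    using ex_has_least_nat[of "\<lambda>u. scoeff f u \<noteq> 0" _ "\<lambda>u. nat (wdeg m ?w u)"] by blast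
  define d where "d = wdeg m ?w u"
  have low: "proj m ?w e f = 0" if "e < d" for e
  proof (rule superpoly_eqI)
    fix v
    show "scoeff (proj m ?w e f) v = scoeff 0 v"
      using least[of v] that wdeg_nonneg[of m K v] wdeg_nonneg[of m K u]
      by (cases "scoeff f v = 0") (auto simp: scoeff_proj d_def)
  qed
  define g where "g = proj m ?w d f"
  have d1: "d \<ge> 1"
    using zero u wdeg_nonneg[of m K u] scoeff_proj[of m ?w 0 f u] by (auto simp: d_def split: if_splits)
  \<comment> \<open>In degree \<open>d - 1\<close> only those terms survive that multiply by a slice
    coordinate and differentiate by an off-slice one, and they see nothing of \<open>f\<close> but
    its lowest component \<open>g\<close>.\<close>
  have part: "proj m ?w (d - 1) (Xgen m a s * dXgen m b t f) =
      (if ?w a s = 0 \<and> ?w b t = 1 then Xgen m a s * dXgen m b t g else 0)" for a b s t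
    unfolding proj_X_dX using low by (auto simp: off_slice_def g_def)
  have cancel: "p = 0" if "Xgen m i i * p = 0" "i < K" for i p
    using that K even_gen_mult_cancel by (auto simp: Xgen_def)
  \<comment> \<open>In column \<open>i\<close> the only slice coordinate is the diagonal one, so a
    single term of the raising operator is left.\<close>
  have claim1: "dXgen m i j g = 0" if ij: "i < j" "i < K" "j < N" for i j
  proof -
    have "0 = proj m ?w (d - 1) (E_gl m n i j f)" using raise ij by simp
    also have "\<dots> = (\<Sum>a<?M. if a = i then Xgen m i i * dXgen m i j g else 0)"
      unfolding E_gl_def proj_sum part using ij by (intro sum.cong) (auto simp: off_slice_def)
    also have "\<dots> = Xgen m i i * dXgen m i j g" using ij K by simp
    finally show ?thesis using cancel ij by metis
  qed
  have claim2: "dXgen m a i g = 0" if ia: "i < K" "i < a" "a < ?M" for i a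
  proof -
    obtain s where s: "unit_act m N i a f = scale s (unit_act m N (star m n a) i f)" using osp ia by blast
    have "proj m ?w (d - 1) (unit_act m N i a f) = (\<Sum>t<N. if t = i then Xgen m i i * dXgen m a i g else 0)"
      unfolding unit_act_def proj_sum part using ia by (intro sum.cong) (auto simp: off_slice_def)
    also have "\<dots> = Xgen m i i * dXgen m a i g" using ia K by simp
    finally have 1: "proj m ?w (d - 1) (unit_act m N i a f) = Xgen m i i * dXgen m a i g" .
    have "proj m ?w (d - 1) (unit_act m N (star m n a) i f) = 0"
      unfolding unit_act_def proj_sum part
    proof (intro sum.neutral ballI)
      \<comment> \<open>For \<open>t > i\<close> the derivative is covered by \<open>claim1\<close>.
        For \<open>t < i\<close> the coordinate in row \<open>star m n a\<close> could be on the
        slice only if \<open>a = t\<close>, which contradicts \<open>i < a\<close>.\<close>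
      fix t assume t: "t \<in> {..<N}"
      have "dXgen m i t g = 0" if w: "?w (star m n a) t = 0" "?w i t = 1"
      proof (cases "i < t")
        case True
        then show ?thesis using claim1 t ia by simp
      next
        case False
        then have "t < i" using w by (auto simp: off_slice_def split: if_splits)
        then have "star m n a = t" using w(1) ia by (auto simp: off_slice_def split: if_splits)
        then have "star m n a = a" using \<open>t < i\<close> ia K star_ge[of m n a] by (auto simp: star_def)
        then show ?thesis using \<open>star m n a = t\<close> \<open>t < i\<close> ia by simp
      qed
      then show "(if ?w (star m n a) t = 0 \<and> ?w i t = 1 then Xgen m (star m n a) t * dXgen m i t g else 0) = 0"
        by simp
    qed
    then have "Xgen m i i * dXgen m a i g = 0" using 1 s by (simp add: proj_scale)
    then show ?thesis using cancel ia by blast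
  qed
  have claim: "dXgen m a t g = 0" if "a < ?M" "t < N" "?w a t = 1" for a t
    using that claim1[of a t] claim2[of t a] by (auto simp: off_slice_def split: if_splits) (meson linorder_neqE_nat order.strict_trans)+
  have gu: "scoeff g u \<noteq> 0" using u by (simp add: g_def scoeff_proj d_def)
  \<comment> \<open>All off-slice derivatives of \<open>g\<close> vanish, so its monomials lie on
    the slice, contrary to \<open>d \<ge> 1\<close>.\<close>
  have "wdeg m ?w u = 0"
  proof -
    have 1: "set_mset (fst u) \<subseteq> {Index a t |a t. a < m \<and> t < N}" "fset (snd u) \<subseteq> {Index a t |a t. a < 2 * n \<and> t < N}"
      using f(1) u mono_spanD unfolding sym_superalg_eq by blast+
    have "?w a t = 0" if "Index a t \<in># fst u" for a t
    proof (rule ccontr)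
      assume "?w a t \<noteq> 0"
      moreover have "a < m" "t < N" using 1(1) that by auto
      ultimately show False using claim[of a t] dXgen_zero_imp[OF _ gu, of m a t] that
        by (auto simp: off_slice_def split: if_splits)
    qed
    moreover have "?w (m + a) t = 0" if "Index a t |\<in>| snd u" for a t
    proof (rule ccontr)
      assume "?w (m + a) t \<noteq> 0"
      moreover have "a < 2 * n" "t < N" using 1(2) that by auto
      ultimately show False using claim[of "m + a" t] dXgen_zero_imp[OF _ gu, of m "m + a" t] that
        by (auto simp: off_slice_def split: if_splits)
    qed
    ultimately show ?thesis
    proof -
      have "(\<Sum>i\<in>#fst u. case i of Index a t \<Rightarrow> ?w a t) = 0"
        by (rule sum_mset.neutral) (use \<open>\<And>a t. Index a t \<in># fst u \<Longrightarrow> ?w a t = 0\<close> in \<open>auto split: index.split\<close>)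
      moreover have "(\<Sum>i\<in>fset (snd u). case i of Index a t \<Rightarrow> ?w (m + a) t) = 0"
        by (rule sum.neutral) (use \<open>\<And>a t. Index a t |\<in>| snd u \<Longrightarrow> ?w (m + a) t = 0\<close> in \<open>auto split: index.split\<close>)
      ultimately show ?thesis by (simp add: wdeg_def)
    qed
  qed
  then show False using d1 by (simp add: d_def)
qed

text \<open>Up to a sign, \<open>osp(V)\<close> pairs the matrix unit at \<open>(a, b)\<close> with
  the one at \<open>(star m n b, star m n a)\<close>. The sign \<open>s\<close> solves the matrix
  condition, and \<open>Y\<close> is the resulting element of the algebra.\<close>

lemma osp_unit_relation:
  assumes f: "f \<in> osp_invariants m n N" and ab: "a < m + 2 * n" "b < m + 2 * n"
  defines "s \<equiv> (-1) ^ ((parity_idx m a + parity_idx m b) mod 2 * parity_idx m b) *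
      (eps m a a * kv m n a) * (eps m b b * kv m n b)"
  shows "unit_act m N a b f = scale s (unit_act m N (star m n b) (star m n a) f)"
proof -
  let ?M = "m + 2 * n" and ?a = "star m n a" and ?b = "star m n b"
  define p where "p = (parity_idx m a + parity_idx m b) mod 2"
  define Y where "Y = mat ?M ?M (\<lambda>(r, c). of_bool (r = a \<and> c = b) - s * of_bool (r = ?b \<and> c = ?a))"
  have st: "?a < ?M" "?b < ?M" "star m n ?a = a" "star m n ?b = b"
    using ab by (simp_all add: star_less star_star)
  have eq: "star m n c = d \<longleftrightarrow> c = star m n d" if "c < ?M" "d < ?M" for c d
    using star_star[OF that(1)] star_star[OF that(2)] by auto
  have p01: "p \<in> {0, 1}" by (auto simp: p_def)
  \<comment> \<open>The two instances of the matrix condition in which an entry of \<open>Y\<close>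
    is involved.\<close>
  have k1: "eps m a a * kv m n a = (-1) ^ (p * parity_idx m b) * (eps m b b * kv m n b) * s"
    and k2: "s * kv m n b = (-1) ^ (p * parity_idx m a) * kv m n a"
    by (auto simp: s_def p_def parity_idx_def eps_def)
  have "Y \<in> gl_homog m n p"
    using ab st by (auto simp: gl_homog_def Y_def p_def parity_star add.commute of_bool_def split: if_splits)
  moreover have "Y $$ (star m n d, c) * (eps m d d * kv m n (star m n d)) +
      (-1) ^ (p * parity_idx m c) * (eps m c c * kv m n c) * Y $$ (star m n c, d) = 0"
    if cd: "c < ?M" "d < ?M" for c d
  proof -
    have Yd: "Y $$ (star m n d, c) = of_bool (d = ?a \<and> c = b) - s * of_bool (d = b \<and> c = ?a)"
      using cd st ab eq[of d a] eq[of d ?b] star_less[OF cd(2)] by (simp add: Y_def)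
    have Yc: "Y $$ (star m n c, d) = of_bool (c = ?a \<and> d = b) - s * of_bool (c = b \<and> d = ?a)"
      using cd st ab eq[of c a] eq[of c ?b] star_less[OF cd(1)] by (simp add: Y_def)
    have x: "of_bool (d = ?a \<and> c = b) * (eps m d d * kv m n (star m n d)) =
        (-1) ^ (p * parity_idx m c) * (eps m c c * kv m n c) * (s * of_bool (c = b \<and> d = ?a))"
      using k1 st(3) by (auto simp: eps_star mult_ac)
    have "eps m b b * kv m n ?b = kv m n b" "eps m ?a ?a * kv m n ?a = kv m n a"
      using kv_star[OF ab(1)] kv_star[OF ab(2)] by (simp_all add: eps_star mult.assoc[symmetric])
    then have y: "s * of_bool (d = b \<and> c = ?a) * (eps m d d * kv m n (star m n d)) =
        (-1) ^ (p * parity_idx m c) * (eps m c c * kv m n c) * of_bool (c = ?a \<and> d = b)"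
      using k2 by (auto simp: parity_star mult_ac)
    show ?thesis unfolding Yd Yc using x y by (simp add: algebra_simps)
  qed
  ultimately have "Y \<in> osp_homog m n p" by (simp add: osp_homog_iff)
  then have 0: "osp_act m n N Y f = 0" using osp_invariantsD(2)[OF f p01] by blast
  have "osp_act m n N Y f = (\<Sum>c<?M. \<Sum>d<?M. (if d = a then if c = b then unit_act m N d c f else 0 else 0) -
      (if d = ?b then if c = ?a then scale s (unit_act m N d c f) else 0 else 0))"
    unfolding osp_act_eq
    by (intro sum.cong refl) (auto simp: Y_def superpoly.scale_left_diff_distrib)
  also have "\<dots> = unit_act m N a b f - scale s (unit_act m N ?b ?a f)"
    using ab st by (simp add: sum_subtractf)
  finally show ?thesis using 0 by simp
qed

lemma unit_act_shift: "unit_act m N (m + a) (m + b) p = unit_act 0 N a b p"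
  by (simp add: unit_act_def Xgen_def dXgen_def)

text \<open>For odd rows, which come after row \<open>K\<close>, the off-slice degree of a generator
  depends only on its column. Operators between odd rows therefore commute with the projection to
  the slice.\<close>

lemma odd_sp_proj:
  assumes f: "f \<in> osp_invariants m n N" and K: "K \<le> m"
  shows "odd_sp n N (proj m (off_slice K) 0 f)"
  unfolding odd_sp_def
proof (intro allI impI)
  fix a b assume ab: "a < 2 * n" "b < 2 * n"
  let ?P = "proj m (off_slice K) 0"
  have P: "unit_act 0 N c d (?P f) = ?P (unit_act m N (m + c) (m + d) f)" for c d
    unfolding unit_act_shift[of m, symmetric] unfolding unit_act_def proj_sum proj_X_dX
    using K by (intro sum.cong) (auto simp: off_slice_def)
  have st: "star m n (m + c) = m + star 0 n c" "kv m n (m + c) = kv 0 n c" "eps m (m + c) (m + c) = - 1" "parity_idx m (m + c) = 1" for c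
    by (auto simp: star_def kv_def eps_def parity_idx_def)
  have "unit_act m N (m + a) (m + b) f = scale (kv 0 n a * kv 0 n b) (unit_act m N (m + star 0 n b) (m + star 0 n a) f)"
    using osp_unit_relation[OF f, of "m + a" "m + b"] ab by (simp add: st)
  then show "unit_act 0 N a b (?P f) = scale (kv 0 n a * kv 0 n b) (unit_act 0 N (star 0 n b) (star 0 n a) (?P f))"
    by (simp add: P proj_scale)
qed

section \<open>Reflections\<close>

definition reflection :: "nat \<Rightarrow> nat \<Rightarrow> complex mat" where
  "reflection m c = mat m m (\<lambda>(i, j). if i = j then if i = c then - 1 else 1 else 0)"

lemma reflection_O_group: "reflection m c \<in> O_group m"
proof -
  have "transpose_mat (reflection m c) * reflection m c = 1\<^sub>m m"
  proof (rule eq_matI)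
    fix i j assume "i < dim_row (1\<^sub>m m :: complex mat)" "j < dim_col (1\<^sub>m m :: complex mat)"
    then have ij: "i < m" "j < m" by simp_all
    have "(transpose_mat (reflection m c) * reflection m c) $$ (i, j) =
        (\<Sum>k\<in>{0..<m}. reflection m c $$ (k, i) * reflection m c $$ (k, j))"
      using ij by (simp add: scalar_prod_def reflection_def)
    also have "\<dots> = (\<Sum>k\<in>{0..<m}. if k = i then (if i = j then 1 else 0) else 0)"
      using ij by (intro sum.cong) (auto simp: reflection_def)
    finally show "(transpose_mat (reflection m c) * reflection m c) $$ (i, j) = 1\<^sub>m m $$ (i, j)"
      using ij by simp
  qed (simp_all add: reflection_def)
  then show ?thesis by (simp add: O_group_def reflection_def)
qed

lemma one_Sp_group: "1\<^sub>m (2 * n) \<in> Sp_group n"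
  using eta_carrier[of n] by (simp add: Sp_group_def)

definition row_degree :: "nat \<Rightarrow> index smonom \<Rightarrow> nat" where
  "row_degree c u = (\<Sum>i\<in>#fst u. case i of Index a t \<Rightarrow> of_bool (a = c))"

definition row_sign :: "nat \<Rightarrow> index superpoly \<Rightarrow> index superpoly" where
  "row_sign c = lin_ext (\<lambda>u. scale ((-1) ^ row_degree c u) (smon u))"

lemma row_sign_simps: "row_sign c (p + q) = row_sign c p + row_sign c q"
  "row_sign c (scale x p) = scale x (row_sign c p)" "row_sign c 0 = 0"
  "row_sign c (smon u) = scale ((-1) ^ row_degree c u) (smon u)"
  by (simp_all add: row_sign_def lin_ext_add lin_ext_scale)

lemma scoeff_row_sign: "scoeff (row_sign c p) u = (-1) ^ row_degree c u * scoeff p u"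
  by (induction p rule: superpoly_induct) (auto simp: row_sign_simps algebra_simps)

lemma row_sign_Xgen: "row_sign c (Xgen m a t * p) = scale (if a < m \<and> a = c then - 1 else 1) (Xgen m a t * row_sign c p)"
proof (induction p rule: superpoly_induct)
  case (smon u)
  show ?case
    by (auto simp: Xgen_def even_gen_def odd_gen_def mon_mult_mon mon_mult_def row_sign_simps row_degree_def scale_mult mult.commute)
next
  case (scale x p)
  then show ?case by (simp add: row_sign_simps scale_mult mult.commute)
qed (simp_all add: row_sign_simps distrib_left superpoly.scale_right_distrib del: superpoly.scale_minus_left)

lemma group_act_reflection:
  assumes "p \<in> sym_superalg m n N"
  shows "group_act m n (reflection m c) (1\<^sub>m (2 * n)) p = row_sign c p"
  using assms
proof (induction p rule: sym_induct)
  case one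
  show ?case unfolding group_act_one by (simp add: one_superpoly_def row_sign_simps row_degree_def)
next
  case (gen a t p)
  have "group_act m n (reflection m c) (1\<^sub>m (2 * n)) (Xgen m a t) = scale (if a < m \<and> a = c then - 1 else 1) (Xgen m a t)"
  proof (cases "a < m")
    case True
    have "(\<Sum>b<m. scale (reflection m c $$ (b, a)) (Xgen m b t)) =
        (\<Sum>b<m. if b = a then scale (if a = c then - 1 else 1) (Xgen m a t) else 0)"
      using True by (intro sum.cong) (auto simp: reflection_def)
    then show ?thesis using True by (simp add: group_act_Xgen)
  next
    case False
    have "(\<Sum>b<2 * n. scale (1\<^sub>m (2 * n) $$ (b, a - m)) (Xgen m (m + b) t)) =
        (\<Sum>b<2 * n. if b = a - m then Xgen m a t else 0)"
      using False gen by (intro sum.cong) auto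
    then show ?thesis using False gen by (auto simp: group_act_Xgen)
  qed
  then show ?case using gen by (simp add: group_act_mult row_sign_Xgen scale_mult)
qed (simp_all add: group_act_add group_act_scale row_sign_simps)

text \<open>Changing the sign of one even basis vector is an orthogonal transformation and
  multiplies a monomial by the sign of its degree in that row.\<close>

lemma invariant_row_degree:
  assumes f: "f \<in> osp_invariants m n N" and "scoeff f u \<noteq> 0"
  shows "even (row_degree c u)"
proof (rule ccontr)
  assume "odd (row_degree c u)"
  moreover have "row_sign c f = f"
    using group_act_reflection[OF osp_invariantsD(1)[OF f], of c]
      osp_invariantsD(5)[OF f reflection_O_group one_Sp_group, of c] by simp
  then have "scoeff f u = (-1) ^ row_degree c u * scoeff f u" by (metis scoeff_row_sign)
  ultimately show False using assms(2) by simp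
qed

section \<open>Uniqueness of invariant highest weight vectors\<close>

definition diag_monom :: "nat \<Rightarrow> (nat \<Rightarrow> nat) \<Rightarrow> index multiset" where
  "diag_monom K lam = (\<Sum>t<K. replicate_mset (lam t) (Index t t))"

lemma count_diag_monom: "count (diag_monom K lam) (Index a t) = (if a = t \<and> t < K then lam t else 0)"
proof -
  have "count (diag_monom K lam) (Index a t) = (\<Sum>s<K. if s = t then (if a = t then lam t else 0) else 0)"
    unfolding diag_monom_def count_sum by (intro sum.cong) auto
  then show ?thesis by simp
qed

text \<open>On an invariant highest weight vector of weight \<open>lam\<close>, restriction to the
  slice followed by stripping the columns leaves a multiple of one monomial; this is the multiple.
  As it is linear, its nonvanishing on all such vectors bounds the multiplicity by one.\<close>

definition hw_functional :: "nat \<Rightarrow> nat \<Rightarrow> nat \<Rightarrow> (nat \<Rightarrow> nat) \<Rightarrow> index superpoly \<Rightarrow> complex" where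
  "hw_functional m n N lam f = (let K = min m N in
     scoeff (Lap_diag n lam [K..<N] (proj m (off_slice K) 0 f)) (diag_monom K lam, {||}))"

lemma hw_functional_diff_scale: "hw_functional m n N lam (f - scale c g) = hw_functional m n N lam f - c * hw_functional m n N lam g"
proof -
  have "f - scale c g = f + scale (- c) g" by (simp add: superpoly.scale_minus_left)
  then show ?thesis
    by (simp only: hw_functional_def Let_def proj_add proj_scale Lap_diag_add Lap_diag_scale scoeff_simps) simp
qed

text \<open>Laplacians for \<open>m = 0\<close> do not touch even generators, so the diagonal
  monomial in front stays fixed while the odd part is reduced.\<close>

definition even_part_eq :: "index multiset \<Rightarrow> index superpoly set" where
  "even_part_eq \<mu> = {p. \<forall>u. scoeff p u \<noteq> 0 \<longrightarrow> fst u = \<mu>}"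

lemma even_part_eq_closed: "p \<in> even_part_eq \<mu> \<Longrightarrow> scale c p \<in> even_part_eq \<mu>"
  "p \<in> even_part_eq \<mu> \<Longrightarrow> dXgen 0 b t p \<in> even_part_eq \<mu>"
  "(\<And>x. x \<in> S \<Longrightarrow> F x \<in> even_part_eq \<mu>) \<Longrightarrow> sum F S \<in> even_part_eq \<mu>"
proof -
  show "sum F S \<in> even_part_eq \<mu>" if "\<And>x. x \<in> S \<Longrightarrow> F x \<in> even_part_eq \<mu>"
  proof -
    have "\<exists>x\<in>S. scoeff (F x) u \<noteq> 0" if "scoeff (sum F S) u \<noteq> 0" for u
      using that unfolding scoeff_sum by (meson sum.neutral)
    then show ?thesis using that by (fastforce simp: even_part_eq_def)
  qed
qed (auto simp: even_part_eq_def dXgen_def scoeff_deriv_odd split: if_splits)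

lemma even_part_eq_Lap_diag: "p \<in> even_part_eq \<mu> \<Longrightarrow> Lap_diag n lam ts p \<in> even_part_eq \<mu>"
proof (induction ts arbitrary: p)
  case (Cons t ts)
  have L: "Lap 0 n t t q \<in> even_part_eq \<mu>" if "q \<in> even_part_eq \<mu>" for q
    unfolding Lap_def using that by (intro even_part_eq_closed)
  have "(Lap 0 n t t ^^ c) p \<in> even_part_eq \<mu>" for c
    by (induction c) (simp_all add: L Cons.prems)
  then show ?case using Cons.IH by simp
qed simp

lemma sum_mset_nonneg_eq_0:
  fixes f :: "'a \<Rightarrow> int"
  assumes "\<And>x. f x \<ge> 0" "(\<Sum>x\<in>#M. f x) = 0" "x \<in># M"
  shows "f x = 0"
proof -
  have nn: "(\<Sum>x\<in>#M. f x) \<ge> 0" for M by (induction M) (auto simp: assms(1))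
  obtain M' where "M = add_mset x M'" using assms(3) by (metis insert_DiffM)
  then show ?thesis using assms(1)[of x] assms(2) nn[of M'] by simp
qed

lemma slice_monomial:
  assumes f: "f \<in> sym_superalg m n N" and K: "K = min m N" and u: "scoeff (proj m (off_slice K) 0 f) u \<noteq> 0"
  shows "set_mset (fst u) \<subseteq> {Index t t | t. t < K}" "fset (snd u) \<subseteq> {Index b t | b t. b < 2 * n \<and> K \<le> t \<and> t < N}"
proof -
  let ?e = "case_index (off_slice K)" and ?o = "case_index (\<lambda>a. off_slice K (m + a))"
  have nz: "scoeff f u \<noteq> 0" and wd: "wdeg m (off_slice K) u = 0"
    using u by (auto simp: scoeff_proj split: if_splits)
  have sub: "set_mset (fst u) \<subseteq> {Index a t | a t. a < m \<and> t < N}" "fset (snd u) \<subseteq> {Index a t | a t. a < 2 * n \<and> t < N}"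
    using mono_spanD[OF f[unfolded sym_superalg_eq] nz] by blast+
  have nn: "?e i \<ge> 0" "?o i \<ge> 0" for i by (auto simp: off_slice_def split: index.split)
  have "(\<Sum>i\<in>#M. ?e i) \<ge> 0" for M by (induction M) (auto simp: nn)
  moreover have "(\<Sum>i\<in>fset (snd u). ?o i) \<ge> 0" by (intro sum_nonneg nn)
  ultimately have e0: "(\<Sum>i\<in>#fst u. ?e i) = 0" and o0: "(\<Sum>i\<in>fset (snd u). ?o i) = 0"
    using wd unfolding wdeg_def by (smt (verit, best))+
  show "set_mset (fst u) \<subseteq> {Index t t | t. t < K}"
  proof
    fix i assume i: "i \<in># fst u"
    then obtain a t where at: "i = Index a t" "a < m" "t < N" using sub(1) by auto
    have "off_slice K a t = 0" using sum_mset_nonneg_eq_0[OF nn(1) e0 i] at by simp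
    then show "i \<in> {Index t t | t. t < K}" using at K by (auto simp: off_slice_def split: if_splits)
  qed
  show "fset (snd u) \<subseteq> {Index b t | b t. b < 2 * n \<and> K \<le> t \<and> t < N}"
  proof
    fix i assume i: "i \<in> fset (snd u)"
    then obtain b t where bt: "i = Index b t" "b < 2 * n" "t < N" using sub(2) by auto
    have "off_slice K (m + b) t = 0"
      using o0 i nn(2) bt by (subst (asm) sum_nonneg_eq_0_iff) auto
    then show "i \<in> {Index b t | b t. b < 2 * n \<and> K \<le> t \<and> t < N}" using bt K by (auto simp: off_slice_def split: if_splits)
  qed
qed

text \<open>On the slice each column \<open>t < K\<close> has only its diagonal generator, so its
  exponent is \<open>lam t\<close>, which is even by reflections; all monomials share this even
  part. The later columns are purely odd and fall under the exterior algebra result. If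
  \<open>m < N\<close>, column \<open>m\<close> of the slice holds just \<open>2 * n\<close> odd
  generators, which bounds \<open>lam m\<close>.\<close>

theorem invariant_highest_weight:
  assumes f: "f \<in> osp_invariants m n N" and hw: "highest_weight_vector m n N lam f"
  shows "t < N \<Longrightarrow> even (lam t)" "m < N \<Longrightarrow> lam m \<le> 2 * n" "hw_functional m n N lam f \<noteq> 0"
proof -
  define K where "K = min m N"
  define g where "g = proj m (off_slice K) 0 f"
  have fs: "f \<in> sym_superalg m n N" using osp_invariantsD(1)[OF f] .
  have K: "K \<le> m" "K \<le> N" by (auto simp: K_def)
  have raise: "E_gl m n i j f = 0" if "j < N" "i < j" for i j
    using hw that by (simp add: highest_weight_vector_def)
  have diag: "E_gl m n i i f = scale (of_nat (lam i)) f" if "i < N" for i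
    using hw that by (simp add: highest_weight_vector_def)
  have "g \<noteq> 0"
    unfolding g_def
  proof (rule slice_nonzero[OF fs _ K raise])
    show "f \<noteq> 0" using hw by (simp add: highest_weight_vector_def)
    fix i a assume "i < K" "a < m + 2 * n"
    moreover from this have "star m n i = i" using K by (simp add: star_def)
    ultimately show "\<exists>s. unit_act m N i a f = scale s (unit_act m N (star m n a) i f)"
      using osp_unit_relation[OF f, of i a] K by (metis trans_less_add1 order.strict_trans2)
  qed
  note mon = slice_monomial[OF fs K_def, folded g_def]
  have wt_u: "wt m n t u = lam t" if "scoeff g u \<noteq> 0" "t < N" for t u
  proof -
    have "scoeff f u \<noteq> 0" using that(1) by (auto simp: g_def scoeff_proj split: if_splits)
    then show ?thesis using E_gl_diag_eigen[OF diag[OF that(2)]] by (metis of_nat_eq_iff)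
  qed
  have cnt: "count (fst u) (Index t t) = lam t" if "scoeff g u \<noteq> 0" "t < K" for t u
  proof -
    have "count (fst u) (Index a t) = 0" if "a \<noteq> t" for a
      using mon(1)[OF \<open>scoeff g u \<noteq> 0\<close>] that by (auto simp: count_eq_zero_iff)
    then have "(\<Sum>a<m. count (fst u) (Index a t)) = (\<Sum>a<m. if a = t then count (fst u) (Index t t) else 0)"
      by (intro sum.cong) auto
    moreover have none: "{b. b < 2 * n \<and> Index b t |\<in>| snd u} = {}"
      using mon(2)[OF \<open>scoeff g u \<noteq> 0\<close>] that by auto
    have "wt m n t u = lam t" using wt_u[OF that(1), of t] that K by simp
    ultimately show ?thesis using that K unfolding wt_def none card.empty by simp
  qed
  have g_even: "g \<in> even_part_eq (diag_monom K lam)"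
    unfolding even_part_eq_def
  proof (intro CollectI allI impI multiset_eqI)
    fix u i assume u: "scoeff g u \<noteq> 0"
    obtain a t where i: "i = Index a t" by (cases i)
    show "count (fst u) i = count (diag_monom K lam) i"
      using cnt[OF u, of t] mon(1)[OF u] by (auto simp: i count_diag_monom count_eq_zero_iff)
  qed
  have g_span: "g \<in> odd_span n K N"
    unfolding odd_span_def by (rule mono_spanI) (use mon(2) in auto)
  have g_sp: "odd_sp n N g" unfolding g_def by (rule odd_sp_proj[OF f K(1)])
  have E_eq: "E_gl 0 n i j g = proj m (off_slice K) 0 (E_gl m n i j f)" if ij: "i \<in> {K..<N}" "j \<in> {K..<N}" for i j
  proof -
    \<comment> \<open>The range is nonempty, so \<open>m < N\<close>, and every slice coordinate in
      these columns lies in an odd row.\<close>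
    have Km: "K = m" using ij by (auto simp: K_def)
    have "proj m (off_slice K) 0 (E_gl m n i j f) = E_gl m n i j g"
      unfolding E_gl_def proj_sum proj_X_dX g_def using ij by (intro sum.cong) (auto simp: off_slice_def)
    \<comment> \<open>The even rows of column \<open>j\<close> are off the slice; differentiating by
      such a coordinate leads to a component of negative degree, which is 0.\<close>
    also have "dXgen m a j g = 0" if "a < m" for a
    proof (rule superpoly_eqI)
      fix u
      have "proj m (off_slice K) (-1) p = 0" for p
      proof (rule superpoly_eqI)
        fix v
        show "scoeff (proj m (off_slice K) (-1) p) v = scoeff 0 v"
          using wdeg_nonneg[of m K v] by (auto simp: scoeff_proj)
      qed
      moreover have "off_slice K a j = 1" using that ij Km by (auto simp: off_slice_def)
      ultimately show "scoeff (dXgen m a j g) u = scoeff 0 u"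
        using proj_dXgen[of m "off_slice K" "-1" a j f] by (simp add: g_def)
    qed
    then have "E_gl m n i j g = E_gl 0 n i j g"
      by (simp add: E_gl_def sum_split_parity) (simp add: Xgen_def dXgen_def)
    finally show ?thesis by simp
  qed
  have red: "(\<forall>t\<in>{K..<N}. even (lam t)) \<and> Lap_diag n lam [K..<N] g \<noteq> 0 \<and> Lap_diag n lam [K..<N] g \<in> odd_span n N N"
  proof (rule odd_highest_weight[OF g_span \<open>g \<noteq> 0\<close> g_sp K(2)])
    show "E_gl 0 n t t g = scale (of_nat (lam t)) g" if "t \<in> {K..<N}" for t
      using that E_eq[of t t] diag[of t] by (simp add: proj_scale g_def[symmetric])
    show "E_gl 0 n i j g = 0" if "j \<in> {K..<N}" "i \<in> {K..<j}" for i j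
      using that by (simp add: E_eq raise)
  qed
  define h where "h = Lap_diag n lam [K..<N] g"
  obtain u where u: "scoeff h u \<noteq> 0" using superpoly_nonzero_coeff red unfolding h_def by blast
  have "fst u = diag_monom K lam"
    using even_part_eq_Lap_diag[OF g_even, of n lam "[K..<N]"] u unfolding h_def even_part_eq_def by blast
  moreover have "fset (snd u) = {}"
    using red mono_spanD[of h UNIV _ u] u unfolding odd_span_def h_def by fastforce
  then have "snd u = {||}" by (metis bot_fset.rep_eq fset_inject)
  ultimately have "u = (diag_monom K lam, {||})" by (simp add: prod_eq_iff)
  then show "hw_functional m n N lam f \<noteq> 0"
    using u by (simp add: hw_functional_def K_def[symmetric] Let_def g_def h_def)
  obtain v where v: "scoeff g v \<noteq> 0" using superpoly_nonzero_coeff \<open>g \<noteq> 0\<close> by blast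
  show "even (lam t)" if t: "t < N"
  proof (cases "t < K")
    case True
    have vf: "scoeff f v \<noteq> 0" using v by (auto simp: g_def scoeff_proj split: if_splits)
    have "row_degree t v = count (fst v) (Index t t)"
    proof -
      have "(\<Sum>i\<in>#M. case i of Index a s \<Rightarrow> of_bool (a = t)) = count M (Index t t)"
        if "set_mset M \<subseteq> {Index t t | t. t < K}" for M
        using that by (induction M) auto
      then show ?thesis using mon(1)[OF v] by (simp add: row_degree_def)
    qed
    then show ?thesis using invariant_row_degree[OF f vf, of t] cnt[OF v True] by simp
  next
    case False
    then show ?thesis using red t by simp
  qed
  show "lam m \<le> 2 * n" if "m < N"
  proof -
    have "K = m" using that by (simp add: K_def)
    have "count (fst v) (Index a m) = 0" for a
      using mon(1)[OF v] \<open>K = m\<close> by (auto simp: count_eq_zero_iff)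
    moreover have "card {b. b < 2 * n \<and> Index b m |\<in>| snd v} \<le> card {..<2 * n}" by (intro card_mono) auto
    ultimately show ?thesis using wt_u[OF v that] by (simp add: wt_def)
  qed
qed

text \<open>Choose \<open>c\<close> so that the functional vanishes on the difference; a nonzero
  difference would be an invariant highest weight vector on which it cannot vanish.\<close>

corollary invariant_highest_weight_unique:
  assumes f: "f \<in> osp_invariants m n N" "highest_weight_vector m n N lam f"
    and g: "g \<in> osp_invariants m n N" "highest_weight_vector m n N lam g"
  shows "\<exists>c. f = scale c g"
proof -
  define c where "c = hw_functional m n N lam f / hw_functional m n N lam g"
  have sub: "superpoly.subspace (osp_invariants m n N)"
    using subalgebra_osp_invariants by (simp add: is_subalgebra_def)
  have "f - scale c g = 0"
  proof (rule ccontr)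
    assume nz: "f - scale c g \<noteq> 0"
    have "f - scale c g \<in> osp_invariants m n N"
      using f g by (intro superpoly.subspace_diff[OF sub] superpoly.subspace_scale[OF sub])
    moreover have "highest_weight_vector m n N lam (f - scale c g)"
      using f(2) g(2) nz
      by (simp add: highest_weight_vector_def E_gl_minus E_gl_scale superpoly.scale_right_diff_distrib mult.commute)
    ultimately have "hw_functional m n N lam (f - scale c g) \<noteq> 0" by (rule invariant_highest_weight(3))
    then show False
      using invariant_highest_weight(3)[OF g] by (simp add: hw_functional_diff_scale c_def)
  qed
  then show ?thesis by auto
qed

section \<open>Invariance of the minors\<close>

lemma bilinear_substitution:
  fixes C M :: "complex mat" and Z Z' :: "nat \<Rightarrow> index superpoly"
  assumes C: "C \<in> carrier_mat k k" and M: "M \<in> carrier_mat k k" and CM: "C * M * transpose_mat C = M"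
  shows "(\<Sum>a<k. \<Sum>b<k. scale (M $$ (a, b)) ((\<Sum>c<k. scale (C $$ (c, a)) (Z c)) * (\<Sum>d<k. scale (C $$ (d, b)) (Z' d)))) =
    (\<Sum>c<k. \<Sum>d<k. scale (M $$ (c, d)) (Z c * Z' d))"
proof -
  have entry: "M $$ (c, d) = (\<Sum>b<k. \<Sum>a<k. C $$ (c, a) * M $$ (a, b) * C $$ (d, b))" if "c < k" "d < k" for c d
  proof -
    have "M $$ (c, d) = (C * M * transpose_mat C) $$ (c, d)" by (simp add: CM)
    also have "\<dots> = (\<Sum>a<k. C $$ (c, a) * (\<Sum>b<k. M $$ (a, b) * C $$ (d, b)))"
      using that C M by (simp add: scalar_prod_def atLeast0LessThan)
    also have "\<dots> = (\<Sum>a<k. \<Sum>b<k. C $$ (c, a) * M $$ (a, b) * C $$ (d, b))"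
      by (simp add: sum_distrib_left mult.assoc)
    also have "\<dots> = (\<Sum>b<k. \<Sum>a<k. C $$ (c, a) * M $$ (a, b) * C $$ (d, b))"
      by (rule sum.swap)
    finally show ?thesis .
  qed
  have "(\<Sum>a<k. \<Sum>b<k. scale (M $$ (a, b)) ((\<Sum>c<k. scale (C $$ (c, a)) (Z c)) * (\<Sum>d<k. scale (C $$ (d, b)) (Z' d)))) =
      (\<Sum>a<k. \<Sum>b<k. \<Sum>c<k. \<Sum>d<k. scale (C $$ (c, a) * M $$ (a, b) * C $$ (d, b)) (Z c * Z' d))"
    by (simp add: sum_product superpoly.scale_sum_right scale_mult mult_ac)
  also have "\<dots> = (\<Sum>b<k. \<Sum>a<k. \<Sum>c<k. \<Sum>d<k. scale (C $$ (c, a) * M $$ (a, b) * C $$ (d, b)) (Z c * Z' d))"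
    by (rule sum.swap)
  also have "\<dots> = (\<Sum>b<k. \<Sum>c<k. \<Sum>a<k. \<Sum>d<k. scale (C $$ (c, a) * M $$ (a, b) * C $$ (d, b)) (Z c * Z' d))"
    by (intro sum.cong refl sum.swap)
  also have "\<dots> = (\<Sum>c<k. \<Sum>b<k. \<Sum>a<k. \<Sum>d<k. scale (C $$ (c, a) * M $$ (a, b) * C $$ (d, b)) (Z c * Z' d))"
    by (rule sum.swap)
  also have "\<dots> = (\<Sum>c<k. \<Sum>b<k. \<Sum>d<k. \<Sum>a<k. scale (C $$ (c, a) * M $$ (a, b) * C $$ (d, b)) (Z c * Z' d))"
    by (intro sum.cong refl sum.swap)
  also have "\<dots> = (\<Sum>c<k. \<Sum>d<k. \<Sum>b<k. \<Sum>a<k. scale (C $$ (c, a) * M $$ (a, b) * C $$ (d, b)) (Z c * Z' d))"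
    by (intro sum.cong refl sum.swap)
  also have "\<dots> = (\<Sum>c<k. \<Sum>d<k. scale (M $$ (c, d)) (Z c * Z' d))"
    by (intro sum.cong refl) (simp add: entry superpoly.scale_sum_left)
  finally show ?thesis .
qed

text \<open>The group preserves the form on \<open>V\<close>, while \<open>q_elem\<close> is built
  from the inverse form, so the dual relation is needed. The defining relation shows
  \<open>L\<close> to be a left inverse of \<open>B\<close>, hence also a right inverse.\<close>

lemma Sp_group_right:
  assumes "B \<in> Sp_group n"
  shows "B * (- eta n) * transpose_mat B = - eta n"
proof -
  let ?e = "eta n" and ?k = "2 * n"
  have B: "B \<in> carrier_mat ?k ?k" and BeB: "transpose_mat B * ?e * B = ?e" using assms by (auto simp: Sp_group_def)
  note e = eta_carrier[of n] eta_square[of n]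
  have Bt: "transpose_mat B \<in> carrier_mat ?k ?k" using B by simp
  have me: "- ?e \<in> carrier_mat ?k ?k" using e(1) by simp
  define L where "L = - ?e * (transpose_mat B * ?e)"
  have Lc: "L \<in> carrier_mat ?k ?k" using e(1) Bt me unfolding L_def by (meson mult_carrier_mat)
  have ee: "- ?e * ?e = 1\<^sub>m ?k"
    using e by (subst uminus_mult_left_mat) auto
  have "L * B = - ?e * (transpose_mat B * ?e * B)"
    unfolding L_def using B Bt e(1) me by (intro assoc_mult_mat) (auto intro: mult_carrier_mat)
  then have "L * B = 1\<^sub>m ?k" using BeB ee by simp
  then have "B * L = 1\<^sub>m ?k" by (rule mat_mult_left_right_inverse[OF Lc B])
  then have "B * (- ?e) * (transpose_mat B * ?e) = 1\<^sub>m ?k"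
    unfolding L_def using B Bt e(1) me by (subst assoc_mult_mat[of _ ?k ?k _ ?k _ ?k]) (auto intro: mult_carrier_mat)
  then have "B * (- ?e) * transpose_mat B * ?e = 1\<^sub>m ?k"
    using B Bt e(1) me by (subst assoc_mult_mat[of _ ?k ?k _ ?k _ ?k]) (auto intro: mult_carrier_mat)
  then have "B * (- ?e) * transpose_mat B * ?e * (- ?e) = - ?e" using me by simp
  moreover have "B * (- ?e) * transpose_mat B * ?e * (- ?e) = B * (- ?e) * transpose_mat B * (?e * (- ?e))"
    using B Bt e(1) me by (intro assoc_mult_mat[of _ ?k ?k _ ?k _ ?k]) (auto intro: mult_carrier_mat)
  moreover have "?e * (- ?e) = 1\<^sub>m ?k" using e by (subst uminus_mult_right_mat) auto
  moreover have "B * (- ?e) * transpose_mat B \<in> carrier_mat ?k ?k" using B Bt me by (meson mult_carrier_mat)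
  ultimately show ?thesis by (metis right_mult_one_mat)
qed

lemma q_elem_split: "q_elem m n t s =
    (\<Sum>a<m. \<Sum>b<m. scale (1\<^sub>m m $$ (a, b)) (Xgen m a t * Xgen m b s)) +
    (\<Sum>a<2 * n. \<Sum>b<2 * n. scale ((- eta n) $$ (a, b)) (Xgen m (m + a) t * Xgen m (m + b) s))"
proof -
  have "kappa_inv m n $$ (a, b) = 1\<^sub>m m $$ (a, b)" if "a < m" "b < m" for a b
    using that carrier_matD[OF eta_carrier[of n]] by (simp add: kappa_inv_def)
  moreover have "kappa_inv m n $$ (m + a, m + b) = (- eta n) $$ (a, b)" if "a < 2 * n" "b < 2 * n" for a b
    using that carrier_matD[OF eta_carrier[of n]] by (simp add: kappa_inv_def)
  moreover have "kappa_inv m n $$ (m + a, b) = 0" "kappa_inv m n $$ (b, m + a) = 0" if "a < 2 * n" "b < m" for a b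
    using that carrier_matD[OF eta_carrier[of n]] by (simp_all add: kappa_inv_def)
  ultimately show ?thesis
    by (simp add: q_elem_def sum_split_parity)
qed

lemma group_act_q_elem:
  assumes A: "A \<in> O_group m" and B: "B \<in> Sp_group n"
  shows "group_act m n A B (q_elem m n t s) = q_elem m n t s"
proof -
  have Ac: "A \<in> carrier_mat m m" and "transpose_mat A * A = 1\<^sub>m m" using A by (auto simp: O_group_def)
  then have "A * transpose_mat A = 1\<^sub>m m" using mat_mult_left_right_inverse[of "transpose_mat A" m A] by simp
  then have A1: "A * 1\<^sub>m m * transpose_mat A = 1\<^sub>m m" using Ac by simp
  have Bc: "B \<in> carrier_mat (2 * n) (2 * n)" using B by (simp add: Sp_group_def)
  have e: "- eta n \<in> carrier_mat (2 * n) (2 * n)" using eta_carrier[of n] by simp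
  have G: "group_act m n A B (Xgen m a r) = (\<Sum>b<m. scale (A $$ (b, a)) (Xgen m b r))" if "a < m" for a r
    using that by (simp add: group_act_Xgen)
  have G': "group_act m n A B (Xgen m (m + a) r) = (\<Sum>b<2 * n. scale (B $$ (b, a)) (Xgen m (m + b) r))" for a r
    by (simp add: group_act_Xgen)
  have "group_act m n A B (q_elem m n t s) =
     (\<Sum>a<m. \<Sum>b<m. scale (1\<^sub>m m $$ (a, b)) ((\<Sum>c<m. scale (A $$ (c, a)) (Xgen m c t)) * (\<Sum>d<m. scale (A $$ (d, b)) (Xgen m d s)))) +
     (\<Sum>a<2 * n. \<Sum>b<2 * n. scale ((- eta n) $$ (a, b))
       ((\<Sum>c<2 * n. scale (B $$ (c, a)) (Xgen m (m + c) t)) * (\<Sum>d<2 * n. scale (B $$ (d, b)) (Xgen m (m + d) s))))"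
    unfolding q_elem_split group_act_add group_act_sum group_act_scale group_act_mult G'
    by (intro arg_cong2[where f = "(+)"] sum.cong refl) (simp add: G)
  then show ?thesis
    unfolding bilinear_substitution[OF Ac one_carrier_mat A1] bilinear_substitution[OF Bc e Sp_group_right[OF B]]
    by (simp add: q_elem_split)
qed

lemma q_elem_invariant: "t < N \<Longrightarrow> s < N \<Longrightarrow> q_elem m n t s \<in> osp_invariants m n N"
  by (intro osp_invariantsI) (auto simp: q_elem_sym_superalg osp_act_q_elem group_act_q_elem)

section \<open>Minors inside subalgebras containing the entries of \<open>Q\<close>\<close>

lemma of_nat_scale: "of_nat k = scale (of_nat k) (1 :: 'i::linorder superpoly)"
  by (induction k) (simp_all add: superpoly.scale_left_distrib)

lemma of_int_scale: "of_int z = scale (of_int z) (1 :: 'i::linorder superpoly)"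
  by (cases z) (simp_all add: of_nat_scale superpoly.scale_minus_left superpoly.scale_left_diff_distrib flip: of_nat_scale)

lemma of_int_mult_scale: "of_int z * p = scale (of_int z) (p :: 'i::linorder superpoly)"
  by (subst of_int_scale) (simp add: scale_mult)

lemma D_minor_eq: "D_minor m n k = (\<Sum>\<sigma> | \<sigma> permutes {..<k}.
    scale (of_int (sign \<sigma>)) (prod_list (map (\<lambda>i. q_elem m n i (\<sigma> i)) [0..<k])))"
  by (simp add: D_minor_def of_int_mult_scale)

lemma subalgebra_prod_list:
  assumes "is_subalgebra W" "\<And>x. x \<in> set xs \<Longrightarrow> f x \<in> W"
  shows "prod_list (map f xs) \<in> W"
  using assms(2) by (induction xs) (use assms(1) in \<open>auto simp: is_subalgebra_def\<close>)

lemma subalgebra_power: "is_subalgebra W \<Longrightarrow> p \<in> W \<Longrightarrow> p ^ k \<in> W"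
  by (induction k) (auto simp: is_subalgebra_def)

lemma D_minor_subalgebra:
  assumes W: "is_subalgebra W" and q: "\<And>s t. s < k \<Longrightarrow> t < k \<Longrightarrow> q_elem m n s t \<in> W"
  shows "D_minor m n k \<in> W"
proof -
  have S: "superpoly.subspace W" using W by (simp add: is_subalgebra_def)
  show ?thesis
    unfolding D_minor_eq
  proof (intro superpoly.subspace_sum[OF S] superpoly.subspace_scale[OF S] subalgebra_prod_list[OF W])
    fix \<sigma> i assume "\<sigma> \<in> {\<sigma>. \<sigma> permutes {..<k}}" "i \<in> set [0..<k]"
    then have "i < k" "\<sigma> i < k" using permutes_in_image[of \<sigma> "{..<k}" i] by auto
    then show "q_elem m n i (\<sigma> i) \<in> W" by (rule q)
  qed
qed

lemma D_prod_subalgebra: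
  assumes "is_subalgebra W" "\<And>s t. s < N \<Longrightarrow> t < N \<Longrightarrow> q_elem m n s t \<in> W"
  shows "D_prod m n N l \<in> W"
  unfolding D_prod_def
  by (intro subalgebra_prod_list subalgebra_power D_minor_subalgebra assms) auto

lemma D_prod_invariant: "D_prod m n N l \<in> osp_invariants m n N"
  by (rule D_prod_subalgebra[OF subalgebra_osp_invariants q_elem_invariant])

section \<open>The minors as highest weight vectors\<close>

lemma subalgebra_even: "is_subalgebra {p. superpoly_even p}"
  by (auto simp: is_subalgebra_def superpoly.subspace_def superpoly_even_def par_add par_scale parity_inv_mult)

lemma even_q_elem: "superpoly_even (q_elem m n s t)"
proof -
  have "parity_inv (Xgen m a s * Xgen m (star m n a) t) = Xgen m a s * Xgen m (star m n a) t" for a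
    by (auto simp: parity_inv_mult parity_inv_Xgen parity_star scale_mult simp flip: power_mult_distrib)
  then show ?thesis
    by (simp add: superpoly_even_def q_elem_eq parity_inv_sum par_scale)
qed

lemma even_D_minor: "superpoly_even (D_minor m n k)"
  using D_minor_subalgebra[OF subalgebra_even, of k m n] even_q_elem by simp

lemma even_D_prod: "superpoly_even (D_prod m n k l)"
  using D_prod_subalgebra[OF subalgebra_even, of k m n l] even_q_elem by simp

lemma even_prod_list: "(\<And>x. x \<in> set xs \<Longrightarrow> superpoly_even (f x)) \<Longrightarrow> superpoly_even (prod_list (map f xs))"
  using subalgebra_prod_list[OF subalgebra_even, of xs f] by simp

lemma even_prod_list_cong:
  assumes "mset xs = mset ys" "\<And>x. superpoly_even (f x)"
  shows "prod_list (map f xs) = prod_list (map f ys)"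
  using assms(1)
proof (induction xs arbitrary: ys)
  case (Cons x xs)
  then have "x \<in> set ys" by (metis list.set_intros(1) mset_eq_setD)
  then obtain as bs where ys: "ys = as @ x # bs" by (meson split_list)
  then have "mset xs = mset (as @ bs)" using Cons.prems by simp
  then have "prod_list (map f xs) = prod_list (map f as) * prod_list (map f bs)" using Cons.IH[of "as @ bs"] by simp
  then have "prod_list (map f (x # xs)) = f x * prod_list (map f as) * prod_list (map f bs)" by (simp add: mult.assoc)
  also have "f x * prod_list (map f as) = prod_list (map f as) * f x" by (rule superpoly_even_commute[OF assms(2)])
  finally show ?case by (simp add: ys mult.assoc)
qed simp

text \<open>The operator is kept abstract since it will be \<open>E_gl\<close> as well as the
  gradient pairing \<open>Gam\<close> in its first argument, and for the latter the Leibniz rule is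
  available on even elements.\<close>

lemma derivation_prod_list:
  assumes der: "\<And>x y. superpoly_even x \<Longrightarrow> superpoly_even y \<Longrightarrow> \<delta> (x * y) = \<delta> x * y + x * \<delta> y"
    and one: "\<delta> 1 = 0" and ev: "\<And>x. superpoly_even (f x)" and "distinct xs"
  shows "\<delta> (prod_list (map f xs)) = (\<Sum>c\<in>set xs. prod_list (map (f(c := \<delta> (f c))) xs))"
  using assms(4)
proof (induction xs)
  case (Cons x xs)
  have "(\<Sum>c\<in>set xs. prod_list (map (f(c := \<delta> (f c))) (x # xs))) = (\<Sum>c\<in>set xs. f x * prod_list (map (f(c := \<delta> (f c))) xs))"
    using Cons.prems by (intro sum.cong) auto
  moreover have "map (f(x := \<delta> (f x))) xs = map f xs" using Cons.prems by (intro map_cong) auto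
  then have "prod_list (map (f(x := \<delta> (f x))) (x # xs)) = \<delta> (f x) * prod_list (map f xs)"
    by (simp only: list.map prod_list.Cons fun_upd_same)
  moreover have "\<delta> (prod_list (map f (x # xs))) = \<delta> (f x) * prod_list (map f xs) + f x * \<delta> (prod_list (map f xs))"
    by (simp add: der[OF ev even_prod_list[OF ev]])
  moreover have "\<delta> (prod_list (map f xs)) = (\<Sum>c\<in>set xs. prod_list (map (f(c := \<delta> (f c))) xs))"
    by (rule Cons.IH) (use Cons.prems in simp)
  ultimately show ?case
    using Cons.prems by (simp only: list.set sum.insert finite_set distinct.simps sum_distrib_left if_False not_False_eq_True)
qed (simp add: one)

lemma E_gl_q_elem: "E_gl m n i j (q_elem m n u v) =
    (if j = u then q_elem m n i v else 0) + (if j = v then q_elem m n u i else 0)"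
proof -
  have "E_gl m n i j (q_elem m n u v) = (\<Sum>a<m + 2 * n. scale (kv m n a)
      ((if j = u then Xgen m a i * Xgen m (star m n a) v else 0) + (if j = v then Xgen m a u * Xgen m (star m n a) i else 0)))"
    unfolding q_elem_eq E_gl_sum E_gl_scale
    by (intro sum.cong refl) (auto simp: E_gl_mult E_gl_Xgen star_less)
  then show ?thesis by (auto simp: q_elem_eq superpoly.scale_right_distrib sum.distrib)
qed

lemma prod_list_zero: "x \<in> set xs \<Longrightarrow> f x = 0 \<Longrightarrow> prod_list (map f xs) = (0 :: 'a::semiring_1)"
  by (induction xs) auto

lemma prod_list_scale_one:
  "distinct xs \<Longrightarrow> c \<in> set xs \<Longrightarrow> prod_list (map (f(c := scale x (f c))) xs) = scale x (prod_list (map f xs))"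
proof (induction xs)
  case (Cons y ys)
  show ?case
  proof (cases "c = y")
    case True
    then have "map (f(c := scale x (f c))) ys = map f ys" using Cons.prems by (intro map_cong) auto
    then show ?thesis using True by (simp only: list.map prod_list.Cons fun_upd_same scale_mult)
  next
    case False
    then show ?thesis using Cons by (simp add: scale_mult)
  qed
qed simp

text \<open>For \<open>i < k\<close> the index \<open>i\<close> occurs in each term of the Leibniz
  expansion exactly once as a row and once as a column.\<close>

lemma E_gl_D_minor_weight: "E_gl m n i i (D_minor m n k) = scale (if i < k then 2 else 0) (D_minor m n k)"
proof -
  have "E_gl m n i i (prod_list (map (\<lambda>t. q_elem m n t (\<sigma> t)) [0..<k])) =
      scale (if i < k then 2 else 0) (prod_list (map (\<lambda>t. q_elem m n t (\<sigma> t)) [0..<k]))" (is "_ (prod_list (map ?f _)) = _")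
    if "\<sigma> permutes {..<k}" for \<sigma>
  proof -
    have "E_gl m n i i (prod_list (map ?f [0..<k])) = (\<Sum>c\<in>{0..<k}. prod_list (map (?f(c := E_gl m n i i (?f c))) [0..<k]))"
      by (subst derivation_prod_list) (auto simp: E_gl_mult even_q_elem)
    also have "\<dots> = (\<Sum>c\<in>{0..<k}. scale (of_bool (i = c) + of_bool (i = \<sigma> c)) (prod_list (map ?f [0..<k])))"
    proof (intro sum.cong refl)
      fix c assume "c \<in> {0..<k}"
      moreover have "E_gl m n i i (?f c) = scale (of_bool (i = c) + of_bool (i = \<sigma> c)) (?f c)"
        by (auto simp: E_gl_q_elem superpoly.scale_left_distrib)
      ultimately show "prod_list (map (?f(c := E_gl m n i i (?f c))) [0..<k]) =
          scale (of_bool (i = c) + of_bool (i = \<sigma> c)) (prod_list (map ?f [0..<k]))"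
        using prod_list_scale_one[of "[0..<k]" c ?f] by simp
    qed
    also have "\<dots> = scale (\<Sum>c\<in>{0..<k}. of_bool (i = c) + of_bool (i = \<sigma> c)) (prod_list (map ?f [0..<k]))"
      by (simp only: superpoly.scale_sum_left)
    also have "(\<Sum>c\<in>{0..<k}. of_bool (i = c) + of_bool (i = \<sigma> c)) = (if i < k then 2 else 0 :: complex)"
    proof -
      have "(\<Sum>c\<in>{..<k}. of_bool (i = \<sigma> c)) = (\<Sum>c\<in>{..<k}. of_bool (i = c) :: complex)"
        using that by (intro sum.permute[of \<sigma> "{..<k}" "\<lambda>c. of_bool (i = c)", symmetric, unfolded comp_def])
      moreover have "(\<Sum>c\<in>{..<k}. of_bool (i = c)) = (if i < k then 1 else 0 :: complex)"
        by (simp add: of_bool_def)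
      ultimately show ?thesis by (simp add: sum.distrib atLeast0LessThan)
    qed
    finally show ?thesis .
  qed
  then show ?thesis
    by (simp add: D_minor_eq E_gl_sum E_gl_scale superpoly.scale_sum_right mult.commute)
qed

lemma permutation_of: "\<sigma> permutes {..<k::nat} \<Longrightarrow> permutation \<sigma>"
  using permutation_permutes by blast

lemma superpoly_eq_uminus: "p = - p \<Longrightarrow> p = (0 :: 'i superpoly)"
proof -
  assume "p = - p"
  have "scale 2 p = p + p" using superpoly.scale_left_distrib[of 1 1 p] by simp
  also have "\<dots> = p + - p" using \<open>p = - p\<close> by simp
  finally show ?thesis by simp
qed

text \<open>Reindexing by the sign-reversing involution shows that the sum equals its own
  negative.\<close>

lemma alternating_sum_zero:
  fixes F :: "(nat \<Rightarrow> nat) \<Rightarrow> 'i superpoly"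
  assumes "\<And>\<sigma>. \<sigma> permutes {..<k} \<Longrightarrow> \<Phi> \<sigma> permutes {..<k}" "\<And>\<sigma>. \<sigma> permutes {..<k} \<Longrightarrow> \<Phi> (\<Phi> \<sigma>) = \<sigma>"
    "\<And>\<sigma>. \<sigma> permutes {..<k} \<Longrightarrow> sign (\<Phi> \<sigma>) = - sign \<sigma>" "\<And>\<sigma>. \<sigma> permutes {..<k} \<Longrightarrow> F (\<Phi> \<sigma>) = F \<sigma>"
  shows "(\<Sum>\<sigma> | \<sigma> permutes {..<k}. scale (of_int (sign \<sigma>)) (F \<sigma>)) = 0"
proof -
  let ?S = "\<Sum>\<sigma> | \<sigma> permutes {..<k}. scale (of_int (sign \<sigma>)) (F \<sigma>)"
  have "?S = (\<Sum>\<sigma> | \<sigma> permutes {..<k}. scale (of_int (sign (\<Phi> \<sigma>))) (F (\<Phi> \<sigma>)))"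
    by (rule sum.reindex_bij_witness[of _ \<Phi> \<Phi>]) (auto simp: assms)
  also have "\<dots> = - ?S"
    by (simp add: assms superpoly.scale_minus_left sum_negf)
  finally show ?thesis by (rule superpoly_eq_uminus)
qed

text \<open>The operator replaces row \<open>j\<close> by row \<open>i\<close>, and then column
  \<open>j\<close> by column \<open>i\<close>. Both results are determinants with a repetition,
  killed by composing the permutations with a transposition on the appropriate side.\<close>

lemma E_gl_D_minor_raise:
  assumes ij: "i < j"
  shows "E_gl m n i j (D_minor m n k) = 0"
proof -
  define \<tau> where "\<tau> = (\<lambda>x. if x = j then i else x)"
  let ?\<pi> = "transpose i j :: nat \<Rightarrow> nat"
  have \<tau>: "\<tau> (?\<pi> x) = \<tau> x" for x using ij by (auto simp: \<tau>_def transpose_def)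
  have step: "E_gl m n i j (prod_list (map (\<lambda>t. q_elem m n t (\<sigma> t)) [0..<k])) =
      (if j < k then prod_list (map (\<lambda>t. q_elem m n (\<tau> t) (\<sigma> t)) [0..<k]) +
        prod_list (map (\<lambda>t. q_elem m n t (\<tau> (\<sigma> t))) [0..<k]) else 0)" (is "_ (prod_list (map ?f _)) = _")
    if \<sigma>: "\<sigma> permutes {..<k}" for \<sigma>
  proof -
    have E: "E_gl m n i j (?f c) = (if c = j then q_elem m n i (\<sigma> c) else 0) + (if c = inv_into UNIV \<sigma> j then q_elem m n c i else 0)" for c
      using permutes_inv_eq[OF \<sigma>, of j c] by (auto simp: E_gl_q_elem)
    have slot: "prod_list (map (f(c := x + y)) [0..<k]) = prod_list (map (f(c := x)) [0..<k]) + prod_list (map (f(c := y)) [0..<k])"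
      if "c \<in> {0..<k}" for f :: "nat \<Rightarrow> index superpoly" and c x y
    proof -
      have "[0..<k] = [0..<c] @ c # [Suc c..<k]"
        using that upt_add_eq_append[of 0 c "k - c"] by (simp add: upt_conv_Cons)
      moreover have "map (f(c := z)) [0..<c] = map f [0..<c]" "map (f(c := z)) [Suc c..<k] = map f [Suc c..<k]" for z
        by (auto intro!: map_cong)
      ultimately show ?thesis by (simp add: distrib_left distrib_right)
    qed
    have zero: "prod_list (map (f(c := 0)) [0..<k]) = 0" if "c \<in> {0..<k}" for f :: "nat \<Rightarrow> index superpoly" and c
      using that by (intro prod_list_zero[of c]) auto
    have "E_gl m n i j (prod_list (map ?f [0..<k])) = (\<Sum>c\<in>{0..<k}. prod_list (map (?f(c := E_gl m n i j (?f c))) [0..<k]))"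
      by (subst derivation_prod_list) (auto simp: E_gl_mult even_q_elem)
    also have "\<dots> = (\<Sum>c\<in>{0..<k}. (if c = j then prod_list (map (?f(c := q_elem m n i (\<sigma> c))) [0..<k]) else 0) +
        (if c = inv_into UNIV \<sigma> j then prod_list (map (?f(c := q_elem m n c i)) [0..<k]) else 0))"
      unfolding E by (intro sum.cong refl) (simp add: slot zero)
    also have "\<dots> = (if j < k then prod_list (map (?f(j := q_elem m n i (\<sigma> j))) [0..<k]) +
        prod_list (map (?f(inv_into UNIV \<sigma> j := q_elem m n (inv_into UNIV \<sigma> j) i)) [0..<k]) else 0)"
    proof -
      have "inv_into UNIV \<sigma> j < k \<longleftrightarrow> j < k" using permutes_in_image[OF permutes_inv[OF \<sigma>], of j] by simp
      then show ?thesis by (simp add: sum.distrib)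
    qed
    also have "?f(j := q_elem m n i (\<sigma> j)) = (\<lambda>t. q_elem m n (\<tau> t) (\<sigma> t))" by (auto simp: \<tau>_def)
    also have "?f(inv_into UNIV \<sigma> j := q_elem m n (inv_into UNIV \<sigma> j) i) = (\<lambda>t. q_elem m n t (\<tau> (\<sigma> t)))"
      using permutes_inv_eq[OF \<sigma>, of j] permutes_inverses[OF \<sigma>] by (auto simp: \<tau>_def fun_eq_iff)
    finally show ?thesis .
  qed
  show ?thesis
  proof (cases "j < k")
    case False
    then show ?thesis by (simp add: D_minor_eq E_gl_sum E_gl_scale step)
  next
    case True
    have \<pi>: "?\<pi> permutes {..<k}" using ij True by (intro permutes_swap_id) auto
    have "(\<Sum>\<sigma> | \<sigma> permutes {..<k}. scale (of_int (sign \<sigma>)) (prod_list (map (\<lambda>t. q_elem m n t (\<tau> (\<sigma> t))) [0..<k]))) = 0"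
    proof (rule alternating_sum_zero[of k "\<lambda>\<sigma>. ?\<pi> \<circ> \<sigma>"])
      fix \<sigma> :: "nat \<Rightarrow> nat" assume \<sigma>: "\<sigma> permutes {..<k}"
      show "?\<pi> \<circ> \<sigma> permutes {..<k}" by (rule permutes_compose[OF \<sigma> \<pi>])
      show "?\<pi> \<circ> (?\<pi> \<circ> \<sigma>) = \<sigma>" by (simp add: fun_eq_iff)
      show "sign (?\<pi> \<circ> \<sigma>) = - sign \<sigma>"
        using ij by (simp add: sign_compose permutation_of[OF \<sigma>] permutation_swap_id sign_swap_id)
    qed (simp add: \<tau>)
    moreover have "(\<Sum>\<sigma> | \<sigma> permutes {..<k}. scale (of_int (sign \<sigma>)) (prod_list (map (\<lambda>t. q_elem m n (\<tau> t) (\<sigma> t)) [0..<k]))) = 0"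
    proof (rule alternating_sum_zero[of k "\<lambda>\<sigma>. \<sigma> \<circ> ?\<pi>"])
      fix \<sigma> :: "nat \<Rightarrow> nat" assume \<sigma>: "\<sigma> permutes {..<k}"
      show "\<sigma> \<circ> ?\<pi> permutes {..<k}" by (rule permutes_compose[OF \<pi> \<sigma>])
      show "\<sigma> \<circ> ?\<pi> \<circ> ?\<pi> = \<sigma>" by (simp add: fun_eq_iff)
      show "sign (\<sigma> \<circ> ?\<pi>) = - sign \<sigma>"
        using ij by (simp add: sign_compose permutation_of[OF \<sigma>] permutation_swap_id sign_swap_id)
      \<comment> \<open>For repeated rows the transposition acts on the positions of the factors, so
        the product has to be reordered; the factors are even and commute.\<close>
      have "mset (map ?\<pi> [0..<k]) = mset [0..<k]"
        unfolding mset_map mset_upt atLeast0LessThan by (rule permutes_image_mset[OF \<pi>])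
      then have "prod_list (map (\<lambda>t. q_elem m n (\<tau> t) (\<sigma> (?\<pi> t))) (map ?\<pi> [0..<k])) =
          prod_list (map (\<lambda>t. q_elem m n (\<tau> t) (\<sigma> (?\<pi> t))) [0..<k])"
        by (intro even_prod_list_cong even_q_elem)
      then show "prod_list (map (\<lambda>t. q_elem m n (\<tau> t) ((\<sigma> \<circ> ?\<pi>) t)) [0..<k]) =
          prod_list (map (\<lambda>t. q_elem m n (\<tau> t) (\<sigma> t)) [0..<k])"
        by (simp add: comp_def \<tau>)
    qed
    ultimately show ?thesis
      using True by (simp add: D_minor_eq E_gl_sum E_gl_scale step superpoly.scale_right_distrib sum.distrib)
  qed
qed

section \<open>A Cayley identity\<close>

lemma parity_inv_diff: "parity_inv (p - q) = parity_inv p - parity_inv q"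
  using par_add[of "p - q" q] by simp

lemma parity_inv_deriv_odd: "parity_inv (deriv_odd i p) = - deriv_odd i (parity_inv p)"
  for p :: "'i::linorder superpoly"
proof (rule superpoly_gen_induct[of p UNIV UNIV])
  have u: "deriv_odd i (- r) = - deriv_odd i r" for r :: "'i superpoly"
    using deriv_odd_minus[of i 0 r] by simp
  fix j and q :: "'i superpoly" assume IH: "parity_inv (deriv_odd i q) = - deriv_odd i (parity_inv q)"
  show "parity_inv (deriv_odd i (even_gen j * q)) = - deriv_odd i (parity_inv (even_gen j * q))"
    by (simp add: deriv_odd_gen_mult parity_inv_mult parity_inv_gen IH)
  show "parity_inv (deriv_odd i (odd_gen j * q)) = - deriv_odd i (parity_inv (odd_gen j * q))"
    by (simp add: deriv_odd_gen_mult parity_inv_mult parity_inv_gen parity_inv_diff IH u)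
qed (simp_all add: deriv_one par_add par_scale deriv_add deriv_scale superpoly.scale_minus_right)

lemma parity_inv_deriv_even: "parity_inv (deriv_even i p) = deriv_even i (parity_inv p)"
  for p :: "'i::linorder superpoly"
proof (rule superpoly_gen_induct[of p UNIV UNIV])
  have u: "deriv_even i (- r) = - deriv_even i r" for r :: "'i superpoly"
    using deriv_even_minus[of i 0 r] by simp
  fix j and q :: "'i superpoly" assume IH: "parity_inv (deriv_even i q) = deriv_even i (parity_inv q)"
  show "parity_inv (deriv_even i (even_gen j * q)) = deriv_even i (parity_inv (even_gen j * q))"
    by (simp add: deriv_even_gen_mult parity_inv_mult parity_inv_gen par_add IH)
  show "parity_inv (deriv_even i (odd_gen j * q)) = deriv_even i (parity_inv (odd_gen j * q))"
    by (simp add: deriv_even_gen_mult parity_inv_mult parity_inv_gen IH u)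
qed (simp_all add: deriv_one par_add par_scale deriv_add deriv_scale)

lemma dXgen_even_mult:
  assumes "superpoly_even f"
  shows "dXgen m a t (f * g) = dXgen m a t f * g + f * dXgen m a t g"
  using assms by (simp add: dXgen_def deriv_even_mult deriv_odd_mult superpoly_even_def)

lemma dXgen_dXgen_mult:
  assumes "superpoly_even f"
  shows "dXgen m a t (dXgen m b s f * g) = dXgen m a t (dXgen m b s f) * g + scale (eps m a b) (dXgen m b s f * dXgen m a t g)"
  using assms by (auto simp: dXgen_def deriv_even_mult deriv_odd_mult superpoly_even_def parity_inv_deriv_odd
      eps_def superpoly.scale_minus_left deriv_even_odd_commute parity_inv_deriv_even)

text \<open>The bilinear part of the second-order operator \<open>Lap m n t t\<close>: twice the
  pairing of gradients, measuring its failure to be a derivation.\<close>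

definition Gam :: "nat \<Rightarrow> nat \<Rightarrow> nat \<Rightarrow> index superpoly \<Rightarrow> index superpoly \<Rightarrow> index superpoly" where
  "Gam m n t f g = scale 2 (\<Sum>a<m + 2 * n. scale (kv m n a) (dXgen m a t f * dXgen m (star m n a) t g))"

lemma Lap_mult_even:
  assumes f: "superpoly_even f"
  shows "Lap m n t t (f * g) = Lap m n t t f * g + f * Lap m n t t g + Gam m n t f g"
proof -
  let ?d = "\<lambda>a. dXgen m a t" and ?s = "star m n"
  have "?d a (?d (?s a) (f * g)) = ?d a (?d (?s a) f) * g + scale (eps m a a) (?d (?s a) f * ?d a g) +
      ?d a f * ?d (?s a) g + f * ?d a (?d (?s a) g)" for a
    using f by (simp add: dXgen_even_mult dXgen_dXgen_mult dXgen_add eps_star add.assoc)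
  then have "Lap m n t t (f * g) = Lap m n t t f * g + f * Lap m n t t g +
      ((\<Sum>a<m + 2 * n. scale (kv m n a * eps m a a) (?d (?s a) f * ?d a g)) +
       (\<Sum>a<m + 2 * n. scale (kv m n a) (?d a f * ?d (?s a) g)))"
    by (simp add: Lap_def superpoly.scale_right_distrib sum.distrib sum_distrib_left sum_distrib_right scale_mult algebra_simps)
  also have "(\<Sum>a<m + 2 * n. scale (kv m n a * eps m a a) (?d (?s a) f * ?d a g)) =
      (\<Sum>a<m + 2 * n. scale (kv m n a) (?d a f * ?d (?s a) g))"
    by (subst sum_star[of _ m n, symmetric]) (simp add: star_star kv_star eps_star mult_ac)
  also have "x + x = scale 2 x" for x :: "index superpoly"
    using superpoly.scale_left_distrib[of 1 1 x] by simp
  finally show ?thesis by (simp add: Gam_def)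
qed

lemma Gam_mult:
  assumes "superpoly_even f" "superpoly_even g"
  shows "Gam m n t (f * g) w = Gam m n t f w * g + f * Gam m n t g w"
proof -
  have "dXgen m a t (f * g) * y = dXgen m a t f * y * g + f * (dXgen m a t g * y)" for a y
    using assms superpoly_even_commute[OF assms(2), of y]
    by (simp add: dXgen_even_mult distrib_right mult.assoc)
  then show ?thesis
    by (simp add: Gam_def superpoly.scale_right_distrib sum.distrib sum_distrib_left sum_distrib_right scale_mult)
qed

lemma Gam_one [simp]: "Gam m n t 1 w = 0"
  by (simp add: Gam_def)

lemma Gam_sum: "Gam m n t (sum f S) w = (\<Sum>x\<in>S. Gam m n t (f x) w)"
  and Gam_scale: "Gam m n t (scale c p) w = scale c (Gam m n t p w)"
  by (simp_all add: Gam_def dXgen_sum dXgen_scale sum_distrib_right superpoly.scale_sum_right scale_mult mult_ac)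
    (subst sum.swap, rule refl)?

lemma dXgen_q_elem: "a < m + 2 * n \<Longrightarrow> dXgen m a t (q_elem m n u v) =
    scale (kv m n a) ((if t = u then Xgen m (star m n a) v else 0) + (if t = v then Xgen m (star m n a) u else 0))"
proof -
  assume a: "a < m + 2 * n"
  have eq: "a = star m n c \<longleftrightarrow> c = star m n a" if "c < m + 2 * n" for c
    using star_star[OF that] star_star[OF a] by auto
  have s: "star m n a < m + 2 * n" "star m n (star m n a) = a" using a by (simp_all add: star_less star_star)
  have "dXgen m a t (q_elem m n u v) = (\<Sum>c<m + 2 * n.
      (if c = a then if t = u then scale (kv m n c) (Xgen m (star m n c) v) else 0 else 0) +
      (if c = star m n a then if t = v then scale (kv m n c * eps m a c) (Xgen m c u) else 0 else 0))"
    unfolding q_elem_eq dXgen_sum dXgen_scale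
  proof (intro sum.cong refl)
    fix c assume "c \<in> {..<m + 2 * n}"
    then show "scale (kv m n c) (dXgen m a t (Xgen m c u * Xgen m (star m n c) v)) =
        (if c = a then if t = u then scale (kv m n c) (Xgen m (star m n c) v) else 0 else 0) +
        (if c = star m n a then if t = v then scale (kv m n c * eps m a c) (Xgen m c u) else 0 else 0)"
      using eq[of c] by (cases "c = a"; cases "c = star m n a")
        (simp_all add: dXgen_Xgen_mult dXgen_Xgen superpoly.scale_right_distrib)
  qed
  also have "\<dots> = (if t = u then scale (kv m n a) (Xgen m (star m n a) v) else 0) +
      (if t = v then scale (kv m n (star m n a) * eps m a a) (Xgen m (star m n a) u) else 0)"
    using a s by (simp add: sum.distrib eps_star)
  also have "kv m n (star m n a) * eps m a a = kv m n a"
    using kv_star[OF a] by (simp add: mult.commute mult.left_commute)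
  finally show ?thesis by (simp add: superpoly.scale_right_distrib)
qed

text \<open>The gradient of a quadratic form is linear, so pairing with it is an operator of
  \<open>gl_N\<close>. The action of the Laplacian on minors is thus governed by the raising and
  weight operators.\<close>

lemma Gam_q_elem: "Gam m n t (q_elem m n u v) w =
    scale 2 ((if t = u then E_gl m n v t w else 0) + (if t = v then E_gl m n u t w else 0))"
proof -
  have "scale (kv m n a) (dXgen m a t (q_elem m n u v) * dXgen m (star m n a) t w) =
      (if t = u then Xgen m (star m n a) v * dXgen m (star m n a) t w else 0) +
      (if t = v then Xgen m (star m n a) u * dXgen m (star m n a) t w else 0)" if "a < m + 2 * n" for a
    using that by (auto simp: dXgen_q_elem scale_mult distrib_right)
  then have "Gam m n t (q_elem m n u v) w = scale 2 (\<Sum>a<m + 2 * n.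
      (if t = u then Xgen m (star m n a) v * dXgen m (star m n a) t w else 0) +
      (if t = v then Xgen m (star m n a) u * dXgen m (star m n a) t w else 0))"
    by (simp add: Gam_def)
  also have "(\<Sum>a<m + 2 * n. (if t = u then Xgen m (star m n a) v * dXgen m (star m n a) t w else 0) +
      (if t = v then Xgen m (star m n a) u * dXgen m (star m n a) t w else 0)) =
      (\<Sum>a<m + 2 * n. (if t = u then Xgen m a v * dXgen m a t w else 0) +
      (if t = v then Xgen m a u * dXgen m a t w else 0))"
    by (rule sum_star[of "\<lambda>a. (if t = u then Xgen m a v * dXgen m a t w else 0) +
      (if t = v then Xgen m a u * dXgen m a t w else 0)"])
  also have "\<dots> = (if t = u then E_gl m n v t w else 0) + (if t = v then E_gl m n u t w else 0)"
    by (simp add: sum.distrib E_gl_def)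
  finally show ?thesis .
qed

text \<open>The constant is twice the superdimension of \<open>V\<close>, obtained as the sum of the
  signs \<open>eps m a a\<close>.\<close>

lemma Lap_q_elem: "Lap m n t t (q_elem m n u v) = scale (if t = u \<and> t = v then 2 * (of_nat m - of_nat (2 * n)) else 0) 1"
proof -
  have "scale (kv m n a) (dXgen m a t (dXgen m (star m n a) t (q_elem m n u v))) =
      scale (if t = u \<and> t = v then 2 * eps m a a else 0) 1" if a: "a < m + 2 * n" for a
  proof -
    have s: "star m n a < m + 2 * n" "star m n (star m n a) = a" using a by (simp_all add: star_less star_star)
    have k: "kv m n a * kv m n (star m n a) = eps m a a" using kv_star[OF a] by (simp add: mult.left_commute)
    have "dXgen m (star m n a) t (q_elem m n u v) = scale (kv m n (star m n a))
        ((if t = u then Xgen m a v else 0) + (if t = v then Xgen m a u else 0))"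
      using dXgen_q_elem[OF s(1)] s(2) by simp
    then have "scale (kv m n a) (dXgen m a t (dXgen m (star m n a) t (q_elem m n u v))) =
        scale (eps m a a) ((if t = u \<and> t = v then 1 else 0) + (if t = v \<and> t = u then 1 else 0))"
      using k by (auto simp: dXgen_scale dXgen_add dXgen_Xgen)
    also have "(if t = u \<and> t = v then 1 else 0) + (if t = v \<and> t = u then 1 else 0) =
        scale (if t = u \<and> t = v then 2 else 0) (1 :: index superpoly)"
      using superpoly.scale_left_distrib[of 1 1 "1 :: index superpoly"] by simp
    finally show ?thesis by (simp add: mult.commute)
  qed
  then have "Lap m n t t (q_elem m n u v) = scale (\<Sum>a<m + 2 * n. if t = u \<and> t = v then 2 * eps m a a else 0) 1"
    by (simp add: Lap_def superpoly.scale_sum_left)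
  also have "(\<Sum>a<m + 2 * n. eps m a a) = of_nat m - of_nat (2 * n)"
    by (simp add: sum_split_parity eps_def)
  then have "(\<Sum>a<m + 2 * n. if t = u \<and> t = v then 2 * eps m a a else 0) =
      (if t = u \<and> t = v then 2 * (of_nat m - of_nat (2 * n)) else 0)"
  proof (cases "t = u \<and> t = v")
    case True
    then show ?thesis using \<open>(\<Sum>a<m + 2 * n. eps m a a) = _\<close> by (simp flip: sum_distrib_left)
  next
    case False
    show ?thesis unfolding if_not_P[OF False] by simp
  qed
  finally show ?thesis .
qed

text \<open>The Laplacian lowers the weight entry at \<open>t\<close> by two, and weights cannot be
  negative.\<close>

lemma Lap_low_weight:
  assumes "E_gl m n t t w = scale c w" "c = 0 \<or> c = 1"
  shows "Lap m n t t w = 0"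
proof (rule ccontr)
  assume "Lap m n t t w \<noteq> 0"
  then obtain u where "scoeff (Lap m n t t w) u \<noteq> 0" using superpoly_nonzero_coeff by blast
  moreover have "E_gl m n t t (Lap m n t t w) = scale (c - 2) (Lap m n t t w)"
    using E_gl_diag_Lap[OF assms(1), of t t] by (simp add: algebra_simps)
  ultimately have "c - 2 = of_nat (wt m n t u)" using E_gl_diag_eigen by blast
  then have "c = of_nat (wt m n t u + 2)" by (simp add: algebra_simps)
  then have "(0 :: complex) = of_nat (wt m n t u + 2) \<or> (of_nat 1 :: complex) = of_nat (wt m n t u + 2)"
    using assms(2) by auto
  then show False by (simp only: of_nat_eq_iff of_nat_eq_0_iff eq_commute[of 0]) auto
qed

text \<open>
  Expansion of the minor of size \<open>Suc p\<close> along its last row: the permutation is written as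
  \<open>transpose p b \<circ> \<sigma>\<close> with \<open>\<sigma>\<close> fixing \<open>p\<close>.
\<close>

definition row_minor :: "nat \<Rightarrow> nat \<Rightarrow> nat \<Rightarrow> nat \<Rightarrow> (nat \<Rightarrow> nat) \<Rightarrow> index superpoly" where
  "row_minor m n p b \<sigma> = prod_list (map (\<lambda>i. q_elem m n i (transpose p b (\<sigma> i))) [0..<p])"

lemma D_minor_Suc: "D_minor m n (Suc p) = (\<Sum>b\<in>insert p {..<p}. \<Sum>\<sigma> | \<sigma> permutes {..<p}.
    scale (of_int (sign \<sigma>) * (if b = p then 1 else - 1)) (q_elem m n p b * row_minor m n p b \<sigma>))"
proof -
  have "D_minor m n (Suc p) = (\<Sum>b\<in>insert p {..<p}. \<Sum>\<sigma> | \<sigma> permutes {..<p}.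
      scale (of_int (sign (transpose p b \<circ> \<sigma>)))
        (prod_list (map (\<lambda>i. q_elem m n i ((transpose p b \<circ> \<sigma>) i)) [0..<Suc p])))"
    unfolding D_minor_eq lessThan_Suc by (rule sum_over_permutations_insert) auto
  also have "\<dots> = (\<Sum>b\<in>insert p {..<p}. \<Sum>\<sigma> | \<sigma> permutes {..<p}.
      scale (of_int (sign \<sigma>) * (if b = p then 1 else - 1)) (q_elem m n p b * row_minor m n p b \<sigma>))"
  proof (intro sum.cong refl)
    fix b \<sigma> assume \<sigma>: "\<sigma> \<in> {\<sigma>. \<sigma> permutes {..<p}}"
    then have "\<sigma> p = p" by (auto simp: permutes_def)
    then have "prod_list (map (\<lambda>i. q_elem m n i ((transpose p b \<circ> \<sigma>) i)) [0..<Suc p]) = row_minor m n p b \<sigma> * q_elem m n p b"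
      by (simp add: row_minor_def)
    also have "\<dots> = q_elem m n p b * row_minor m n p b \<sigma>"
      by (rule superpoly_even_commute[OF even_q_elem, symmetric])
    finally show "scale (of_int (sign (transpose p b \<circ> \<sigma>)))
        (prod_list (map (\<lambda>i. q_elem m n i ((transpose p b \<circ> \<sigma>) i)) [0..<Suc p])) =
        scale (of_int (sign \<sigma>) * (if b = p then 1 else - 1)) (q_elem m n p b * row_minor m n p b \<sigma>)"
      using \<sigma> by (auto simp: sign_compose permutation_of permutation_swap_id sign_swap_id)
  qed
  finally show ?thesis .
qed

lemma even_row_minor: "superpoly_even (row_minor m n p b \<sigma>)"
  unfolding row_minor_def by (intro even_prod_list even_q_elem)

lemma derivation_row_minor_zero:
  assumes der: "\<And>x y. superpoly_even x \<Longrightarrow> superpoly_even y \<Longrightarrow> \<delta> (x * y) = \<delta> x * y + x * \<delta> y" "\<delta> 1 = 0"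
    and "\<And>i. i < p \<Longrightarrow> \<delta> (q_elem m n i (transpose p b (\<sigma> i))) = 0"
  shows "\<delta> (row_minor m n p b \<sigma>) = 0"
  unfolding row_minor_def
  by (subst derivation_prod_list[OF der])
    (auto simp: even_q_elem assms(3) intro!: sum.neutral prod_list_zero)

lemma D_minor_row_minor: "D_minor m n p = (\<Sum>\<sigma> | \<sigma> permutes {..<p}. scale (of_int (sign \<sigma>)) (row_minor m n p p \<sigma>))"
  by (simp add: D_minor_eq row_minor_def)

text \<open>In the expansion along the last row, the term \<open>b = p\<close> contributes twice the
  superdimension. Each of the \<open>p\<close> other terms contributes 2 through the gradient
  pairing, with the sign -1 of its transposition.\<close>

lemma Lap_D_minor: "Lap m n p p (D_minor m n (Suc p)) =
    scale (2 * (of_nat m - of_nat (2 * n) - of_nat p)) (D_minor m n p)"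
proof -
  have main: "Lap m n p p (q_elem m n p b * row_minor m n p b \<sigma>) =
      scale (if b = p then 2 * (of_nat m - of_nat (2 * n)) else 2) (row_minor m n p p \<sigma>)"
    if \<sigma>: "\<sigma> permutes {..<p}" and b: "b \<in> insert p {..<p}" for b \<sigma>
  proof (cases "b = p")
    case True
    have lt: "\<sigma> i < p" if "i < p" for i using permutes_in_image[OF \<sigma>, of i] that by simp
    have "E_gl m n p p (row_minor m n p p \<sigma>) = 0"
      by (rule derivation_row_minor_zero) (use lt in \<open>auto simp: E_gl_mult E_gl_q_elem\<close>)
    then show ?thesis using Lap_low_weight[of m n p "row_minor m n p p \<sigma>" 0] True
      by (simp add: Lap_mult_even[OF even_q_elem] Lap_q_elem Gam_q_elem scale_mult)
  next
    case False
    then have b: "b < p" using b by simp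
    \<comment> \<open>The row whose column index \<open>b\<close> was turned into \<open>p\<close>
      by the transposition: the only factor of the row minor in which the index \<open>p\<close>
      occurs.\<close>
    define c0 where "c0 = inv_into UNIV \<sigma> b"
    have c0: "\<sigma> c0 = b" "c0 < p" "\<And>i. \<sigma> i = b \<longleftrightarrow> i = c0"
      using permutes_inverses[OF \<sigma>] permutes_in_image[OF permutes_inv[OF \<sigma>], of b] permutes_inv_eq[OF \<sigma>, of b] b
      by (auto simp: c0_def)
    have lt: "\<sigma> i < p" if "i < p" for i using permutes_in_image[OF \<sigma>, of i] that by simp
    let ?f = "\<lambda>i. q_elem m n i (transpose p b (\<sigma> i))"
    have E: "E_gl m n i p (row_minor m n p b \<sigma>) = prod_list (map (?f(c0 := q_elem m n c0 i)) [0..<p])" for i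
    proof -
      have Ef: "E_gl m n i p (?f c) = (if c = c0 then q_elem m n c0 i else 0)" if "c < p" for c
        using c0(3)[of c] lt[OF that] that b by (auto simp: E_gl_q_elem transpose_def)
      have "E_gl m n i p (row_minor m n p b \<sigma>) = (\<Sum>c\<in>{0..<p}. prod_list (map (?f(c := E_gl m n i p (?f c))) [0..<p]))"
        unfolding row_minor_def by (subst derivation_prod_list) (auto simp: E_gl_mult even_q_elem)
      also have "\<dots> = (\<Sum>c\<in>{0..<p}. if c = c0 then prod_list (map (?f(c0 := q_elem m n c0 i)) [0..<p]) else 0)"
        by (intro sum.cong refl) (auto simp: Ef intro!: prod_list_zero)
      finally show ?thesis using c0(2) by simp
    qed
    have "?f(c0 := q_elem m n c0 p) = ?f" using c0(1) by auto
    then have "E_gl m n p p (row_minor m n p b \<sigma>) = scale 1 (row_minor m n p b \<sigma>)"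
      using E[of p] by (simp add: row_minor_def)
    then have L: "Lap m n p p (row_minor m n p b \<sigma>) = 0" by (rule Lap_low_weight) simp
    have "\<sigma> i \<noteq> b" if "i \<noteq> c0" for i using c0(3) that by simp
    then have "prod_list (map (?f(c0 := q_elem m n c0 b)) [0..<p]) = row_minor m n p p \<sigma>"
      unfolding row_minor_def using c0(1,2) lt b
      by (intro arg_cong[where f = prod_list] map_cong refl) (auto simp: transpose_def)
    then have "E_gl m n b p (row_minor m n p b \<sigma>) = row_minor m n p p \<sigma>" using E[of b] by simp
    then show ?thesis using False L
      by (simp add: Lap_mult_even[OF even_q_elem] Lap_q_elem Gam_q_elem)
  qed
  have "Lap m n p p (D_minor m n (Suc p)) = (\<Sum>b\<in>insert p {..<p}. \<Sum>\<sigma> | \<sigma> permutes {..<p}.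
      scale (of_int (sign \<sigma>) * (if b = p then 2 * (of_nat m - of_nat (2 * n)) else - 2)) (row_minor m n p p \<sigma>))"
    unfolding D_minor_Suc Lap_sum Lap_scale by (intro sum.cong refl) (auto simp: main)
  also have "\<dots> = (\<Sum>b\<in>insert p {..<p}. scale (if b = p then 2 * (of_nat m - of_nat (2 * n)) else - 2) (D_minor m n p))"
    unfolding D_minor_row_minor by (simp add: superpoly.scale_sum_right mult.commute)
  also have "\<dots> = scale (\<Sum>b\<in>insert p {..<p}. if b = p then 2 * (of_nat m - of_nat (2 * n)) else - 2) (D_minor m n p)"
    by (simp only: superpoly.scale_sum_left)
  also have "(\<Sum>b\<in>insert p {..<p}. if b = p then 2 * (of_nat m - of_nat (2 * n)) else - 2) =
      (2 * (of_nat m - of_nat (2 * n) - of_nat p) :: complex)"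
    by (simp add: algebra_simps)
  finally show ?thesis .
qed

text \<open>Since \<open>w\<close> is killed by the raising operators into column \<open>p\<close>,
  only the corner entry \<open>q_elem m n p p\<close> of the last row contributes; its two equal
  indices together with the factor 2 in \<open>Gam\<close> make 4.\<close>

lemma Gam_D_minor:
  assumes "\<And>s. s < p \<Longrightarrow> E_gl m n s p w = 0"
  shows "Gam m n p (D_minor m n (Suc p)) w = scale 4 (D_minor m n p * E_gl m n p p w)"
proof -
  have main: "Gam m n p (q_elem m n p b * row_minor m n p b \<sigma>) w =
      (if b = p then scale 4 (row_minor m n p p \<sigma> * E_gl m n p p w) else 0)"
    if \<sigma>: "\<sigma> permutes {..<p}" and b: "b \<in> insert p {..<p}" for b \<sigma>
  proof -
    have "Gam m n p (q_elem m n i (transpose p b (\<sigma> i))) w = 0" if "i < p" for i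
      using that assms by (auto simp: Gam_q_elem)
    then have R: "Gam m n p (row_minor m n p b \<sigma>) w = 0"
      by (intro derivation_row_minor_zero[where \<delta> = "\<lambda>x. Gam m n p x w"]) (auto simp: Gam_mult)
    have "scale 2 (E_gl m n p p w + E_gl m n p p w) = scale 4 (E_gl m n p p w)"
      using superpoly.scale_left_distrib[of 2 2 "E_gl m n p p w"] by (simp add: superpoly.scale_right_distrib)
    then have "scale 2 ((E_gl m n p p w + E_gl m n p p w) * row_minor m n p p \<sigma>) = scale 4 (E_gl m n p p w * row_minor m n p p \<sigma>)"
      by (metis scale_mult(1))
    moreover have "E_gl m n p p w * row_minor m n p p \<sigma> = row_minor m n p p \<sigma> * E_gl m n p p w"
      by (rule superpoly_even_commute[OF even_row_minor, symmetric])
    ultimately show ?thesis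
      using R b assms by (auto simp: Gam_mult[OF even_q_elem even_row_minor] Gam_q_elem scale_mult)
  qed
  have "Gam m n p (D_minor m n (Suc p)) w = (\<Sum>b\<in>insert p {..<p}. \<Sum>\<sigma> | \<sigma> permutes {..<p}.
      if b = p then scale (of_int (sign \<sigma>)) (scale 4 (row_minor m n p p \<sigma> * E_gl m n p p w)) else 0)"
    unfolding D_minor_Suc Gam_sum Gam_scale by (intro sum.cong refl) (auto simp: main)
  also have "\<dots> = (\<Sum>\<sigma> | \<sigma> permutes {..<p}. scale (of_int (sign \<sigma>)) (scale 4 (row_minor m n p p \<sigma> * E_gl m n p p w)))"
    by simp
  also have "\<dots> = scale 4 (D_minor m n p * E_gl m n p p w)"
    unfolding D_minor_row_minor
    by (simp add: sum_distrib_right scale_mult superpoly.scale_sum_right mult.commute)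
  finally show ?thesis .
qed

lemma E_gl_power: "E_gl m n s t p = scale c p \<Longrightarrow> E_gl m n s t (p ^ k) = scale (of_nat k * c) (p ^ k)"
  by (induction k) (simp_all add: E_gl_mult scale_mult superpoly.scale_left_distrib distrib_right)

text \<open>Splitting off one factor adds \<open>2 * M + 8 * j\<close>, where M abbreviates m - 2n -
  p: the Laplacian of the minor gives \<open>2 * M\<close>, the gradient pairing 4 times the weight
  \<open>2 * j\<close>. Summing these contributions gives the stated product.\<close>

lemma Lap_D_minor_power:
  assumes h: "E_gl m n p p h = 0" "\<And>s. s < p \<Longrightarrow> E_gl m n s p h = 0"
  shows "Lap m n p p (D_minor m n (Suc p) ^ Suc j * h) =
    scale (2 * of_nat (Suc j) * (of_nat m - of_nat (2 * n) - of_nat p + 2 * of_nat j))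
      (D_minor m n p * (D_minor m n (Suc p) ^ j * h))"
proof (induction j)
  let ?u = "D_minor m n (Suc p)" and ?D = "D_minor m n p" and ?M = "of_nat m - of_nat (2 * n) - of_nat p :: complex"
  have rec: "Lap m n p p (?u ^ Suc j * h) = scale (2 * ?M + 8 * of_nat j) (?D * (?u ^ j * h)) + ?u * Lap m n p p (?u ^ j * h)" for j
  proof -
    have u: "E_gl m n p p ?u = scale 2 ?u" using E_gl_D_minor_weight[of m n p "Suc p"] by simp
    have E: "E_gl m n p p (?u ^ j * h) = scale (2 * of_nat j) (?u ^ j * h)"
      using E_gl_power[OF u, of j] h(1) by (simp add: E_gl_mult scale_mult mult.commute)
    have "E_gl m n s p (?u ^ j * h) = 0" if "s < p" for s
      using E_gl_power[of m n s p ?u 0 j] E_gl_D_minor_raise[OF that] h(2)[OF that] by (simp add: E_gl_mult)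
    then have "Gam m n p ?u (?u ^ j * h) = scale (8 * of_nat j) (?D * (?u ^ j * h))"
      using Gam_D_minor[of p m n "?u ^ j * h"] E by (simp add: scale_mult)
    moreover have "Lap m n p p (?u ^ Suc j * h) = Lap m n p p (?u * (?u ^ j * h))" by (simp add: mult.assoc)
    ultimately show ?thesis
      by (simp add: Lap_mult_even[OF even_D_minor] Lap_D_minor scale_mult superpoly.scale_left_distrib algebra_simps)
  qed
  case 0
  show ?case using rec[of 0] Lap_low_weight[of m n p h 0] h(1) by simp
  case (Suc j)
  have "?u * (?D * (?u ^ j * h)) = ?D * (?u ^ Suc j * h)"
    using superpoly_even_commute[OF even_D_minor, of m n "Suc p" ?D] by (simp add: mult.assoc[symmetric])
  then have "Lap m n p p (?u ^ Suc (Suc j) * h) = scale (2 * ?M + 8 * of_nat (Suc j) +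
      2 * of_nat (Suc j) * (?M + 2 * of_nat j)) (?D * (?u ^ Suc j * h))"
    unfolding rec[of "Suc j"] Suc scale_mult(2) by (simp only: superpoly.scale_left_distrib)
  also have "2 * ?M + 8 * of_nat (Suc j) + 2 * of_nat (Suc j) * (?M + 2 * of_nat j) =
      2 * of_nat (Suc (Suc j)) * (?M + 2 * of_nat (Suc j))"
    by (simp add: algebra_simps)
  finally show ?case .
qed

section \<open>Nonvanishing of products of minors\<close>

lemma D_minor_0 [simp]: "D_minor m n 0 = 1"
  by (simp add: D_minor_def)

lemma D_prod_0 [simp]: "D_prod m n 0 l = 1"
  by (simp add: D_prod_def)

lemma D_prod_Suc: "D_prod m n (Suc p) l = D_prod m n p l * D_minor m n (Suc p) ^ l (Suc p)"
  by (simp add: D_prod_def)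

lemma D_prod_cong: "(\<And>i. 1 \<le> i \<Longrightarrow> i \<le> N \<Longrightarrow> l i = l' i) \<Longrightarrow> D_prod m n N l = D_prod m n N l'"
  unfolding D_prod_def by (intro arg_cong[where f = prod_list] map_cong refl) auto

lemma E_gl_mult_eigen:
  assumes "E_gl m n s t p = scale a p" "E_gl m n s t q = scale b q"
  shows "E_gl m n s t (p * q) = scale (a + b) (p * q)"
  using assms by (simp add: E_gl_mult scale_mult superpoly.scale_left_distrib)

lemma D_prod_weight: "E_gl m n k k (D_prod m n N l) = scale (of_nat (2 * (\<Sum>i=1..N. l i * fund_weight i k))) (D_prod m n N l)"
proof (induction N)
  case (Suc N)
  have "E_gl m n k k (D_minor m n (Suc N) ^ l (Suc N)) =
      scale (of_nat (l (Suc N)) * (if k < Suc N then 2 else 0)) (D_minor m n (Suc N) ^ l (Suc N))"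
    by (rule E_gl_power[OF E_gl_D_minor_weight])
  from E_gl_mult_eigen[OF Suc this] show ?case
    by (auto simp: D_prod_Suc fund_weight_def algebra_simps)
qed simp

lemma D_prod_raise: "i < j \<Longrightarrow> E_gl m n i j (D_prod m n N l) = 0"
proof (induction N)
  case (Suc N)
  have "E_gl m n i j (D_minor m n (Suc N) ^ l (Suc N)) = 0"
    using E_gl_power[of m n i j "D_minor m n (Suc N)" 0] E_gl_D_minor_raise[OF Suc.prems] by simp
  then show ?case using Suc by (simp add: D_prod_Suc E_gl_mult)
qed simp

text \<open>The factors D(p) are traded for D(p + 1) one at a time: the Laplacian undoes one
  exchange up to the Cayley constant, so nonvanishing propagates upwards as long as that constant is
  nonzero.\<close>

lemma D_minor_power_nonzero:
  assumes p: "m \<le> p" and r: "r \<le> n"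
    and h: "E_gl m n p p h = 0" "\<And>s. s < p \<Longrightarrow> E_gl m n s p h = 0"
    and nz: "D_minor m n p ^ r * h \<noteq> 0"
  shows "D_minor m n (Suc p) ^ r * h \<noteq> 0"
proof -
  let ?u = "D_minor m n (Suc p)" and ?D = "D_minor m n p"
  have "?u ^ j * (?D ^ (r - j) * h) \<noteq> 0" if "j \<le> r" for j
    using that
  proof (induction j)
    case (Suc j)
    let ?h = "?D ^ (r - Suc j) * h"
    have "E_gl m n p p (?D ^ k) = 0" for k
      using E_gl_power[OF E_gl_D_minor_weight[of m n p p], of k] by simp
    moreover have "E_gl m n s p (?D ^ k) = 0" if "s < p" for s k
      using E_gl_power[of m n s p ?D 0 k] E_gl_D_minor_raise[OF that] by simp
    ultimately have h': "E_gl m n p p ?h = 0" "\<And>s. s < p \<Longrightarrow> E_gl m n s p ?h = 0"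
      using h by (simp_all add: E_gl_mult)
    have "?D * (?u ^ j * ?h) = ?u ^ j * (?D * ?h)"
      using superpoly_even_commute[OF even_D_minor, of m n p "?u ^ j"] by (simp add: mult.assoc[symmetric])
    also have "?D * ?h = ?D ^ (r - j) * h"
    proof -
      have "r - j = Suc (r - Suc j)" using Suc.prems by simp
      then show ?thesis by (simp add: mult.assoc)
    qed
    finally have L: "Lap m n p p (?u ^ Suc j * ?h) =
        scale (2 * of_nat (Suc j) * (of_nat m - of_nat (2 * n) - of_nat p + 2 * of_nat j)) (?u ^ j * (?D ^ (r - j) * h))"
      using Lap_D_minor_power[OF h', of j] by simp
    \<comment> \<open>At this point \<open>j < r \<le> n\<close> and \<open>p \<ge> m\<close>, so
      the left side is strictly smaller.\<close>
    have "of_nat m + 2 * of_nat j \<noteq> (of_nat (2 * n) + of_nat p :: complex)"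
    proof
      assume "of_nat m + 2 * of_nat j = (of_nat (2 * n) + of_nat p :: complex)"
      then have "of_nat (m + 2 * j) = (of_nat (2 * n + p) :: complex)" by simp
      then have "m + 2 * j = 2 * n + p" by (simp only: of_nat_eq_iff)
      then show False using p r Suc.prems by simp
    qed
    then have "of_nat m - of_nat (2 * n) - of_nat p + 2 * of_nat j \<noteq> (0 :: complex)"
      by (simp add: algebra_simps)
    then have "2 * of_nat (Suc j) * (of_nat m - of_nat (2 * n) - of_nat p + 2 * of_nat j) \<noteq> (0 :: complex)"
      by (simp del: of_nat_Suc of_nat_mult)
    then have "Lap m n p p (?u ^ Suc j * ?h) \<noteq> 0"
      unfolding L using Suc by (simp add: superpoly.scale_eq_0_iff del: of_nat_Suc)
    then show ?case by auto
  qed (simp add: nz)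
  from this[of r] show ?thesis by simp
qed

text \<open>Evaluation at the point whose even block is the identity pattern and whose odd part is
  0; all minors of size at most \<open>m\<close> take the value 1 there.\<close>

definition diagonal_eval :: "index superpoly \<Rightarrow> index superpoly" where
  "diagonal_eval = subst_hom (\<lambda>i. case i of Index a t \<Rightarrow> if a = t then 1 else 0) (\<lambda>i. 0)"

lemma diagonal_eval_mult: "diagonal_eval (p * q) = diagonal_eval p * diagonal_eval q"
  unfolding diagonal_eval_def
  by (rule subst_hom_mult) (auto simp: superpoly_even_def superpoly_odd_def split: index.split)

lemma diagonal_eval_simps: "diagonal_eval 1 = 1" "diagonal_eval (p + q) = diagonal_eval p + diagonal_eval q"
  "diagonal_eval (scale c p) = scale c (diagonal_eval p)"
  "diagonal_eval (Xgen m a t) = (if a < m \<and> a = t then 1 else 0)"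
  by (simp_all add: diagonal_eval_def subst_hom_simps Xgen_def)

lemma diagonal_eval_zero: "diagonal_eval 0 = 0"
  using diagonal_eval_simps(3)[of 0 0] by simp

lemma diagonal_eval_sum: "diagonal_eval (sum f S) = (\<Sum>x\<in>S. diagonal_eval (f x))"
  by (induction S rule: infinite_finite_induct) (simp_all add: diagonal_eval_zero diagonal_eval_simps)

lemma diagonal_eval_prod_list: "diagonal_eval (prod_list xs) = prod_list (map diagonal_eval xs)"
  by (induction xs) (simp_all add: diagonal_eval_mult diagonal_eval_simps)

lemma diagonal_eval_power: "diagonal_eval (p ^ k) = diagonal_eval p ^ k"
  by (induction k) (simp_all add: diagonal_eval_mult diagonal_eval_simps)

lemma diagonal_eval_q_elem:
  assumes "t < m"
  shows "diagonal_eval (q_elem m n t s) = (if t = s then 1 else 0)"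
proof -
  have "scale (kv m n a) ((if a < m \<and> a = t then 1 else 0) * (if star m n a < m \<and> star m n a = s then 1 else 0)) =
      (if a = t then if t = s then 1 else 0 else (0 :: index superpoly))" for a
    using assms by (auto simp: star_def kv_def)
  then show ?thesis
    using assms by (simp only: q_elem_eq diagonal_eval_sum diagonal_eval_simps diagonal_eval_mult) simp
qed

lemma diagonal_eval_D_minor:
  assumes "k \<le> m"
  shows "diagonal_eval (D_minor m n k) = 1"
proof -
  have "diagonal_eval (prod_list (map (\<lambda>i. q_elem m n i (\<sigma> i)) [0..<k])) = (if \<sigma> = id then 1 else 0)"
    if \<sigma>: "\<sigma> permutes {..<k}" for \<sigma>
  proof (cases "\<sigma> = id")
    case True
    have "prod_list (map (\<lambda>i. diagonal_eval (q_elem m n i i)) xs) = 1" if "set xs \<subseteq> {..<m}" for xs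
      using that by (induction xs) (auto simp: diagonal_eval_q_elem)
    moreover have "set [0..<k] \<subseteq> {..<m}" using assms by auto
    ultimately have "prod_list (map (\<lambda>i. diagonal_eval (q_elem m n i i)) [0..<k]) = 1" by blast
    then show ?thesis using True
      by (simp add: diagonal_eval_prod_list comp_def)
  next
    case False
    then obtain i where i: "\<sigma> i \<noteq> i" by (auto simp: fun_eq_iff)
    then have "i < k" using \<sigma> by (auto simp: permutes_def)
    then have "diagonal_eval (q_elem m n i (\<sigma> i)) = 0" using i assms by (simp add: diagonal_eval_q_elem)
    then show ?thesis using False \<open>i < k\<close>
      by (simp add: diagonal_eval_prod_list comp_def prod_list_zero[of i])
  qed
  then have "diagonal_eval (D_minor m n k) = (\<Sum>\<sigma> | \<sigma> permutes {..<k}. if \<sigma> = id then 1 else 0)"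
    unfolding D_minor_eq diagonal_eval_sum diagonal_eval_simps by (intro sum.cong refl) auto
  then show ?thesis by (simp add: finite_permutations permutes_id)
qed

text \<open>For sizes up to \<open>m\<close> a single evaluation suffices. Beyond that, the exponent
  of the largest minor is moved down to the next smaller one, where the induction hypothesis
  applies, and the exchange lemma brings it back up.\<close>

lemma D_prod_nonzero:
  assumes "(\<Sum>i\<in>{m<..N}. l i) \<le> n"
  shows "D_prod m n N l \<noteq> 0"
  using assms
proof (induction N arbitrary: l)
  case (Suc p)
  show ?case
  proof (cases "Suc p \<le> m")
    case True
    have "k \<le> m \<Longrightarrow> diagonal_eval (D_prod m n k l) = 1" for k
      by (induction k) (simp_all add: D_prod_Suc diagonal_eval_mult diagonal_eval_power diagonal_eval_D_minor diagonal_eval_simps)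
    from this[OF True] show ?thesis using diagonal_eval_zero by force
  next
    case False
    define r where "r = l (Suc p)"
    have split: "{m<..Suc p} = insert (Suc p) {m<..p}" using False by auto
    then have r: "r \<le> n" using Suc.prems by (simp add: r_def)
    have "D_minor m n p ^ r * D_prod m n p l \<noteq> 0"
    proof (cases p)
      case (Suc p')
      \<comment> \<open>The exponent \<open>r\<close> moves from \<open>Suc p\<close> to
        \<open>p\<close>. The sum of the exponents beyond \<open>m\<close> is unchanged, except that
        for \<open>p = m\<close> the moved exponent is no longer counted.\<close>
      define l' where "l' = l(p := l p + r)"
      have "D_prod m n p' l = D_prod m n p' l'" by (rule D_prod_cong) (auto simp: l'_def Suc)
      then have "D_prod m n p l' = D_prod m n p l * D_minor m n p ^ r"
        by (simp add: Suc D_prod_Suc l'_def power_add mult.assoc)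
      moreover have "(\<Sum>i\<in>{m<..p}. l' i) \<le> n"
      proof (cases "p = m")
        case False
        then have "p \<in> {m<..p}" using \<open>\<not> Suc p \<le> m\<close> by simp
        then have "(\<Sum>i\<in>{m<..p}. l' i) = (\<Sum>i\<in>{m<..p}. l i) + r"
          by (simp add: sum.remove[of "{m<..p}" p] l'_def)
        then show ?thesis using Suc.prems by (simp add: split r_def)
      qed simp
      then have "D_prod m n p l' \<noteq> 0" by (rule Suc.IH)
      ultimately show ?thesis
        using superpoly_even_commute[OF even_D_prod, of m n p l "D_minor m n p ^ r"] by simp
    qed simp
    moreover have "E_gl m n p p (D_prod m n p l) = 0"
      by (simp add: D_prod_weight fund_weight_def)
    ultimately have "D_minor m n (Suc p) ^ r * D_prod m n p l \<noteq> 0"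
      using False r D_prod_raise by (intro D_minor_power_nonzero) simp_all
    then show ?thesis
      using superpoly_even_commute[OF even_D_prod, of m n p l "D_minor m n (Suc p) ^ r"]
      by (simp add: D_prod_Suc r_def)
  qed
qed simp

text \<open>With parts numbered from 0, the part at \<open>m\<close> is twice the sum of the
  exponents beyond \<open>m\<close>; the hook condition is therefore the hypothesis of
  \<open>D_prod_nonzero\<close>.\<close>

lemma fund_weight_sum:
  assumes "\<And>k. \<mu> k = 2 * (\<Sum>i=1..N. l i * fund_weight i k)"
  shows "\<mu> k = 2 * (\<Sum>i\<in>{k<..N}. l i)"
proof -
  have "(\<Sum>i=1..N. l i * fund_weight i k) = (\<Sum>i\<in>{k<..N}. l i)"
    by (rule sum.mono_neutral_cong_right) (auto simp: fund_weight_def)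
  then show ?thesis using assms by simp
qed

lemma D_prod_highest_weight:
  assumes "\<mu> \<in> even_hook_partitions m n N" and l: "\<And>k. \<mu> k = 2 * (\<Sum>i=1..N. l i * fund_weight i k)"
  shows "highest_weight_vector m n N \<mu> (D_prod m n N l)"
proof -
  have "\<mu> m \<le> 2 * n" using assms(1) by (simp add: even_hook_partitions_def)
  then have "D_prod m n N l \<noteq> 0" using fund_weight_sum[OF l, of m] by (intro D_prod_nonzero) simp
  then show ?thesis
    unfolding highest_weight_vector_def l using D_prod_weight D_prod_raise by blast
qed

lemma exists_fund_weight_coeffs:
  assumes "\<mu> \<in> even_hook_partitions m n N"
  shows "\<exists>l. \<forall>k. \<mu> k = 2 * (\<Sum>i=1..N. l i * fund_weight i k)"
proof -
  have dec: "\<And>i j. i \<le> j \<Longrightarrow> \<mu> j \<le> \<mu> i" and z: "\<And>k. k \<ge> N \<Longrightarrow> \<mu> k = 0" and ev: "\<And>k. even (\<mu> k)"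
    using assms by (auto simp: even_hook_partitions_def partitions_length_le_def)
  \<comment> \<open>Half the drop between consecutive parts; the sums telescope down to the part at
    \<open>N\<close>, which is 0.\<close>
  define l where "l i = (\<mu> (i - 1) - \<mu> i) div 2" for i
  have tel: "2 * (\<Sum>i\<in>{k<..k + d}. l i) + \<mu> (k + d) = \<mu> k" for k d
  proof (induction d)
    case (Suc d)
    have "{k<..k + Suc d} = insert (Suc (k + d)) {k<..k + d}" by auto
    moreover have "2 * l (Suc (k + d)) + \<mu> (Suc (k + d)) = \<mu> (k + d)"
      using dec[of "k + d" "Suc (k + d)"] ev by (simp add: l_def)
    ultimately show ?case using Suc by simp
  qed simp
  have "\<mu> k = 2 * (\<Sum>i=1..N. l i * fund_weight i k)" for k
  proof -
    have "(\<Sum>i=1..N. l i * fund_weight i k) = (\<Sum>i\<in>{k<..N}. l i)"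
      by (rule sum.mono_neutral_cong_right) (auto simp: fund_weight_def)
    then show ?thesis using tel[of k "N - k"] z[of k] z[of "k + (N - k)"] by (cases "k \<le> N") auto
  qed
  then show ?thesis by blast
qed

section \<open>The submodule generated by a highest weight vector\<close>

text \<open>Only lowering operators are applied, yet the span will be closed under all of
  \<open>gl_N\<close>, as for a cyclic module over the lower triangular part. This form makes
  orthogonality to another highest weight vector immediate.\<close>

inductive_set lowering_words :: "nat \<Rightarrow> nat \<Rightarrow> nat \<Rightarrow> index superpoly \<Rightarrow> index superpoly set"
  for m n N :: nat and v :: "index superpoly" where
  base: "v \<in> lowering_words m n N v"
| lower: "x \<in> lowering_words m n N v \<Longrightarrow> j < i \<Longrightarrow> i < N \<Longrightarrow> E_gl m n i j x \<in> lowering_words m n N v"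

definition hw_module :: "nat \<Rightarrow> nat \<Rightarrow> nat \<Rightarrow> index superpoly \<Rightarrow> index superpoly set" where
  "hw_module m n N v = superpoly.span (lowering_words m n N v)"

lemma span_closed_linear:
  assumes "x \<in> superpoly.span S" "superpoly.subspace U" "\<And>p q. f (p + q) = f p + f q" "\<And>c p. f (scale c p) = scale c (f p)"
    and "\<And>x. x \<in> S \<Longrightarrow> f x \<in> U"
  shows "f x \<in> U"
  using assms(1)
proof (induction rule: superpoly.span_induct_alt)
  case base
  have "f 0 = 0" using assms(4)[of 0 0] by simp
  then show ?case using superpoly.subspace_0[OF assms(2)] by simp
next
  case (step c x y)
  then show ?case by (simp add: assms superpoly.subspace_add superpoly.subspace_scale)
qed

text \<open>A raising or diagonal operator is commuted past the outermost lowering operator. The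
  commutator is again an operator of \<open>gl_N\<close> on the shorter word, covered by induction
  or by closure under lowering.\<close>

lemma hw_module_raise:
  assumes hw: "highest_weight_vector m n N lam v" and x: "x \<in> lowering_words m n N v"
  shows "k \<le> l \<Longrightarrow> l < N \<Longrightarrow> E_gl m n k l x \<in> hw_module m n N v"
  using x
proof (induction arbitrary: k l)
  case base
  have v: "v \<in> hw_module m n N v" unfolding hw_module_def by (intro superpoly.span_base lowering_words.base)
  show ?case
  proof (cases "k = l")
    case True
    then have "E_gl m n k l v = scale (of_nat (lam k)) v" using hw base by (simp add: highest_weight_vector_def)
    then show ?thesis using v by (simp add: hw_module_def superpoly.span_scale)
  next
    case False
    then have "E_gl m n k l v = 0" using hw base by (simp add: highest_weight_vector_def)
    then show ?thesis by (simp add: hw_module_def superpoly.span_zero)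
  qed
next
  case (lower x j i)
  let ?S = "hw_module m n N v"
  have low: "E_gl m n s t y \<in> ?S" if "t < s" "s < N" "y \<in> ?S" for s t y
    using that(3) unfolding hw_module_def
    by (rule span_closed_linear) (use that in \<open>auto simp: E_gl_add E_gl_scale intro: superpoly.span_base lowering_words.lower\<close>)
  have xS: "x \<in> ?S" unfolding hw_module_def by (intro superpoly.span_base lower.hyps)
  have any: "E_gl m n s t x \<in> ?S" if "s < N" "t < N" for s t
    using lower.IH[of s t] low[of t s x] xS that by (cases "s \<le> t") auto
  have "E_gl m n k l (E_gl m n i j x) = E_gl m n i j (E_gl m n k l x) +
      (if l = i then E_gl m n k j x else 0) - (if k = j then E_gl m n i l x else 0)"
    by (rule E_gl_bracket)
  moreover have "E_gl m n i j (E_gl m n k l x) \<in> ?S"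
    by (rule low[OF lower.hyps(2,3) any]) (use lower.prems in auto)
  moreover have "(if l = i then E_gl m n k j x else 0) \<in> ?S" "(if k = j then E_gl m n i l x else 0) \<in> ?S"
  proof -
    have "0 \<in> ?S" by (simp add: hw_module_def superpoly.span_zero)
    moreover have "j < N" "k < N" using lower by simp_all
    ultimately show "(if l = i then E_gl m n k j x else 0) \<in> ?S" "(if k = j then E_gl m n i l x else 0) \<in> ?S"
      using any lower by simp_all
  qed
  ultimately show ?case
    unfolding hw_module_def by (simp only: superpoly.span_add superpoly.span_diff)
qed

lemma hw_module_E_gl:
  assumes hw: "highest_weight_vector m n N lam v" and x: "x \<in> hw_module m n N v" and st: "s < N" "t < N"
  shows "E_gl m n s t x \<in> hw_module m n N v"
  using x unfolding hw_module_def
proof (rule span_closed_linear)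
  show "E_gl m n s t y \<in> superpoly.span (lowering_words m n N v)" if "y \<in> lowering_words m n N v" for y
    using hw_module_raise[OF hw that, of s t] lowering_words.lower[OF that, of t s] st
    by (cases "s \<le> t") (auto simp: hw_module_def intro: superpoly.span_base)
qed (auto simp: E_gl_add E_gl_scale)

lemma hw_module_base: "v \<in> hw_module m n N v"
  unfolding hw_module_def by (intro superpoly.span_base lowering_words.base)

lemma hw_module_least:
  assumes U: "superpoly.subspace U" "v \<in> U" "\<And>s t p. s < N \<Longrightarrow> t < N \<Longrightarrow> p \<in> U \<Longrightarrow> E_gl m n s t p \<in> U"
  shows "hw_module m n N v \<subseteq> U"
proof -
  have "x \<in> U" if "x \<in> lowering_words m n N v" for x
    using that by induction (use U in auto)
  then show ?thesis unfolding hw_module_def by (intro superpoly.span_minimal U(1)) auto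
qed

lemma gl_submodule_hw_module:
  assumes "highest_weight_vector m n N lam v" "v \<in> sym_superalg m n N"
  shows "gl_submodule m n N (hw_module m n N v)"
proof -
  have "hw_module m n N v \<subseteq> sym_superalg m n N"
    by (rule hw_module_least) (use assms(2) subspace_sym sym_E_gl in auto)
  then show ?thesis
    using hw_module_E_gl[OF assms(1)] by (simp add: gl_submodule_def hw_module_def superpoly.subspace_span)
qed

lemma subspace_orthogonal: "superpoly.subspace {p. herm w p = 0}"
  by (auto simp: superpoly.subspace_def herm_add_right herm_scale_right)

text \<open>The generators are orthogonal because a self-adjoint diagonal operator has different
  eigenvalues on them. A lowering operator on one side becomes a raising operator killing the
  generator on the other; the remaining operators are moved across by adjointness.\<close>

lemma hw_modules_orthogonal:
  assumes v: "highest_weight_vector m n N lam v" and w: "highest_weight_vector m n N mu w"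
    and ne: "i < N" "lam i \<noteq> mu i" and x: "x \<in> hw_module m n N v" and y: "y \<in> hw_module m n N w"
  shows "herm x y = 0"
proof -
  have vw: "herm v w = 0"
  proof -
    have "of_nat (lam i) * herm v w = of_nat (mu i) * herm v w"
      using v w ne(1) herm_E_gl[of m n i i v w]
      by (simp add: highest_weight_vector_def herm_scale_left herm_scale_right)
    then show ?thesis using ne(2) by simp
  qed
  have 1: "herm v y = 0" if "y \<in> hw_module m n N w" for y
  proof -
    have "herm v y = 0" if "y \<in> lowering_words m n N w" for y
      using that
    proof cases
      case (lower x j i)
      have "herm v (E_gl m n i j x) = herm (E_gl m n j i v) x" by (simp add: herm_E_gl)
      also have "E_gl m n j i v = 0" using v lower by (simp add: highest_weight_vector_def)
      finally show ?thesis using lower by simp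
    qed (simp add: vw)
    then have "hw_module m n N w \<subseteq> {p. herm v p = 0}"
      unfolding hw_module_def by (intro superpoly.span_minimal subspace_orthogonal) auto
    then show ?thesis using that by auto
  qed
  have "hw_module m n N v \<subseteq> {p. \<forall>y\<in>hw_module m n N w. herm p y = 0}"
  proof (rule hw_module_least)
    show "superpoly.subspace {p. \<forall>y\<in>hw_module m n N w. herm p y = 0}"
      by (auto simp: superpoly.subspace_def herm_add_left herm_scale_left)
    show "E_gl m n s t p \<in> {p. \<forall>y\<in>hw_module m n N w. herm p y = 0}"
      if "s < N" "t < N" "p \<in> {p. \<forall>y\<in>hw_module m n N w. herm p y = 0}" for s t p
      using that hw_module_E_gl[OF w _ that(2,1)] by (simp add: herm_E_gl)
  qed (use 1 in auto)
  then show ?thesis using x y by auto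
qed

section \<open>The decomposition\<close>

lemma submodule_contains_highest_weight:
  assumes U: "gl_submodule m n N U" "U \<noteq> {0}" "U \<subseteq> osp_invariants m n N"
  shows "\<exists>v\<in>U. \<exists>\<mu>\<in>even_hook_partitions m n N. highest_weight_vector m n N \<mu> v"
proof -
  have S: "superpoly.subspace U" using U(1) by (simp add: gl_submodule_def)
  then have "0 \<in> U" by (rule superpoly.subspace_0)
  then have "\<exists>p\<in>U. p \<noteq> 0" using U(2) by auto
  moreover have "E_gl m n i j p \<in> U" if "i \<le> j" "j < N" "p \<in> U" for i j p
    using U(1) that by (simp add: gl_submodule_def)
  ultimately obtain v lam where v: "v \<in> U" "v \<noteq> 0" "\<forall>i\<in>{0..<N}. E_gl m n i i v = scale (of_nat (lam i)) v"
    "\<forall>j\<in>{0..<N}. \<forall>i\<in>{0..<j}. E_gl m n i j v = 0"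
    using exists_highest_weight_vector[OF S, of 0 N m n] by blast
  \<comment> \<open>The eigenvalues determine \<open>lam\<close> only below \<open>N\<close>;
    cutting it off there makes it a partition.\<close>
  define \<mu> where "\<mu> k = (if k < N then lam k else 0)" for k
  have hw: "highest_weight_vector m n N \<mu> v" using v by (simp add: highest_weight_vector_def \<mu>_def)
  have vW: "v \<in> osp_invariants m n N" using v(1) U(3) by blast
  have "\<mu> j \<le> \<mu> i" if "i \<le> j" for i j
    using highest_weight_decreasing[OF hw that] by (cases "j < N") (auto simp: \<mu>_def)
  moreover have "even (\<mu> k)" for k
    using invariant_highest_weight(1)[OF vW hw, of k] by (cases "k < N") (auto simp: \<mu>_def)
  moreover have "\<mu> m \<le> 2 * n"
    using invariant_highest_weight(2)[OF vW hw] by (cases "m < N") (auto simp: \<mu>_def)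
  ultimately have "\<mu> \<in> even_hook_partitions m n N"
    by (auto simp: even_hook_partitions_def partitions_length_le_def \<mu>_def)
  then show ?thesis using hw v(1) by blast
qed

lemma even_hook_partitions_neq:
  assumes "\<mu> \<in> even_hook_partitions m n N" "\<nu> \<in> even_hook_partitions m n N" "\<mu> \<noteq> \<nu>"
  shows "\<exists>i<N. \<mu> i \<noteq> \<nu> i"
proof (rule ccontr)
  assume "\<not> ?thesis"
  then have "\<mu> i = \<nu> i" for i
    using assms(1,2) by (cases "i < N") (auto simp: even_hook_partitions_def partitions_length_le_def)
  then show False using assms(3) by auto
qed

text \<open>Truncation by total degree: its intersection with the superalgebra is finite-dimensional
  and stable under \<open>gl_N\<close>, so orthogonal projections exist there and respect the module
  structure.\<close>

definition degree_le :: "nat \<Rightarrow> nat \<Rightarrow> index superpoly set" where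
  "degree_le m d = {p. \<forall>e>int d. proj m (\<lambda>_ _. 1) e p = 0}"

lemma subspace_degree_le: "superpoly.subspace (degree_le m d)"
  by (auto simp: superpoly.subspace_def degree_le_def proj_add proj_scale)

lemma degree_le_E_gl: "p \<in> degree_le m d \<Longrightarrow> E_gl m n s t p \<in> degree_le m d"
  by (simp add: degree_le_def E_gl_def proj_sum proj_X_dX)

lemma wdeg_one: "wdeg m (\<lambda>_ _. 1) u = int (size (fst u)) + int (fcard (snd u))"
proof -
  have 1: "(\<lambda>i. case i of Index a t \<Rightarrow> (1 :: int)) = (\<lambda>i. 1)" by (auto split: index.split)
  have 2: "(\<Sum>i\<in>#M. 1 :: int) = int (size M)" for M :: "index multiset" by (induction M) auto
  show ?thesis unfolding wdeg_def 1 2 by (simp add: fcard.rep_eq)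
qed

lemma exists_degree_le: "\<exists>d. p \<in> degree_le m d"
proof -
  define d where "d = (\<Sum>u\<in>ssupport p. size (fst u) + fcard (snd u))"
  have "p \<in> degree_le m d"
    unfolding degree_le_def
  proof (intro CollectI allI impI superpoly_eqI)
    fix e u assume e: "e > int d"
    show "scoeff (proj m (\<lambda>_ _. 1) e p) u = scoeff 0 u"
    proof (cases "u \<in> ssupport p")
      case True
      then have "size (fst u) + fcard (snd u) \<le> d" unfolding d_def by (intro member_le_sum) auto
      then show ?thesis using e by (simp add: scoeff_proj wdeg_one)
    qed (simp add: scoeff_proj in_support_iff)
  qed
  then show ?thesis ..
qed

lemma degree_le_finite_span: "\<exists>S. finite S \<and> sym_superalg m n N \<inter> degree_le m d \<subseteq> superpoly.span S"
proof -
  define I where "I = {Index a t | a t. a < m \<and> t < N}"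
  define J where "J = {Index a t | a t. a < 2 * n \<and> t < N}"
  have fin: "finite {Index a t | a t. a < x \<and> t < N}" for x
  proof -
    have "{Index a t | a t. a < x \<and> t < N} = (\<lambda>(a, t). Index a t) ` ({..<x} \<times> {..<N})" by auto
    then show ?thesis by simp
  qed
  define M where "M = mset ` {xs. set xs \<subseteq> I \<and> length xs \<le> d} \<times> {A. fset A \<subseteq> J}"
  have "{A. fset A \<subseteq> J} = fset -` Pow J" by auto
  moreover have "finite (fset -` Pow J)"
  proof (rule finite_vimageI)
    show "finite (Pow J)" using fin[of "2 * n"] by (simp add: J_def)
    show "inj fset" by (simp add: inj_on_def fset_inject)
  qed
  ultimately have "finite {A. fset A \<subseteq> J}" by simp
  then have "finite M" using fin by (simp add: M_def I_def finite_lists_length_le)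
  moreover have "p \<in> superpoly.span (smon ` M)" if p: "p \<in> sym_superalg m n N" "p \<in> degree_le m d" for p
  proof -
    have "u \<in> M" if u: "u \<in> ssupport p" for u
    proof -
      have nz: "scoeff p u \<noteq> 0" using u by (simp add: in_support_iff)
      have sub: "set_mset (fst u) \<subseteq> I" "fset (snd u) \<subseteq> J"
        using mono_spanD[OF p(1)[unfolded sym_superalg_eq] nz] by (auto simp: I_def J_def)
      have "size (fst u) \<le> d"
      proof (rule ccontr)
        assume "\<not> size (fst u) \<le> d"
        then have "wdeg m (\<lambda>_ _. 1) u > int d" by (simp add: wdeg_one)
        then have "proj m (\<lambda>_ _. 1) (wdeg m (\<lambda>_ _. 1) u) p = 0" using p(2) by (simp add: degree_le_def)
        then show False using nz scoeff_proj[of m "\<lambda>_ _. 1" "wdeg m (\<lambda>_ _. 1) u" p u] by simp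
      qed
      moreover obtain xs where xs: "mset xs = fst u" using ex_mset by blast
      have "length xs = size (fst u)" "set xs = set_mset (fst u)" unfolding xs[symmetric] by simp_all
      ultimately have "fst u \<in> mset ` {xs. set xs \<subseteq> I \<and> length xs \<le> d}"
        using sub(1) xs by (intro image_eqI[of _ _ xs]) simp_all
      then have "(fst u, snd u) \<in> M" using sub(2) unfolding M_def by blast
      then show ?thesis by simp
    qed
    then show ?thesis
      by (subst superpoly_expand[of p]) (intro superpoly.span_sum superpoly.span_scale superpoly.span_base, auto)
  qed
  ultimately show ?thesis by (intro exI[of _ "smon ` M"]) auto
qed

lemma orthogonal_projection_subspace:
  assumes B: "superpoly.subspace B" "B \<subseteq> superpoly.span S" "finite S"
  shows "\<exists>b\<in>B. \<forall>x\<in>B. herm (p - b) x = 0"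
proof -
  obtain B0 where B0: "B0 \<subseteq> B" "superpoly.independent B0" "B \<subseteq> superpoly.span B0"
    using superpoly.maximal_independent_subset[of B] by blast
  have "finite B0" using superpoly.independent_span_bound[OF B(3) B0(2)] B0(1) B(2) by blast
  moreover have "superpoly.span B0 = B" using B0 B(1) by (metis subset_antisym superpoly.span_minimal)
  ultimately show ?thesis using exists_orthogonal_projection by blast
qed

text \<open>Pairing a vanishing sum with one of its terms leaves the squared norm of that
  term.\<close>

lemma internal_direct_sum_orthogonal:
  fixes L :: "'k \<Rightarrow> index superpoly set"
  assumes L: "\<And>k. k \<in> K \<Longrightarrow> superpoly.subspace (L k)"
    and orth: "\<And>k l x y. k \<in> K \<Longrightarrow> l \<in> K \<Longrightarrow> k \<noteq> l \<Longrightarrow> x \<in> L k \<Longrightarrow> y \<in> L l \<Longrightarrow> herm x y = 0"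
    and W: "W = superpoly.span (\<Union>k\<in>K. L k)"
  shows "internal_direct_sum K L W"
proof -
  let ?S = "{(\<Sum>k\<in>F. v k) | F v. finite F \<and> F \<subseteq> K \<and> (\<forall>k \<in> F. v k \<in> L k)}"
  have "superpoly.subspace ?S"
    unfolding superpoly.subspace_def
  proof (intro conjI ballI allI)
    show "0 \<in> ?S" by (intro CollectI exI[of _ "{}"]) auto
    fix x assume "x \<in> ?S"
    then obtain F v where x: "x = (\<Sum>k\<in>F. v k)" "finite F" "F \<subseteq> K" "\<forall>k\<in>F. v k \<in> L k" by blast
    have "\<forall>k\<in>F. scale c (v k) \<in> L k" for c
      using x(3,4) superpoly.subspace_scale[OF L] by blast
    then show "scale c x \<in> ?S" for c
      using x(1-3) by (intro CollectI exI[of _ F] exI[of _ "\<lambda>k. scale c (v k)"]) (auto simp: superpoly.scale_sum_right)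
    fix y assume "y \<in> ?S"
    then obtain G w where y: "y = (\<Sum>k\<in>G. w k)" "finite G" "G \<subseteq> K" "\<forall>k\<in>G. w k \<in> L k" by blast
    let ?u = "\<lambda>k. (if k \<in> F then v k else 0) + (if k \<in> G then w k else 0)"
    have "(\<Sum>k\<in>F \<union> G. ?u k) = x + y"
    proof -
      have "(\<Sum>k\<in>F \<union> G. if k \<in> F then v k else 0) = x" "(\<Sum>k\<in>F \<union> G. if k \<in> G then w k else 0) = y"
        using x(1,2) y(1,2) by (auto simp: sum.inter_restrict[symmetric] Int_absorb1 Int_absorb2)
      then show ?thesis by (simp add: sum.distrib)
    qed
    moreover have "?u k \<in> L k" if "k \<in> F \<union> G" for k
    proof -
      have S: "superpoly.subspace (L k)" using that x(3) y(3) L by blast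
      show ?thesis
        using that x(4) y(4) superpoly.subspace_0[OF S] superpoly.subspace_add[OF S] by auto
    qed
    ultimately show "x + y \<in> ?S"
      using x(2,3) y(2,3) by (intro CollectI exI[of _ "F \<union> G"] exI[of _ ?u]) auto
  qed
  moreover have "(\<Union>k\<in>K. L k) \<subseteq> ?S"
  proof
    fix x assume "x \<in> (\<Union>k\<in>K. L k)"
    then obtain k where "k \<in> K" "x \<in> L k" by blast
    then show "x \<in> ?S" by (intro CollectI exI[of _ "{k}"] exI[of _ "\<lambda>_. x"]) auto
  qed
  ultimately have "W \<subseteq> ?S" unfolding W by (intro superpoly.span_minimal)
  moreover have "?S \<subseteq> W"
  proof
    fix x assume "x \<in> ?S"
    then obtain F v where x: "x = (\<Sum>k\<in>F. v k)" "F \<subseteq> K" "\<forall>k\<in>F. v k \<in> L k" by blast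
    show "x \<in> W"
      unfolding x(1) W by (rule superpoly.span_sum, rule superpoly.span_base) (use x(2,3) in blast)
  qed
  moreover have "v k = 0" if F: "finite F" "F \<subseteq> K" "\<forall>k\<in>F. v k \<in> L k" "(\<Sum>k\<in>F. v k) = 0" and k: "k \<in> F" for F v k
  proof -
    have "0 = herm (v k) (\<Sum>l\<in>F. v l)" using F(4) by simp
    also have "\<dots> = (\<Sum>l\<in>F. if l = k then herm (v k) (v k) else 0)"
      unfolding herm_sum_right
    proof (intro sum.cong refl)
      fix l assume "l \<in> F"
      then show "herm (v k) (v l) = (if l = k then herm (v k) (v k) else 0)"
        using orth[of k l "v k" "v l"] F(2,3) k by auto
    qed
    finally show ?thesis using F(1) k by simp
  qed
  ultimately show ?thesis unfolding internal_direct_sum_def by blast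
qed

theorem theorem2p5:
  fixes m n N :: nat
  assumes "N \<ge> 1"
  shows "is_subalgebra (osp_invariants m n N) \<and>
    (\<exists>L :: (nat \<Rightarrow> nat) \<Rightarrow> index superpoly set.
      (\<forall>\<mu> \<in> even_hook_partitions m n N. is_simple_with_highest_weight m n N \<mu> (L \<mu>)) \<and>
      internal_direct_sum (even_hook_partitions m n N) L (osp_invariants m n N) \<and>
      (\<forall>\<mu> \<in> even_hook_partitions m n N.
        (\<exists>l :: nat \<Rightarrow> nat. \<forall>k. \<mu> k = 2 * (\<Sum>i=1..N. l i * fund_weight i k)) \<and>
        (\<forall>l :: nat \<Rightarrow> nat. (\<forall>k. \<mu> k = 2 * (\<Sum>i=1..N. l i * fund_weight i k)) \<longrightarrow>
          D_prod m n N l \<in> L \<mu> \<and> highest_weight_vector m n N \<mu> (D_prod m n N l))))"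
proof -
  let ?K = "even_hook_partitions m n N" and ?W = "osp_invariants m n N"
  have W: "superpoly.subspace ?W" "gl_submodule m n N ?W"
    using subalgebra_osp_invariants gl_submodule_osp_invariants by (auto simp: is_subalgebra_def)
  have "\<exists>v. \<forall>\<mu>\<in>?K. v \<mu> \<in> ?W \<and> highest_weight_vector m n N \<mu> (v \<mu>)"
  proof (rule bchoice, rule ballI)
    fix \<mu> assume \<mu>: "\<mu> \<in> ?K"
    then obtain l where "\<And>k. \<mu> k = 2 * (\<Sum>i=1..N. l i * fund_weight i k)" using exists_fund_weight_coeffs by blast
    then have "highest_weight_vector m n N \<mu> (D_prod m n N l)" by (rule D_prod_highest_weight[OF \<mu>])
    then show "\<exists>v. v \<in> ?W \<and> highest_weight_vector m n N \<mu> v" using D_prod_invariant by blast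
  qed
  then obtain v where v: "\<And>\<mu>. \<mu> \<in> ?K \<Longrightarrow> v \<mu> \<in> ?W" "\<And>\<mu>. \<mu> \<in> ?K \<Longrightarrow> highest_weight_vector m n N \<mu> (v \<mu>)"
    by blast
  define L where "L \<mu> = hw_module m n N (v \<mu>)" for \<mu>
  have vL: "v \<mu> \<in> L \<mu>" for \<mu> by (simp add: L_def hw_module_base)
  have subL: "superpoly.subspace (L \<mu>)" for \<mu> by (simp add: L_def hw_module_def superpoly.subspace_span)
  have LW: "L \<mu> \<subseteq> ?W" if "\<mu> \<in> ?K" for \<mu>
    unfolding L_def using W v(1)[OF that] by (intro hw_module_least) (auto simp: gl_submodule_def)
  have modL: "gl_submodule m n N (L \<mu>)" if "\<mu> \<in> ?K" for \<mu>
    unfolding L_def using v[OF that] osp_invariantsD(1) by (intro gl_submodule_hw_module) auto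
  \<comment> \<open>Multiplicity one in usable form: every invariant highest weight vector already
    lies in the chosen module of its weight.\<close>
  have hwL: "w \<in> L \<mu>" if "\<mu> \<in> ?K" "w \<in> ?W" "highest_weight_vector m n N \<mu> w" for \<mu> w
    using invariant_highest_weight_unique[OF that(2,3) v[OF that(1)]] vL[of \<mu>] superpoly.subspace_scale[OF subL]
    by auto
  have orth: "herm x y = 0"
    if "\<mu> \<in> ?K" "\<nu> \<in> ?K" "\<mu> \<noteq> \<nu>" "x \<in> L \<mu>" "y \<in> L \<nu>" for \<mu> \<nu> x y
    using even_hook_partitions_neq[OF that(1-3)] hw_modules_orthogonal[OF v(2)[OF that(1)] v(2)[OF that(2)]] that(4,5)
    unfolding L_def by blast
  have simple: "gl_simple m n N (L \<mu>)" if \<mu>: "\<mu> \<in> ?K" for \<mu>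
    unfolding gl_simple_def
  proof (intro conjI allI impI)
    show "gl_submodule m n N (L \<mu>)" by (rule modL[OF \<mu>])
    show "L \<mu> \<noteq> {0}" using vL[of \<mu>] v(2)[OF \<mu>] by (auto simp: highest_weight_vector_def)
    fix U assume U: "gl_submodule m n N U \<and> U \<subseteq> L \<mu>"
    show "U = {0} \<or> U = L \<mu>"
    proof (rule disjCI)
      assume ne: "U \<noteq> L \<mu>"
      show "U = {0}"
      proof (rule ccontr)
        assume "U \<noteq> {0}"
        then obtain w \<nu> where w: "w \<in> U" "\<nu> \<in> ?K" "highest_weight_vector m n N \<nu> w"
          using submodule_contains_highest_weight[of m n N U] U LW[OF \<mu>] by blast
        have w0: "w \<noteq> 0" using w(3) by (simp add: highest_weight_vector_def)
        have wW: "w \<in> ?W" using w(1) U LW[OF \<mu>] by blast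
        \<comment> \<open>Otherwise \<open>w\<close> would belong to two mutually orthogonal modules
          and be orthogonal to itself.\<close>
        have "\<nu> = \<mu>"
        proof (rule ccontr)
          assume "\<nu> \<noteq> \<mu>"
          then have "herm w w = 0" using orth[OF \<mu> w(2), of w w] hwL[OF w(2) wW w(3)] w(1) U by blast
          then show False using w0 by simp
        qed
        then obtain c where c: "v \<mu> = scale c w"
          using invariant_highest_weight_unique[OF v[OF \<mu>] wW] w(3) by blast
        have "superpoly.subspace U" using U by (simp add: gl_submodule_def)
        then have "v \<mu> \<in> U" unfolding c using w(1) by (rule superpoly.subspace_scale)
        then have "L \<mu> \<subseteq> U"
          unfolding L_def using U by (intro hw_module_least) (auto simp: gl_submodule_def)
        then show False using U ne by blast
      qed
    qed
  qed
  have span: "?W = superpoly.span (\<Union>\<mu>\<in>?K. L \<mu>)"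
  proof
    let ?T = "superpoly.span (\<Union>\<mu>\<in>?K. L \<mu>)"
    show TW: "?T \<subseteq> ?W" using LW W(1) by (intro superpoly.span_minimal) auto
    show "?W \<subseteq> ?T"
    proof
      fix p assume p: "p \<in> ?W"
      obtain d where d: "p \<in> degree_le m d" using exists_degree_le by blast
      obtain S where S: "finite S" "sym_superalg m n N \<inter> degree_le m d \<subseteq> superpoly.span S"
        using degree_le_finite_span[of m n N d] by (elim exE conjE)
      \<comment> \<open>The projection is taken onto the part of the sum in bounded degree, since
        the whole sum need not be finite-dimensional.\<close>
      define B where "B = ?T \<inter> degree_le m d"
      have subB: "superpoly.subspace B"
        unfolding B_def by (intro superpoly.subspace_inter superpoly.subspace_span subspace_degree_le)
      have "B \<subseteq> superpoly.span S"
        using TW S(2) osp_invariantsD(1) unfolding B_def by blast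
      then obtain b where b: "b \<in> B" "\<forall>x\<in>B. herm (p - b) x = 0"
        using orthogonal_projection_subspace[OF subB _ S(1), of p] by blast
      have EB: "E_gl m n s t x \<in> B" if "s < N" "t < N" "x \<in> B" for s t x
      proof -
        have gen: "E_gl m n s t y \<in> ?T" if y: "y \<in> (\<Union>\<mu>\<in>?K. L \<mu>)" for y
        proof -
          obtain \<mu> where "\<mu> \<in> ?K" "y \<in> L \<mu>" using y by blast
          then have "E_gl m n s t y \<in> L \<mu>" using modL[of \<mu>] \<open>s < N\<close> \<open>t < N\<close> by (simp add: gl_submodule_def)
          then show ?thesis using \<open>\<mu> \<in> ?K\<close> by (intro superpoly.span_base) blast
        qed
        have "x \<in> ?T" using that(3) unfolding B_def by (rule IntD1)
        then have "E_gl m n s t x \<in> ?T"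
          by (rule span_closed_linear[OF _ superpoly.subspace_span E_gl_add E_gl_scale gen])
        then show ?thesis using that by (simp add: B_def degree_le_E_gl)
      qed
      \<comment> \<open>The orthogonal complement of \<open>B\<close> among the invariants of
        bounded degree is a submodule by adjointness. If it were nonzero, it would contain an
        invariant highest weight vector, which by \<open>hwL\<close> also lies in
        \<open>B\<close>.\<close>
      define C where "C = {c \<in> ?W \<inter> degree_le m d. \<forall>x\<in>B. herm c x = 0}"
      have "superpoly.subspace C"
        using W(1) subspace_degree_le[of m d]
        by (auto simp: superpoly.subspace_def C_def herm_add_left herm_scale_left)
      moreover have "C \<subseteq> sym_superalg m n N" using osp_invariantsD(1) by (auto simp: C_def)
      moreover have "E_gl m n s t c \<in> C" if "s < N" "t < N" "c \<in> C" for s t c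
        using that W(2) EB[OF that(2,1)] by (auto simp: C_def gl_submodule_def degree_le_E_gl herm_E_gl)
      ultimately have subC: "gl_submodule m n N C" by (simp add: gl_submodule_def)
      have bW: "b \<in> ?W" "b \<in> degree_le m d" using b(1) TW by (auto simp: B_def)
      have "p - b \<in> C"
        using b(2) superpoly.subspace_diff[OF W(1) p bW(1)] superpoly.subspace_diff[OF subspace_degree_le d bW(2)]
        by (simp add: C_def)
      moreover have "C = {0}"
      proof (rule ccontr)
        assume "C \<noteq> {0}"
        then obtain w \<nu> where w: "w \<in> C" "\<nu> \<in> ?K" "highest_weight_vector m n N \<nu> w"
          using submodule_contains_highest_weight[OF subC] by (auto simp: C_def)
        then have "w \<in> L \<nu>" using hwL by (simp add: C_def)
        then have "w \<in> B" using w by (auto simp: B_def C_def intro: superpoly.span_base)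
        then have "herm w w = 0" using w(1) by (simp add: C_def)
        then show False using w(3) by (simp add: highest_weight_vector_def)
      qed
      ultimately have "p = b" by auto
      then show "p \<in> ?T" using b(1) by (simp add: B_def)
    qed
  qed
  have "internal_direct_sum ?K L ?W"
    using subL orth span by (intro internal_direct_sum_orthogonal) auto
  moreover have "\<forall>\<mu>\<in>?K. is_simple_with_highest_weight m n N \<mu> (L \<mu>)"
    using simple vL v(2) by (auto simp: is_simple_with_highest_weight_def)
  moreover have "D_prod m n N l \<in> L \<mu> \<and> highest_weight_vector m n N \<mu> (D_prod m n N l)"
    if "\<mu> \<in> ?K" "\<forall>k. \<mu> k = 2 * (\<Sum>i=1..N. l i * fund_weight i k)" for \<mu> l
  proof -
    have "highest_weight_vector m n N \<mu> (D_prod m n N l)" using that by (intro D_prod_highest_weight) auto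
    then show ?thesis using hwL[OF that(1) D_prod_invariant] by blast
  qed
  ultimately show ?thesis
    using subalgebra_osp_invariants exists_fund_weight_coeffs by blast
qed

end
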